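(* Let $s\in(0,1)$, let $\Omega\subset\mathbb{R}^d$ be a convex polytope, $\eta_1,\eta_2\in\mathcal{C}(\lambda,\Lambda)$, $f\in C(\overline\Omega)$, and assume there is $U\in C^2(\mathbb{R}^d)$ with $\mathcal{L}_{\eta_i}[U]\ge f$ in $\Omega$ for $i=1,2$ and $U\ge0$ in $\Omega^c$. Let $u$ be the solution of $$\min\{\mathcal{L}_{\eta_1}[u],\mathcal{L}_{\eta_2}[u]\}=f\ \text{ in }\Omega,\qquad u=0\ \text{ in }\Omega^c,$$ let $\{u_k\}_{k\ge0}$ be the continuous obstacle iteration, $\{u_{h,k}\}$ the discrete obstacle iteration, and $\{\tilde u_{h,k}\}$ the auxiliary discrete functions defined in the context. Assume that there is a continuous function $\sigma:\mathbb{R}^+\to\mathbb{R}^+$ with $\sigma(h)\downarrow0$ as $h\downarrow0$ such that $$\sup_{k\in\mathbb{N}_0}\|u_k-\tilde u_{h,k}\|_{L^\infty(\Omega)}\le\sigma(h).$$ If $k\uparrow\infty$ and $h\downarrow0$ in such a way that $k\,\sigma(h)\to0$, then $u_{h,k}\to u$ uniformly.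
   Context: $\Omega^c=\mathbb{R}^d\setminus\overline\Omega$, $\delta(x)=\operatorname{dist}(x,\partial\Omega)$; functions are extended by zero outside $\Omega$. $\widetilde H^s(\Omega)$ is the space of functions in $L^2(\Omega)$ whose extension by zero belongs to $H^s(\mathbb{R}^d)$. For $0<\lambda\le\Lambda<\infty$, $\eta\in\mathcal{C}(\lambda,\Lambda)$ means $\eta:\mathbb{S}^{d-1}\to\mathbb{R}$, $\eta(\theta)=\eta(-\theta)$, $\lambda\le\eta\le\Lambda$ a.e. Solutions of the fully nonlinear problem are understood in the viscosity sense. Operators: $\mathcal{L}_\eta[w](x)=\mathrm{p.v.}\int_{\mathbb{R}^d}\frac{w(x)-w(y)}{|x-y|^{d+2s}}\eta\big(\frac{x-y}{|x-y|}\big)dy$. For $\varepsilon>0$, $\mathcal{L}_{\eta,\varepsilon}[w](x)=\frac12\int_{\mathbb{R}^d}(2w(x)-w(x-y)-w(x+y))\,\eta\big(\frac{y}{|y|}\big)\mathcal{K}_\varepsilon(|y|)dy$, where $\mathcal{K}_\varepsilon(r)=r^{-d-2s}$ for $r\ge\varepsilon$ and $\mathcal{K}_\varepsilon(r)=\varepsilon^{-d-2s}+\gamma(r^2-\varepsilon^2)+\nu(r^3-\varepsilon^3)$ for $r<\varepsilon$, with $\gamma=-\frac{(4+d)(d+2s)(3+d+2s)}{4(1-s)}\varepsilon^{-d-2s-2}$, $\nu=\frac{(5+d)(d+2s)(2+d+2s)}{6(1-s)}\varepsilon^{-d-2s-3}$. $\mathcal{L}_{\eta,\bar\varepsilon}[w](z)=\mathcal{L}_{\eta,\bar\varepsilon(z)}[w](z)$.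 Meshes: $\mathscr{T}$ ranges over a family of conforming, (uniformly) shape regular simplicial triangulations of $\Omega$ with closed elements $T$, $h_T=\operatorname{diam}T$, graded with parameters $h>0$ and fixed $\mu\ge1$: $h_T\approx h^\mu$ if $T\cap\partial\Omega\ne\emptyset$ and $h_T\approx h\operatorname{dist}(T,\partial\Omega)^{(\mu-1)/\mu}$ otherwise, with constants independent of $T,h$. Interior vertices are mesh vertices in $\Omega$; $h_z$ is the radius of the largest ball centered at $z$ contained in $\bigcup\{T:z\in T\}$. The regularization scale satisfies $\frac12h_z\le\bar\varepsilon(z)\le\frac12\delta(z)$ at interior vertices. $\mathbb{V}_h^0$ is the space of continuous functions on $\overline\Omega$, affine on each $T$, vanishing on $\partial\Omega$; $I_h$ is Lagrange interpolation. Iterations; for $k\ge1$ put $i=i(k)=(k\bmod2)+1$. Continuous: $u_0\in\widetilde H^s(\Omega)$ solves $\mathcal{L}_{\eta_1}[u_0]=f$ in $\Omega$; $u_k\in\widetilde H^s(\Omega)$ is the (weak) solution of $\min\{\mathcal{L}_{\eta_i}[u_k]-f,u_k-u_{k-1}\}=0$ in $\Omega$. Discrete: $u_{h,0}\in\mathbb{V}_h^0$ solves $\mathcal{L}_{\eta_1,\bar\varepsilon}[u_{h,0}](z)=f(z)$ for all interior vertices $z$; $u_{h,k}\in\mathbb{V}_h^0$ solves $\min\{\mathcal{L}_{\eta_i,\bar\varepsilon}[u_{h,k}](z)-f(z),u_{h,k}(z)-u_{h,k-1}(z)\}=0$ for all interior vertices $z$. Auxiliary: $\tilde u_{h,0}=u_{h,0}$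 and, for $k\ge1$, $\tilde u_{h,k}\in\mathbb{V}_h^0$ solves $\min\{\mathcal{L}_{\eta_i,\bar\varepsilon}[\tilde u_{h,k}](z)-f(z),\tilde u_{h,k}(z)-I_hu_{k-1}(z)\}=0$ for all interior vertices $z$. *)

theory Defs
  imports "HOL-Analysis.Analysis" "HOL-Probability.Essential_Supremum"
begin

text \<open>
  Functions on the unit sphere are represented by total functions \<open>\<eta>\<close> on the ambient space, only
  ever evaluated at \<open>sgn y\<close>, that is at \<open>y / |y|\<close>. Measurability and "almost everywhere" with
  respect to surface measure are expressed through Lebesgue measure on the ambient space: a subset
  of the sphere is a null set (is measurable) iff the cone over it is.
  All functions on a domain are extended by zero to the whole space.
\<close>

definition kernel_class :: "real \<Rightarrow> real \<Rightarrow> ('a::euclidean_space \<Rightarrow> real) \<Rightarrow> bool" where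
  "kernel_class lam Lam \<eta> \<longleftrightarrow>
     (\<lambda>y. \<eta> (sgn y)) \<in> borel_measurable lebesgue \<and>
     (AE y in lebesgue. \<eta> (- sgn y) = \<eta> (sgn y) \<and> lam \<le> \<eta> (sgn y) \<and> \<eta> (sgn y) \<le> Lam)"

definition C2_function :: "('a::euclidean_space \<Rightarrow> real) \<Rightarrow> bool" where
  "C2_function \<phi> \<longleftrightarrow>
     (\<exists>(g :: 'a \<Rightarrow> 'a) (D2 :: 'a \<Rightarrow> 'a \<Rightarrow>\<^sub>L 'a).
        (\<forall>x. (\<phi> has_derivative (\<lambda>v. g x \<bullet> v)) (at x)) \<and>
        (\<forall>x. (g has_derivative blinfun_apply (D2 x)) (at x)) \<and>
        continuous_on UNIV D2)"


subsection \<open>The integro-differential operator\<close>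

definition frac_integrand ::
  "real \<Rightarrow> ('a::euclidean_space \<Rightarrow> real) \<Rightarrow> ('a \<Rightarrow> real) \<Rightarrow> 'a \<Rightarrow> 'a \<Rightarrow> real" where
  "frac_integrand s \<eta> w x y =
     (w x - w y) / norm (x - y) powr (real DIM('a) + 2 * s) * \<eta> (sgn (x - y))"

definition frac_trunc ::
  "real \<Rightarrow> ('a::euclidean_space \<Rightarrow> real) \<Rightarrow> ('a \<Rightarrow> real) \<Rightarrow> 'a \<Rightarrow> real \<Rightarrow> real" where
  "frac_trunc s \<eta> w x \<rho> = (LINT y:{y. \<rho> < norm (x - y)}|lebesgue. frac_integrand s \<eta> w x y)"

text \<open>The principal value exists (in particular, the tail integrals converge) and equals \<open>l\<close>.\<close>

definition has_frac_op ::
  "real \<Rightarrow> ('a::euclidean_space \<Rightarrow> real) \<Rightarrow> ('a \<Rightarrow> real) \<Rightarrow> 'a \<Rightarrow> real \<Rightarrow> bool" where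
  "has_frac_op s \<eta> w x l \<longleftrightarrow>
     (\<forall>\<rho>>0. set_integrable lebesgue {y. \<rho> < norm (x - y)} (frac_integrand s \<eta> w x)) \<and>
     (frac_trunc s \<eta> w x \<longlongrightarrow> l) (at_right 0)"

definition frac_op ::
  "real \<Rightarrow> ('a::euclidean_space \<Rightarrow> real) \<Rightarrow> ('a \<Rightarrow> real) \<Rightarrow> 'a \<Rightarrow> real" where
  "frac_op s \<eta> w x = (THE l. has_frac_op s \<eta> w x l)"

text \<open>
  Viscosity solutions of \<open>min {L\<^sub>1 u, L\<^sub>2 u} = f\<close> in \<open>\<Omega>\<close> with \<open>u = 0\<close> outside \<open>\<Omega>\<close>. The test function
  at \<open>x\<close> is \<open>u\<close> with its values in a neighbourhood \<open>N\<close> of \<open>x\<close> replaced by those of a smooth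
  function touching \<open>u\<close> at \<open>x\<close>; it is bounded and smooth near \<open>x\<close>, so the principal value exists.
  Note the sign: \<open>L\<close> is a positive operator, like minus the Laplacian.
\<close>

definition replace_on :: "'a set \<Rightarrow> ('a \<Rightarrow> real) \<Rightarrow> ('a \<Rightarrow> real) \<Rightarrow> 'a \<Rightarrow> real" where
  "replace_on N \<phi> u y = (if y \<in> N then \<phi> y else u y)"

definition viscosity_subsolution ::
  "real \<Rightarrow> (nat \<Rightarrow> 'a::euclidean_space \<Rightarrow> real) \<Rightarrow> 'a set \<Rightarrow> ('a \<Rightarrow> real) \<Rightarrow> ('a \<Rightarrow> real) \<Rightarrow> bool" where
  "viscosity_subsolution s \<eta> \<Omega> f u \<longleftrightarrow>
     (\<forall>x N \<phi>. open N \<and> x \<in> N \<and> N \<subseteq> \<Omega> \<and> C2_function \<phi> \<and> \<phi> x = u x \<and> (\<forall>y\<in>N. u y \<le> \<phi> y) \<longrightarrow>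
        min (frac_op s (\<eta> 1) (replace_on N \<phi> u) x) (frac_op s (\<eta> 2) (replace_on N \<phi> u) x) \<le> f x)"

definition viscosity_supersolution ::
  "real \<Rightarrow> (nat \<Rightarrow> 'a::euclidean_space \<Rightarrow> real) \<Rightarrow> 'a set \<Rightarrow> ('a \<Rightarrow> real) \<Rightarrow> ('a \<Rightarrow> real) \<Rightarrow> bool" where
  "viscosity_supersolution s \<eta> \<Omega> f u \<longleftrightarrow>
     (\<forall>x N \<phi>. open N \<and> x \<in> N \<and> N \<subseteq> \<Omega> \<and> C2_function \<phi> \<and> \<phi> x = u x \<and> (\<forall>y\<in>N. \<phi> y \<le> u y) \<longrightarrow>
        min (frac_op s (\<eta> 1) (replace_on N \<phi> u) x) (frac_op s (\<eta> 2) (replace_on N \<phi> u) x) \<ge> f x)"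

definition viscosity_solution ::
  "real \<Rightarrow> (nat \<Rightarrow> 'a::euclidean_space \<Rightarrow> real) \<Rightarrow> 'a set \<Rightarrow> ('a \<Rightarrow> real) \<Rightarrow> ('a \<Rightarrow> real) \<Rightarrow> bool" where
  "viscosity_solution s \<eta> \<Omega> f u \<longleftrightarrow>
     continuous_on UNIV u \<and> (\<forall>x\<in>- closure \<Omega>. u x = 0) \<and>
     viscosity_subsolution s \<eta> \<Omega> f u \<and> viscosity_supersolution s \<eta> \<Omega> f u"


subsection \<open>Weak solutions and the continuous obstacle iteration\<close>

text \<open>
  Double integrals are taken with respect to Lebesgue measure on the product space, so that
  Lebesgue measurable (not only Borel) functions and kernels are covered.
\<close>

definition Hs_space :: "real \<Rightarrow> ('a::euclidean_space \<Rightarrow> real) set" where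
  "Hs_space s =
     {w. w \<in> borel_measurable lebesgue \<and>
         integrable lebesgue (\<lambda>x. (w x)\<^sup>2) \<and>
         integrable lebesgue
           (\<lambda>(x, y). (w x - w y)\<^sup>2 / norm (x - y) powr (real DIM('a) + 2 * s))}"

definition Hs_tilde :: "real \<Rightarrow> 'a::euclidean_space set \<Rightarrow> ('a \<Rightarrow> real) set" where
  "Hs_tilde s \<Omega> = {w \<in> Hs_space s. \<forall>x. x \<notin> \<Omega> \<longrightarrow> w x = 0}"

definition energy_form ::
  "real \<Rightarrow> ('a::euclidean_space \<Rightarrow> real) \<Rightarrow> ('a \<Rightarrow> real) \<Rightarrow> ('a \<Rightarrow> real) \<Rightarrow> real" where
  "energy_form s \<eta> w v =
     1 / 2 * (\<integral>(x, y). (w x - w y) * (v x - v y) / norm (x - y) powr (real DIM('a) + 2 * s)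
                        * \<eta> (sgn (x - y)) \<partial>lebesgue)"

definition weak_solution ::
  "real \<Rightarrow> ('a::euclidean_space \<Rightarrow> real) \<Rightarrow> 'a set \<Rightarrow> ('a \<Rightarrow> real) \<Rightarrow> ('a \<Rightarrow> real) \<Rightarrow> bool" where
  "weak_solution s \<eta> \<Omega> f w \<longleftrightarrow>
     w \<in> Hs_tilde s \<Omega> \<and>
     (\<forall>v\<in>Hs_tilde s \<Omega>. energy_form s \<eta> w v = (LINT x:\<Omega>|lebesgue. f x * v x))"

text \<open>The weak form of \<open>min {L w - f, w - \<psi>} = 0\<close> is the usual variational inequality.\<close>

definition obstacle_set :: "real \<Rightarrow> 'a::euclidean_space set \<Rightarrow> ('a \<Rightarrow> real) \<Rightarrow> ('a \<Rightarrow> real) set" where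
  "obstacle_set s \<Omega> \<psi> = {v \<in> Hs_tilde s \<Omega>. AE x in lebesgue. x \<in> \<Omega> \<longrightarrow> \<psi> x \<le> v x}"

definition weak_obstacle_solution ::
  "real \<Rightarrow> ('a::euclidean_space \<Rightarrow> real) \<Rightarrow> 'a set \<Rightarrow> ('a \<Rightarrow> real) \<Rightarrow> ('a \<Rightarrow> real) \<Rightarrow> ('a \<Rightarrow> real) \<Rightarrow> bool"
  where
  "weak_obstacle_solution s \<eta> \<Omega> f \<psi> w \<longleftrightarrow>
     w \<in> obstacle_set s \<Omega> \<psi> \<and>
     (\<forall>v\<in>obstacle_set s \<Omega> \<psi>.
        energy_form s \<eta> w (\<lambda>x. v x - w x) \<ge> (LINT x:\<Omega>|lebesgue. f x * (v x - w x)))"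

definition iter_index :: "nat \<Rightarrow> nat" where
  "iter_index k = k mod 2 + 1"

text \<open>
  The elements of the Sobolev space are only determined up to null sets; each iterate is
  represented by the function continuous in \<open>\<Omega>\<close>, since its nodal values enter the discretization.
\<close>

definition obstacle_iteration ::
  "real \<Rightarrow> (nat \<Rightarrow> 'a::euclidean_space \<Rightarrow> real) \<Rightarrow> 'a set \<Rightarrow> ('a \<Rightarrow> real) \<Rightarrow> (nat \<Rightarrow> 'a \<Rightarrow> real) \<Rightarrow> bool"
  where
  "obstacle_iteration s \<eta> \<Omega> f u \<longleftrightarrow>
     (\<forall>k. continuous_on \<Omega> (u k)) \<and>
     weak_solution s (\<eta> 1) \<Omega> f (u 0) \<and>
     (\<forall>k\<ge>1. weak_obstacle_solution s (\<eta> (iter_index k)) \<Omega> f (u (k - 1)) (u k))"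


subsection \<open>Meshes\<close>

definition conforming_mesh :: "'a::euclidean_space set \<Rightarrow> 'a set set \<Rightarrow> bool" where
  "conforming_mesh \<Omega> \<T> \<longleftrightarrow>
     triangulation \<T> \<and> (\<forall>T\<in>\<T>. int DIM('a) simplex T) \<and> \<Union>\<T> = closure \<Omega>"

definition inradius :: "'a::euclidean_space set \<Rightarrow> real" where
  "inradius T = Sup {r. 0 \<le> r \<and> (\<exists>x. cball x r \<subseteq> T)}"

text \<open>
  A family of meshes with parameters \<open>h\<close> ranging over a set \<open>H\<close>; the constants in the shape
  regularity and in the two-sided grading conditions are uniform over the family.
\<close>

definition graded_mesh_family ::
  "'a::euclidean_space set \<Rightarrow> real \<Rightarrow> real set \<Rightarrow> (real \<Rightarrow> 'a set set) \<Rightarrow> bool" where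
  "graded_mesh_family \<Omega> \<mu> H \<T> \<longleftrightarrow>
     H \<subseteq> {0<..} \<and>
     (\<forall>h\<in>H. conforming_mesh \<Omega> (\<T> h)) \<and>
     (\<exists>\<kappa>. \<forall>h\<in>H. \<forall>T\<in>\<T> h. diameter T \<le> \<kappa> * inradius T) \<and>
     (\<exists>c C. 0 < c \<and>
        (\<forall>h\<in>H. \<forall>T\<in>\<T> h.
           (let g = (if T \<inter> frontier \<Omega> \<noteq> {} then h powr \<mu>
                     else h * setdist T (frontier \<Omega>) powr ((\<mu> - 1) / \<mu>))
            in c * g \<le> diameter T \<and> diameter T \<le> C * g)))"

definition mesh_vertices :: "'a::euclidean_space set set \<Rightarrow> 'a set" where
  "mesh_vertices \<T> = {z. \<exists>T\<in>\<T>. z extreme_point_of T}"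

definition interior_vertices :: "'a::euclidean_space set \<Rightarrow> 'a set set \<Rightarrow> 'a set" where
  "interior_vertices \<Omega> \<T> = mesh_vertices \<T> \<inter> \<Omega>"

definition patch_radius :: "'a::euclidean_space set set \<Rightarrow> 'a \<Rightarrow> real" where
  "patch_radius \<T> z = Sup {r. 0 \<le> r \<and> cball z r \<subseteq> \<Union>{T \<in> \<T>. z \<in> T}}"

definition affine_function_on :: "'a::euclidean_space set \<Rightarrow> ('a \<Rightarrow> real) \<Rightarrow> bool" where
  "affine_function_on T v \<longleftrightarrow> (\<exists>a b. \<forall>x\<in>T. v x = a \<bullet> x + b)"

definition fe_space :: "'a::euclidean_space set \<Rightarrow> 'a set set \<Rightarrow> ('a \<Rightarrow> real) set" where
  "fe_space \<Omega> \<T> =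
     {v. continuous_on (closure \<Omega>) v \<and> (\<forall>T\<in>\<T>. affine_function_on T v) \<and>
         (\<forall>x. x \<notin> \<Omega> \<longrightarrow> v x = 0)}"

definition lagrange_interp :: "'a::euclidean_space set set \<Rightarrow> ('a \<Rightarrow> real) \<Rightarrow> 'a \<Rightarrow> real" where
  "lagrange_interp \<T> w =
     (THE v. (\<forall>T\<in>\<T>. affine_function_on T v) \<and> (\<forall>z\<in>mesh_vertices \<T>. v z = w z) \<and>
             (\<forall>x. x \<notin> \<Union>\<T> \<longrightarrow> v x = 0))"

definition admissible_scale ::
  "'a::euclidean_space set \<Rightarrow> 'a set set \<Rightarrow> ('a \<Rightarrow> real) \<Rightarrow> bool" where
  "admissible_scale \<Omega> \<T> eps \<longleftrightarrow>
     (\<forall>z\<in>interior_vertices \<Omega> \<T>.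
        1 / 2 * patch_radius \<T> z \<le> eps z \<and> eps z \<le> 1 / 2 * infdist z (frontier \<Omega>))"


subsection \<open>Discrete problems\<close>

definition reg_kernel :: "real \<Rightarrow> real \<Rightarrow> real \<Rightarrow> real \<Rightarrow> real" where
  "reg_kernel d s \<epsilon> r =
     (let \<gamma> = - ((4 + d) * (d + 2 * s) * (3 + d + 2 * s) / (4 * (1 - s))) * \<epsilon> powr (- d - 2 * s - 2);
          \<nu> = (5 + d) * (d + 2 * s) * (2 + d + 2 * s) / (6 * (1 - s)) * \<epsilon> powr (- d - 2 * s - 3)
      in if r \<ge> \<epsilon> then r powr (- d - 2 * s)
         else \<epsilon> powr (- d - 2 * s) + \<gamma> * (r\<^sup>2 - \<epsilon>\<^sup>2) + \<nu> * (r ^ 3 - \<epsilon> ^ 3))"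

definition reg_op ::
  "real \<Rightarrow> ('a::euclidean_space \<Rightarrow> real) \<Rightarrow> real \<Rightarrow> ('a \<Rightarrow> real) \<Rightarrow> 'a \<Rightarrow> real" where
  "reg_op s \<eta> \<epsilon> w x =
     1 / 2 * (LINT y|lebesgue. (2 * w x - w (x - y) - w (x + y)) * \<eta> (sgn y)
                               * reg_kernel (real DIM('a)) s \<epsilon> (norm y))"

definition discrete_solution ::
  "real \<Rightarrow> ('a::euclidean_space \<Rightarrow> real) \<Rightarrow> 'a set \<Rightarrow> ('a \<Rightarrow> real) \<Rightarrow> 'a set set \<Rightarrow> ('a \<Rightarrow> real) \<Rightarrow>
   ('a \<Rightarrow> real) \<Rightarrow> bool" where
  "discrete_solution s \<eta> \<Omega> f \<T> eps w \<longleftrightarrow>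
     w \<in> fe_space \<Omega> \<T> \<and> (\<forall>z\<in>interior_vertices \<Omega> \<T>. reg_op s \<eta> (eps z) w z = f z)"

definition discrete_obstacle_solution ::
  "real \<Rightarrow> ('a::euclidean_space \<Rightarrow> real) \<Rightarrow> 'a set \<Rightarrow> ('a \<Rightarrow> real) \<Rightarrow> 'a set set \<Rightarrow> ('a \<Rightarrow> real) \<Rightarrow>
   ('a \<Rightarrow> real) \<Rightarrow> ('a \<Rightarrow> real) \<Rightarrow> bool" where
  "discrete_obstacle_solution s \<eta> \<Omega> f \<T> eps \<psi> w \<longleftrightarrow>
     w \<in> fe_space \<Omega> \<T> \<and>
     (\<forall>z\<in>interior_vertices \<Omega> \<T>. min (reg_op s \<eta> (eps z) w z - f z) (w z - \<psi> z) = 0)"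

definition discrete_iteration ::
  "real \<Rightarrow> (nat \<Rightarrow> 'a::euclidean_space \<Rightarrow> real) \<Rightarrow> 'a set \<Rightarrow> ('a \<Rightarrow> real) \<Rightarrow> 'a set set \<Rightarrow>
   ('a \<Rightarrow> real) \<Rightarrow> (nat \<Rightarrow> 'a \<Rightarrow> real) \<Rightarrow> bool" where
  "discrete_iteration s \<eta> \<Omega> f \<T> eps uh \<longleftrightarrow>
     discrete_solution s (\<eta> 1) \<Omega> f \<T> eps (uh 0) \<and>
     (\<forall>k\<ge>1. discrete_obstacle_solution s (\<eta> (iter_index k)) \<Omega> f \<T> eps (uh (k - 1)) (uh k))"

definition auxiliary_functions ::
  "real \<Rightarrow> (nat \<Rightarrow> 'a::euclidean_space \<Rightarrow> real) \<Rightarrow> 'a set \<Rightarrow> ('a \<Rightarrow> real) \<Rightarrow> 'a set set \<Rightarrow>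
   ('a \<Rightarrow> real) \<Rightarrow> (nat \<Rightarrow> 'a \<Rightarrow> real) \<Rightarrow> (nat \<Rightarrow> 'a \<Rightarrow> real) \<Rightarrow> (nat \<Rightarrow> 'a \<Rightarrow> real) \<Rightarrow> bool" where
  "auxiliary_functions s \<eta> \<Omega> f \<T> eps u uh ut \<longleftrightarrow>
     ut 0 = uh 0 \<and>
     (\<forall>k\<ge>1. discrete_obstacle_solution s (\<eta> (iter_index k)) \<Omega> f \<T> eps
               (lagrange_interp \<T> (u (k - 1))) (ut k))"

definition Linf_norm :: "'a::euclidean_space set \<Rightarrow> ('a \<Rightarrow> real) \<Rightarrow> ereal" where
  "Linf_norm \<Omega> w = esssup (lebesgue_on \<Omega>) (\<lambda>x. ereal \<bar>w x\<bar>)"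

end

theory Submission
  imports Defs
begin

text \<open>
  The kernels of the regularized operators are positive, so the discrete obstacle problems satisfy a
  comparison principle and depend on the obstacle as a contraction in the maximum norm. As the
  obstacles of \<open>uh k\<close> and \<open>ut k\<close> differ at the vertices by at most \<open>\<bar>uh (k - 1) - ut (k - 1)\<bar> + \<sigma>\<close>,
  the two discrete functions differ by at most \<open>k \<sigma>\<close>.

  The iterates \<open>uc k\<close> increase and are bounded by \<open>u\<close>. They converge uniformly without any regularity
  theory: on one fixed mesh they are, uniformly in \<open>k\<close>, within \<open>\<sigma>\<close> of a space of functions determined
  by finitely many vertex values, and at each vertex the values converge. The limit is identified
  with \<open>u\<close> by comparing a weak with a viscosity solution: a mollification of the weak one is smooth,
  satisfies the same linear inequality up to a small error, and serves as a test function at the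
  maximum of the difference. Shifting it by the value \<open>c > 0\<close> of that maximum lowers it below \<open>0\<close> far
  away, where both solutions vanish, and the nonlocal operator gains a fixed multiple of \<open>c\<close>, which
  gives the contradiction.
\<close>

subsection \<open>Simplicial meshes and Lagrange interpolation\<close>

text \<open>What shapes the comparison of \<open>uc k\<close> with \<open>u\<close> is that neither
  side offers a pointwise equation: one is tested in an integral form, the other only with C2
  functions touching it. Testing the energy form with the reflected mollifier
  \<open>\<rho> (x0 - x)\<close> gives the operator of the convolution at \<open>x0\<close>, so the
  mollification obeys a classical inequality at single points. The gain from the shift does not
  depend on the mollification scale; that scale can therefore be chosen last, with errors below the
  gain. One comparison lemma serves both directions. For \<open>uc k \<le> u\<close> a single
  operator suffices: a supersolution of the minimum is one for each operator, and where
  \<open>uc k\<close> exceeds \<open>u\<close> the obstacle \<open>uc (k - 1)\<close> is inactive.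
  For the reverse bound the limit must be a supersolution for both operators, which holds because
  each of them recurs in the iteration; all functions are then negated.\<close>

lemma mesh_simplex_vertices:
  assumes "conforming_mesh \<Omega> \<T>" "T \<in> \<T>"
  obtains C where "finite C" "\<not> affine_dependent C" "convex hull C = T"
    "{z. z extreme_point_of T} = C"
proof -
  have "int DIM('a) simplex T"
    using assms by (auto simp: conforming_mesh_def)
  then obtain C where "finite C" "\<not> affine_dependent C" "T = convex hull C"
    unfolding simplex by blast
  moreover from this have "{z. z extreme_point_of T} = C"
    using extreme_point_of_convex_hull_affine_independent[of C] by auto
  ultimately show ?thesis by (intro that[of C]) simp_all
qed

lemma finite_mesh_vertices:
  assumes "conforming_mesh \<Omega> \<T>"
  shows "finite (mesh_vertices \<T>)"
proof -
  have "mesh_vertices \<T> = (\<Union>T\<in>\<T>. {z. z extreme_point_of T})"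
    by (auto simp: mesh_vertices_def)
  moreover have "finite \<T>"
    using assms by (auto simp: conforming_mesh_def triangulation_def)
  moreover have "finite {z. z extreme_point_of T}" if "T \<in> \<T>" for T
    by (rule mesh_simplex_vertices[OF assms that]) simp
  ultimately show ?thesis by auto
qed

lemma affine_function_on_convex_combination:
  assumes "affine_function_on T v" "finite C" "C \<subseteq> T" "sum m C = 1"
    "(\<Sum>c\<in>C. m c *\<^sub>R c) \<in> T"
  shows "v (\<Sum>c\<in>C. m c *\<^sub>R c) = (\<Sum>c\<in>C. m c * v c)"
proof -
  obtain a b where ab: "\<forall>x\<in>T. v x = a \<bullet> x + b"
    using assms(1) by (auto simp: affine_function_on_def)
  have "v (\<Sum>c\<in>C. m c *\<^sub>R c) = (\<Sum>c\<in>C. m c * (a \<bullet> c)) + (\<Sum>c\<in>C. m c) * b"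
    using ab assms(4,5) by (simp add: inner_sum_right)
  also have "\<dots> = (\<Sum>c\<in>C. m c * (a \<bullet> c + b))"
    by (simp add: algebra_simps sum.distrib sum_distrib_left)
  also have "\<dots> = (\<Sum>c\<in>C. m c * v c)"
    using ab assms(3) by (intro sum.cong) auto
  finally show ?thesis .
qed

text \<open>Two elements are allowed so that the lemma serves the gluing along common faces and,
  with \<open>T = T'\<close>, the uniqueness of the interpolant.\<close>

lemma affine_function_on_eq_hull:
  assumes "affine_function_on T v" "affine_function_on T' w" "finite C" "C \<subseteq> T" "C \<subseteq> T'"
    "convex T" "convex T'" "\<And>c. c \<in> C \<Longrightarrow> v c = w c" "x \<in> convex hull C"
  shows "v x = w x"
proof -
  obtain m where l: "\<forall>c\<in>C. 0 \<le> m c" "sum m C = 1" "(\<Sum>c\<in>C. m c *\<^sub>R c) = x"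
    using assms(9) unfolding convex_hull_finite[OF assms(3)] by auto
  have "convex hull C \<subseteq> T" "convex hull C \<subseteq> T'"
    using assms(4-7) by (auto simp: hull_minimal)
  then have "x \<in> T" "x \<in> T'" using assms(9) by auto
  moreover have "(\<Sum>c\<in>C. m c * v c) = (\<Sum>c\<in>C. m c * w c)"
    using assms(8) by (intro sum.cong) auto
  ultimately show ?thesis
    using affine_function_on_convex_combination[OF assms(1,3,4) l(2)]
      affine_function_on_convex_combination[OF assms(2,3,5) l(2)] l(3) by simp
qed

text \<open>Subtracting one vertex \<open>c0\<close> turns affine independence into linear
  independence, so the prescribed differences \<open>w c - w c0\<close> extend to a linear
  functional.\<close>

lemma affine_function_on_interpolating:
  fixes C :: "'a::euclidean_space set"
  assumes "finite C" "\<not> affine_dependent C"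
  shows "\<exists>v. affine_function_on (convex hull C) v \<and> (\<forall>c\<in>C. v c = w c)"
proof (cases "C = {}")
  case True
  then have "affine_function_on (convex hull C) w \<and> (\<forall>c\<in>C. w c = w c)"
    by (simp add: affine_function_on_def)
  then show ?thesis by (rule exI[of _ w])
next
  case False
  then obtain c0 where c0: "c0 \<in> C" by auto
  define B where "B = (\<lambda>x. - c0 + x) ` (C - {c0})"
  have "\<not> dependent B"
    unfolding B_def using affine_dependent_iff_dependent2[OF c0] assms(2) by blast
  from linear_independent_extend[OF this, of "\<lambda>x. w (x + c0) - w c0"]
  obtain g :: "'a \<Rightarrow> real" where g: "linear g" "\<forall>x\<in>B. g x = w (x + c0) - w c0"
    by (elim exE conjE)
  \<comment> \<open>The vector representing the functional \<open>g\<close>, which brings it into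
    the inner product form of \<open>affine_function_on\<close>.\<close>
  define a where "a = adjoint g 1"
  have ga: "g x = a \<bullet> x" for x
    using adjoint_works[OF g(1), of x 1] by (simp add: a_def inner_commute[of x])
  define v where "v x = a \<bullet> x + (w c0 - a \<bullet> c0)" for x
  have "v c = w c" if "c \<in> C" for c
  proof (cases "c = c0")
    case False
    then have "- c0 + c \<in> B" using that unfolding B_def by blast
    then have "g (- c0 + c) = w (- c0 + c + c0) - w c0" using g(2) by (rule bspec[rotated])
    then have "a \<bullet> c - a \<bullet> c0 = w c - w c0"
      unfolding ga by (simp add: inner_diff_right)
    then show ?thesis unfolding v_def by linarith
  qed (simp add: v_def)
  moreover have "affine_function_on (convex hull C) v"
    unfolding affine_function_on_def v_def by blast
  ultimately have "affine_function_on (convex hull C) v \<and> (\<forall>c\<in>C. v c = w c)" by simp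
  then show ?thesis by (rule exI[of _ v])
qed

text \<open>\<open>lagrange_interp\<close> is a definite description, so evaluating it takes
  existence and uniqueness of the interpolant. Existence glues affine pieces: conformity makes the
  intersection of two elements a common face, and a face is the hull of vertices shared by
  both.\<close>

lemma lagrange_interp_vertex:
  fixes \<Omega> :: "'a::euclidean_space set"
  assumes mesh: "conforming_mesh \<Omega> \<T>" and z: "z \<in> mesh_vertices \<T>"
  shows "lagrange_interp \<T> w z = w z"
proof -
  let ?P = "\<lambda>v. (\<forall>T\<in>\<T>. affine_function_on T v) \<and> (\<forall>z\<in>mesh_vertices \<T>. v z = w z) \<and>
             (\<forall>x. x \<notin> \<Union>\<T> \<longrightarrow> v x = 0)"
  have conv: "convex T" if "T \<in> \<T>" for T
    using convex_simplex mesh that by (auto simp: conforming_mesh_def)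
  have face: "T \<inter> T' face_of T" if "T \<in> \<T>" "T' \<in> \<T>" for T T'
    using mesh that by (auto simp: conforming_mesh_def triangulation_def)
  have "\<forall>T\<in>\<T>. \<exists>v. affine_function_on T v \<and> (\<forall>c. c extreme_point_of T \<longrightarrow> v c = w c)"
  proof
    fix T assume "T \<in> \<T>"
    then obtain C where "finite C" "\<not> affine_dependent C" "convex hull C = T"
      "{z. z extreme_point_of T} = C" by (rule mesh_simplex_vertices[OF mesh])
    then show "\<exists>v. affine_function_on T v \<and> (\<forall>c. c extreme_point_of T \<longrightarrow> v c = w c)"
      using affine_function_on_interpolating[of C w] by blast
  qed
  then obtain V where V: "\<And>T. T \<in> \<T> \<Longrightarrow> affine_function_on T (V T)"
    "\<And>T c. T \<in> \<T> \<Longrightarrow> c extreme_point_of T \<Longrightarrow> V T c = w c" using bchoice[of \<T>] by metis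
  have agree: "V T x = V T' x" if prem: "T \<in> \<T>" "T' \<in> \<T>" "x \<in> T" "x \<in> T'" for T T' x
  proof -
    obtain C where C: "finite C" "convex hull C = T" "{z. z extreme_point_of T} = C"
      by (rule mesh_simplex_vertices[OF mesh prem(1)])
    have F: "T \<inter> T' face_of T" "T \<inter> T' face_of T'" using face[OF prem(1,2)] face[OF prem(2,1)]
      by (simp_all add: Int_commute)
    have "polytope T" using C unfolding polytope_def by auto
    then have "polytope (T \<inter> T')" using F(1) face_of_polytope_polytope by blast
    then have K: "T \<inter> T' = convex hull {z. z extreme_point_of (T \<inter> T')}"
      by (intro Krein_Milman_Minkowski polytope_imp_compact polytope_imp_convex)
    have ext: "c extreme_point_of T" "c extreme_point_of T'" "c \<in> T" "c \<in> T'"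
      if "c extreme_point_of (T \<inter> T')" for c
      using that extreme_point_of_face[OF F(1)] extreme_point_of_face[OF F(2)] by auto
    have sub: "{z. z extreme_point_of (T \<inter> T')} \<subseteq> C"
      using ext C(3) by auto
    show ?thesis
    proof (rule affine_function_on_eq_hull[OF V(1) V(1)])
      show "finite {z. z extreme_point_of (T \<inter> T')}" using sub C(1) finite_subset by blast
      show "x \<in> convex hull {z. z extreme_point_of (T \<inter> T')}" using K prem by blast
    qed (use prem ext conv V(2) in auto)
  qed
  define v where "v x = (if x \<in> \<Union>\<T> then V (SOME T. T \<in> \<T> \<and> x \<in> T) x else 0)" for x
  have vV: "v x = V T x" if "T \<in> \<T>" "x \<in> T" for x T
  proof -
    define T' where "T' = (SOME T. T \<in> \<T> \<and> x \<in> T)"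
    have "T' \<in> \<T> \<and> x \<in> T'"
      unfolding T'_def by (rule someI[of "\<lambda>T. T \<in> \<T> \<and> x \<in> T" T]) (simp add: that)
    then have "V T' x = V T x" using agree that by blast
    moreover have "v x = V T' x" unfolding v_def T'_def using that by auto
    ultimately show ?thesis by simp
  qed
  have "?P v"
  proof (intro conjI ballI allI impI)
    fix T assume T: "T \<in> \<T>"
    then show "affine_function_on T v"
      using V(1)[OF T] vV[OF T] by (simp add: affine_function_on_def)
  next
    fix z assume "z \<in> mesh_vertices \<T>"
    then obtain T where "T \<in> \<T>" "z extreme_point_of T" by (auto simp: mesh_vertices_def)
    then show "v z = w z" using vV V(2) by (simp add: extreme_point_of_def)
  qed (auto simp: v_def)
  moreover have "v' = v" if "?P v'" for v'
  proof
    fix x show "v' x = v x"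
    proof (cases "x \<in> \<Union>\<T>")
      case True
      then obtain T where T: "T \<in> \<T>" "x \<in> T" by auto
      obtain C where C: "finite C" "convex hull C = T" "{z. z extreme_point_of T} = C"
        by (rule mesh_simplex_vertices[OF mesh T(1)])
      show ?thesis
      proof (rule affine_function_on_eq_hull[where T=T and T'=T and C=C])
        show "affine_function_on T v'" "affine_function_on T v" using that \<open>?P v\<close> T by auto
        show "C \<subseteq> T" "C \<subseteq> T" using hull_subset[of C convex] C(2) by simp_all
        show "v' c = v c" if "c \<in> C" for c
        proof -
          have "c \<in> mesh_vertices \<T>" using T that C(3) by (auto simp: mesh_vertices_def)
          then show ?thesis using \<open>?P v\<close> \<open>?P v'\<close> by auto
        qed
      qed (use C T conv in auto)
    next
      case False
      then show ?thesis using that \<open>?P v\<close> by auto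
    qed
  qed
  ultimately have "lagrange_interp \<T> w = v"
    unfolding lagrange_interp_def by (rule the_equality)
  moreover have "\<forall>z\<in>mesh_vertices \<T>. v z = w z" using \<open>?P v\<close> by (elim conjE)
  ultimately show ?thesis using z by simp
qed

text \<open>On each element the value is a convex combination of vertex values. Vertices on the
  boundary contribute \<open>0\<close>, which \<open>0 \<le> M\<close> absorbs.\<close>

lemma fe_space_le_vertices:
  fixes \<Omega> :: "'a::euclidean_space set"
  assumes mesh: "conforming_mesh \<Omega> \<T>" and v: "v \<in> fe_space \<Omega> \<T>" "0 \<le> M"
    "\<And>z. z \<in> interior_vertices \<Omega> \<T> \<Longrightarrow> v z \<le> M"
  shows "v x \<le> M"
proof (cases "x \<in> \<Omega>")
  case True
  then have "x \<in> \<Union>\<T>" using mesh closure_subset by (auto simp: conforming_mesh_def)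
  then obtain T where T: "T \<in> \<T>" "x \<in> T" by auto
  obtain C where C: "finite C" "convex hull C = T" "{z. z extreme_point_of T} = C"
    by (rule mesh_simplex_vertices[OF mesh T(1)])
  have CM: "v c \<le> M" if "c \<in> C" for c
  proof (cases "c \<in> \<Omega>")
    case True
    then have "c \<in> interior_vertices \<Omega> \<T>"
      using that C(3) T(1) by (auto simp: interior_vertices_def mesh_vertices_def)
    then show ?thesis using v by auto
  qed (use v in \<open>auto simp: fe_space_def\<close>)
  obtain m where l: "\<forall>c\<in>C. 0 \<le> m c" "sum m C = 1" "(\<Sum>c\<in>C. m c *\<^sub>R c) = x"
    using T(2) C(2) unfolding convex_hull_finite[OF C(1)] by auto
  have "affine_function_on T v" using v T by (auto simp: fe_space_def)
  then have "v x = (\<Sum>c\<in>C. m c * v c)"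
    using affine_function_on_convex_combination[of T v C m] C T l hull_subset[of C convex] by simp
  also have "\<dots> \<le> (\<Sum>c\<in>C. m c * M)"
    using l CM by (intro sum_mono mult_left_mono) auto
  also have "\<dots> = M" using l(2) by (simp flip: sum_distrib_right)
  finally show ?thesis .
qed (use v in \<open>auto simp: fe_space_def\<close>)

lemma fe_space_diff:
  assumes "v \<in> fe_space \<Omega> \<T>" "w \<in> fe_space \<Omega> \<T>"
  shows "(\<lambda>x. v x - w x) \<in> fe_space \<Omega> \<T>"
proof -
  have "affine_function_on T (\<lambda>x. v x - w x)"
    if vw: "affine_function_on T v" "affine_function_on T w" for T
  proof -
    obtain a b c d where "\<forall>x\<in>T. v x = a \<bullet> x + b" "\<forall>x\<in>T. w x = c \<bullet> x + d"
      using vw by (auto simp: affine_function_on_def)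
    then have "\<forall>x\<in>T. v x - w x = (a - c) \<bullet> x + (b - d)"
      by (auto simp: inner_diff_left)
    then show ?thesis unfolding affine_function_on_def by blast
  qed
  then show ?thesis using assms by (auto simp: fe_space_def intro!: continuous_intros)
qed

lemma fe_space_abs_le_vertices:
  assumes mesh: "conforming_mesh \<Omega> \<T>" and v: "v \<in> fe_space \<Omega> \<T>" "w \<in> fe_space \<Omega> \<T>" "0 \<le> M"
    "\<And>z. z \<in> interior_vertices \<Omega> \<T> \<Longrightarrow> \<bar>v z - w z\<bar> \<le> M"
  shows "\<bar>v x - w x\<bar> \<le> M"
proof -
  have "v x - w x \<le> M" "w x - v x \<le> M"
    using fe_space_le_vertices[OF mesh fe_space_diff[OF v(1,2)] v(3), of x]
      fe_space_le_vertices[OF mesh fe_space_diff[OF v(2,1)] v(3), of x] v(4) by force+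
  then show ?thesis by auto
qed

text \<open>Two closed sets, \<open>closure \<Omega>\<close> and the complement of the open set
  \<Omega>, cover the space, and continuity holds on each.\<close>

lemma continuous_on_zero_extension:
  assumes "continuous_on (closure \<Omega>) v" "\<And>x. x \<notin> \<Omega> \<Longrightarrow> v x = 0" "open \<Omega>"
  shows "continuous_on UNIV v"
proof -
  have "continuous_on (closure \<Omega> \<union> - \<Omega>) v"
  proof (rule continuous_on_closed_Un)
    show "continuous_on (- \<Omega>) v"
      using assms(2) by (subst continuous_on_cong[of _ _ _ "\<lambda>_. 0"]) auto
  qed (use assms in auto)
  moreover have "closure \<Omega> \<union> - \<Omega> = UNIV" using closure_subset by blast
  ultimately show ?thesis by simp
qed

text \<open>Finitely many closed elements miss \<open>z\<close>; removing them from \<Omega> leaves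
  a neighbourhood covered by the elements that contain \<open>z\<close>. Through
  \<open>admissible_scale\<close> this makes the regularization scales positive.\<close>

lemma patch_radius_pos:
  assumes mesh: "conforming_mesh \<Omega> \<T>" and "open \<Omega>" "bounded \<Omega>"
    and z: "z \<in> interior_vertices \<Omega> \<T>"
  shows "0 < patch_radius \<T> z"
proof -
  have fin: "finite \<T>" and U: "\<Union>\<T> = closure \<Omega>"
    using mesh by (auto simp: conforming_mesh_def triangulation_def)
  have cl: "closed T" if "T \<in> \<T>" for T
    using closed_simplex mesh that by (auto simp: conforming_mesh_def)
  have "open (\<Omega> - \<Union>{T\<in>\<T>. z \<notin> T})"
    using fin cl \<open>open \<Omega>\<close> by (intro open_Diff closed_Union) auto
  moreover have "z \<in> \<Omega> - \<Union>{T\<in>\<T>. z \<notin> T}"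
    using z by (auto simp: interior_vertices_def)
  ultimately obtain e where e: "e > 0" "cball z e \<subseteq> \<Omega> - \<Union>{T\<in>\<T>. z \<notin> T}"
    unfolding open_contains_cball by blast
  have "\<Omega> - \<Union>{T\<in>\<T>. z \<notin> T} \<subseteq> \<Union>{T\<in>\<T>. z \<in> T}"
    using U closure_subset by blast
  then have e2: "e \<in> {r. 0 \<le> r \<and> cball z r \<subseteq> \<Union>{T \<in> \<T>. z \<in> T}}"
    using e by auto
  have "bounded (closure \<Omega>)" using assms(3) by (rule bounded_closure)
  then obtain B where B: "\<And>x. x \<in> closure \<Omega> \<Longrightarrow> dist z x \<le> B"
    unfolding bounded_any_center[of _ z] by blast
  \<comment> \<open>The radii must be bounded above before \<open>Sup\<close> can be compared with a
    member of the set.\<close>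
  have "r \<le> B" if "0 \<le> r" "cball z r \<subseteq> \<Union>{T \<in> \<T>. z \<in> T}" for r
  proof -
    obtain b :: 'a where b: "norm b = 1" using vector_choose_size[of 1] by auto
    have "z + r *\<^sub>R b \<in> cball z r" using that b by (simp add: dist_norm)
    then have "z + r *\<^sub>R b \<in> closure \<Omega>" using that U by blast
    then have "dist z (z + r *\<^sub>R b) \<le> B" by (rule B)
    then show ?thesis using that b by (simp add: dist_norm)
  qed
  then have "bdd_above {r. 0 \<le> r \<and> cball z r \<subseteq> \<Union>{T \<in> \<T>. z \<in> T}}"
    by (auto intro!: bdd_aboveI[of _ B])
  then have "e \<le> patch_radius \<T> z"
    unfolding patch_radius_def using e2 by (rule cSup_upper[rotated])
  then show ?thesis using e by simp
qed

subsection \<open>Translation, reflection and the Levy weight\<close>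

lemma lborel_reflect: "distr lborel borel (\<lambda>z. x - z) = (lborel :: 'a::euclidean_space measure)"
proof -
  have "lborel = density (distr lborel borel (\<lambda>z. x + (-1) *\<^sub>R z)) (\<lambda>_::'a. \<bar>-1::real\<bar> ^ DIM('a))"
    by (rule lborel_affine) simp
  also have "\<dots> = density (distr lborel borel (\<lambda>z. x - z)) (\<lambda>_. 1)"
    by simp
  finally show ?thesis by (simp add: density_1)
qed

lemma lborel_translate: "distr lborel borel (\<lambda>z. z + x) = (lborel :: 'a::euclidean_space measure)"
proof -
  have "lborel = density (distr lborel borel (\<lambda>z. x + 1 *\<^sub>R z)) (\<lambda>_::'a. \<bar>1::real\<bar> ^ DIM('a))"
    by (rule lborel_affine) simp
  also have "\<dots> = density (distr lborel borel (\<lambda>z. z + x)) (\<lambda>_. 1)"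
    by (simp add: add.commute)
  finally show ?thesis by (simp add: density_1)
qed

lemma AE_lborel_reflect:
  fixes x :: "'a::euclidean_space"
  assumes "AE z in lborel. P z"
  shows "AE z in lborel. P (x - z)"
proof -
  obtain N where N: "N \<in> null_sets lborel" "{z. \<not> P z} \<subseteq> N"
    using assms by (auto elim!: AE_E simp: null_sets_def)
  have "(\<lambda>z. x - z) -` N \<in> null_sets lborel"
  proof -
    have "emeasure lborel ((\<lambda>z. x - z) -` N) = emeasure (distr lborel borel (\<lambda>z. x - z)) N"
      using N by (subst emeasure_distr) (auto simp: null_sets_def)
    also have "\<dots> = 0" using N by (simp add: lborel_reflect null_sets_def)
    finally show ?thesis
      using N measurable_sets_borel[of "\<lambda>z. x - z" lborel N] by (auto simp: null_sets_def)
  qed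
  then show ?thesis using N by (intro AE_I') auto
qed

lemma integrable_lborel_reflect:
  fixes h :: "'a::euclidean_space \<Rightarrow> real"
  assumes "h \<in> borel_measurable borel"
  shows "integrable lborel (\<lambda>z. h (x - z)) \<longleftrightarrow> integrable lborel h"
proof -
  have "integrable (distr lborel borel (\<lambda>z. x - z)) h \<longleftrightarrow> integrable lborel (\<lambda>z. h (x - z))"
    using assms by (intro integrable_distr_eq) auto
  then show ?thesis by (simp add: lborel_reflect)
qed

lemma integral_lborel_reflect:
  fixes h :: "'a::euclidean_space \<Rightarrow> real"
  assumes "h \<in> borel_measurable borel"
  shows "(LINT z|lborel. h (x - z)) = (LINT z|lborel. h z)"
proof -
  have "(LINT z|distr lborel borel (\<lambda>z. x - z). h z) = (LINT z|lborel. h (x - z))"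
    using assms by (intro integral_distr) auto
  then show ?thesis by (simp add: lborel_reflect)
qed

lemma integrable_lborel_translate:
  fixes h :: "'a::euclidean_space \<Rightarrow> real"
  assumes "h \<in> borel_measurable borel"
  shows "integrable lborel (\<lambda>z. h (z + x)) \<longleftrightarrow> integrable lborel h"
proof -
  have "integrable (distr lborel borel (\<lambda>z. z + x)) h \<longleftrightarrow> integrable lborel (\<lambda>z. h (z + x))"
    using assms by (intro integrable_distr_eq) auto
  then show ?thesis by (simp add: lborel_translate)
qed

lemma integral_lborel_translate:
  fixes h :: "'a::euclidean_space \<Rightarrow> real"
  assumes "h \<in> borel_measurable borel"
  shows "(LINT z|lborel. h (z + x)) = (LINT z|lborel. h z)"
proof -
  have "(LINT z|distr lborel borel (\<lambda>z. z + x). h z) = (LINT z|lborel. h (z + x))"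
    using assms by (intro integral_distr) auto
  then show ?thesis by (simp add: lborel_translate)
qed

lemma open_AE_complement_empty:
  fixes U :: "'a::euclidean_space set"
  assumes "open U" "AE x in lborel. x \<notin> U"
  shows "U = {}"
proof (rule ccontr)
  assume "U \<noteq> {}"
  then obtain c e where e: "0 < e" "ball c e \<subseteq> U"
    using assms(1) unfolding open_contains_ball by blast
  have "AE x in lborel. x \<notin> ball c e" using assms(2) by eventually_elim (use e(2) in blast)
  then have "emeasure lborel (ball c e) = 0"
    by (subst (asm) AE_iff_measurable[of "ball c e"]) auto
  moreover have "0 < measure lborel (ball c e)" using content_ball_pos[of e c] e(1) by simp
  ultimately show False by (simp add: measure_def)
qed

text \<open>Measurability of \<eta> is only Lebesgue, and its bounds and symmetry hold only almost
  everywhere. Averaging a Borel version over \<open>z\<close> and \<open>- z\<close> and clamping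
  the result between \<open>lam\<close> and \<open>Lam\<close> makes everything hold everywhere, and
  changes nothing at the points where it held before.\<close>

lemma kernel_class_borel_representative:
  fixes \<eta> :: "'a::euclidean_space \<Rightarrow> real"
  assumes \<eta>: "kernel_class lam Lam \<eta>" and "lam \<le> Lam"
  obtains k where "k \<in> borel_measurable borel" "\<And>z. k (- z) = k z" "\<And>z. lam \<le> k z" "\<And>z. k z \<le> Lam"
    "AE z in lborel. \<eta> (sgn z) = k z"
proof -
  obtain g where g: "g \<in> borel_measurable lborel" "AE z in lborel. \<eta> (sgn z) = g z"
    using completion_ex_borel_measurable_real[of "\<lambda>y. \<eta> (sgn y)" lborel] \<eta>
    unfolding kernel_class_def by blast
  have g_meas [measurable]: "g \<in> borel_measurable borel" using g(1) by simp
  have ae: "AE y in lborel. \<eta> (- sgn y) = \<eta> (sgn y) \<and> lam \<le> \<eta> (sgn y) \<and> \<eta> (sgn y) \<le> Lam"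
    using \<eta> by (auto simp: kernel_class_def AE_completion_iff)
  have g_minus: "AE z in lborel. \<eta> (sgn (- z)) = g (- z)"
    using AE_lborel_reflect[OF g(2), of 0] by simp
  define k where "k z = max lam (min Lam ((g z + g (- z)) / 2))" for z
  show ?thesis
  proof
    show "k \<in> borel_measurable borel" unfolding k_def by measurable
    show "AE z in lborel. \<eta> (sgn z) = k z"
      using ae g(2) g_minus
    proof eventually_elim
      case (elim z)
      then have "g (- z) = g z" by (simp add: sgn_minus)
      then show ?case using elim by (auto simp: k_def max_def min_def)
    qed
  qed (use \<open>lam \<le> Lam\<close> in \<open>auto simp: k_def add.commute max_def min_def\<close>)
qed

text \<open>The integrand is dominated by a sum of multiples of indicators of balls, whose integrals
  are volumes. A radial singularity or tail is thereby reduced to a geometric series. The origin is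
  exempt, being a null set.\<close>

lemma integrable_of_dyadic_majorant:
  fixes h :: "'a::euclidean_space \<Rightarrow> real"
  assumes [measurable]: "h \<in> borel_measurable borel" and h0: "\<And>z. 0 \<le> h z"
    and c: "\<And>j. 0 \<le> c j" and r: "\<And>j. 0 \<le> r j"
    and le: "\<And>z. z \<noteq> 0 \<Longrightarrow> h z \<noteq> 0 \<Longrightarrow> \<exists>j. norm z \<le> r j \<and> h z \<le> c j"
    and sum: "summable (\<lambda>j::nat. c j * r j ^ DIM('a))"
  shows "integrable lborel h"
proof (rule integrableI_bounded)
  have "(\<integral>\<^sup>+z. ennreal (norm (h z)) \<partial>lborel) \<le> (\<integral>\<^sup>+z. (\<Sum>j. ennreal (c j) * indicator (cball (0::'a) (r j)) z) \<partial>lborel)"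
  proof (rule nn_integral_mono_AE)
    have "AE z in lborel. z \<noteq> (0::'a)"
      by (rule AE_lborel_singleton)
    then show "AE z in lborel. ennreal (norm (h z)) \<le> (\<Sum>j. ennreal (c j) * indicator (cball 0 (r j)) z)"
    proof eventually_elim
      case (elim z)
      show ?case
      proof (cases "h z = 0")
        case False
        then obtain j where j: "norm z \<le> r j" "h z \<le> c j" using le elim by blast
        define F where "F i = ennreal (c i) * indicator (cball (0::'a) (r i)) z" for i
        have "ennreal (norm (h z)) \<le> F j"
          using j h0[of z] by (simp add: ennreal_leI F_def)
        also have "F j = sum F {j}" by simp
        also have "\<dots> \<le> suminf F" by (rule sum_le_suminf) auto
        finally have "ennreal (norm (h z)) \<le> suminf F" .
        then show ?thesis by (simp add: F_def[abs_def])
      qed simp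
    qed
  qed
  also have "\<dots> = (\<Sum>j. ennreal (c j) * emeasure lborel (cball (0::'a) (r j)))"
  proof (subst nn_integral_suminf)
    have [measurable]: "cball (0::'a) (r i) \<in> sets borel" for i by simp
    show "(\<lambda>z. ennreal (c i) * indicator (cball (0::'a) (r i)) z) \<in> borel_measurable lborel" for i
      by measurable
  qed (simp add: nn_integral_cmult_indicator)
  also have "\<dots> = (\<Sum>j. ennreal (unit_ball_vol DIM('a) * (c j * r j ^ DIM('a))))"
    using c r by (intro suminf_cong) (simp add: emeasure_cball ennreal_mult' mult_ac)
  also have "\<dots> < \<infinity>"
    using sum c r by (subst suminf_ennreal2) (auto intro!: summable_mult mult_nonneg_nonneg)
  finally show "(\<integral>\<^sup>+z. ennreal (norm (h z)) \<partial>lborel) < \<infinity>" .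
qed simp

section \<open>Levy weight and kernel tails\<close>

definition levy_weight :: "real \<Rightarrow> 'a::euclidean_space \<Rightarrow> real" where
  "levy_weight s z = min 1 ((norm z)\<^sup>2) / norm z powr (real DIM('a) + 2 * s)"

lemma levy_weight_nonneg: "0 \<le> levy_weight s z"
  by (simp add: levy_weight_def)

lemma levy_weight_measurable [measurable]: "levy_weight s \<in> borel_measurable borel"
  unfolding levy_weight_def by measurable

lemma dyadic_bracket:
  fixes x :: real
  assumes "1 \<le> x"
  obtains j :: nat where "2 ^ j \<le> x" "x < 2 * 2 ^ j"
proof
  have l: "0 \<le> log 2 x" using assms by simp
  define j where "j = nat \<lfloor>log 2 x\<rfloor>"
  have "real j \<le> log 2 x" "log 2 x < real j + 1" using l unfolding j_def by linarith+
  then have "2 powr real j \<le> 2 powr log 2 x" "2 powr log 2 x < 2 powr (real j + 1)" by simp_all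
  then show "2 ^ j \<le> x" "x < 2 * 2 ^ j"
    using assms by (simp_all add: powr_realpow powr_add)
qed

text \<open>Each half has a geometric majorant. Near the origin its ratio is
  \<open>2 powr (2 * s - 2)\<close>, below one because \<open>s < 1\<close>; in the tail it is
  \<open>2 powr (- 2 * s)\<close>, below one because \<open>0 < s\<close>.\<close>

lemma integrable_levy_weight:
  assumes s: "0 < s" "s < 1"
  shows "integrable lborel (levy_weight s :: 'a::euclidean_space \<Rightarrow> real)"
proof -
  define p where "p = real DIM('a) + 2 * s"
  have p: "0 < p" using s by (simp add: p_def)
  define near where "near z = (norm z)\<^sup>2 / norm z powr p * indicator {z. norm z \<le> 1} z" for z :: 'a
  define far where "far z = 1 / norm z powr p * indicator {z. 1 < norm z} z" for z :: 'a
  have "integrable lborel near"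
  proof (rule integrable_of_dyadic_majorant)
    show "near \<in> borel_measurable borel" unfolding near_def by measurable
    fix z :: 'a assume z: "z \<noteq> 0" "near z \<noteq> 0"
    then have z1: "norm z \<le> 1" by (auto simp: near_def indicator_def split: if_splits)
    \<comment> \<open>\<open>z\<close> lies in the dyadic shell between \<open>(1/2) ^ Suc j\<close>
      and \<open>(1/2) ^ j\<close>; the outer radius bounds the numerator, the inner one the
      singular denominator.\<close>
    then obtain j :: nat where j: "2 ^ j \<le> 1 / norm z" "1 / norm z < 2 * 2 ^ j"
      using dyadic_bracket[of "1 / norm z"] z by auto
    have le: "norm z \<le> (1/2) ^ j" using j(1) z by (simp add: field_simps)
    have "1 / norm z powr p = (1 / norm z) powr p" using z by (simp add: powr_divide)
    also have "\<dots> \<le> (2 * 2 ^ j) powr p" using j(2) z p by (intro powr_mono2) auto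
    also have "\<dots> = 2 powr p * (2 powr p) ^ j"
      by (simp add: powr_mult flip: powr_realpow powr_powr) (simp add: powr_powr mult.commute)
    finally have 1: "1 / norm z powr p \<le> 2 powr p * (2 powr p) ^ j" .
    have "(norm z)\<^sup>2 \<le> ((1/2) ^ j)\<^sup>2" using le by (intro power_mono) auto
    also have "\<dots> = (2 powr - 2) ^ j"
      by (simp add: powr_minus power_even_eq power_mult[symmetric] mult.commute[of j] power2_eq_square flip: power_mult_distrib)
    finally have "(norm z)\<^sup>2 * (1 / norm z powr p) \<le> (2 powr - 2) ^ j * (2 powr p * (2 powr p) ^ j)"
      using 1 by (intro mult_mono) auto
    also have "\<dots> = 2 powr p * (2 powr (p - 2)) ^ j"
      by (simp add: powr_diff powr_minus power_divide field_simps)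
    finally show "\<exists>j. norm z \<le> (1/2) ^ j \<and> near z \<le> 2 powr p * (2 powr (p - 2)) ^ j"
      using le z1 by (intro exI[of _ j]) (simp add: near_def)
  next
    have "2 powr (p - 2) * (1/2) ^ DIM('a) = 2 powr (p - 2 - real DIM('a))"
      by (simp add: powr_diff powr_realpow power_divide)
    also have "\<dots> < 2 powr 0" using s by (intro powr_less_mono) (auto simp: p_def)
    finally have "summable (\<lambda>j. 2 powr p * (2 powr (p - 2) * (1/2) ^ DIM('a)) ^ j)"
      by (intro summable_mult summable_geometric) simp
    then show "summable (\<lambda>j. 2 powr p * (2 powr (p - 2)) ^ j * ((1/2) ^ j) ^ DIM('a))"
      by (simp add: power_mult_distrib mult.assoc mult.commute[of _ "DIM('a)"] flip: power_mult)
  qed (auto simp: near_def indicator_def split: if_splits)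
  moreover have "integrable lborel far"
  proof (rule integrable_of_dyadic_majorant)
    show "far \<in> borel_measurable borel" unfolding far_def by measurable
    fix z :: 'a assume z: "z \<noteq> 0" "far z \<noteq> 0"
    then have z1: "1 < norm z" by (auto simp: far_def indicator_def split: if_splits)
    then obtain j :: nat where j: "2 ^ j \<le> norm z" "norm z < 2 * 2 ^ j"
      using dyadic_bracket[of "norm z"] by auto
    have "(2 powr p) ^ j = (2 ^ j) powr p"
      by (simp flip: powr_realpow) (simp add: powr_powr mult.commute)
    also have "\<dots> \<le> norm z powr p" using j(1) p by (intro powr_mono2) auto
    finally have "1 / norm z powr p \<le> 1 / (2 powr p) ^ j"
      using z by (intro divide_left_mono) auto
    also have "\<dots> = (2 powr - p) ^ j" by (simp add: powr_minus power_inverse divide_inverse)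
    finally show "\<exists>j. norm z \<le> 2 * 2 ^ j \<and> far z \<le> (2 powr - p) ^ j"
      using j z1 by (intro exI[of _ j]) (simp add: far_def)
  next
    have "2 powr - p * 2 ^ DIM('a) = 2 powr (- 2 * s)"
      by (simp add: p_def powr_add powr_diff powr_minus powr_realpow field_simps)
    also have "\<dots> < 2 powr 0" using s by (intro powr_less_mono) auto
    finally have "summable (\<lambda>j. 2 ^ DIM('a) * (2 powr - p * 2 ^ DIM('a)) ^ j)"
      by (intro summable_mult summable_geometric) simp
    then show "summable (\<lambda>j. (2 powr - p) ^ j * (2 * 2 ^ j) ^ DIM('a))"
      by (simp add: power_mult_distrib mult_ac flip: power_mult)
  qed (auto simp: far_def indicator_def split: if_splits)
  ultimately have "integrable lborel (\<lambda>z. near z + far z)" by simp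
  moreover have "min 1 ((norm z)\<^sup>2) = (if norm z \<le> 1 then (norm z)\<^sup>2 else 1)" for z :: 'a
    using abs_square_le_1[of "norm z"] by auto
  then have "levy_weight s z = near z + far z" for z
    unfolding levy_weight_def near_def far_def p_def by simp
  then have "levy_weight s = (\<lambda>z. near z + far z)" by (rule ext)
  ultimately show ?thesis by simp
qed

text \<open>Off a ball around the origin the truncated square is bounded below, so a bounded
  function is controlled there by the Levy weight.\<close>

lemma one_le_scaled_truncation:
  fixes z :: "'a::real_normed_vector"
  assumes "0 < R" "R \<le> norm z"
  shows "1 \<le> max 1 (1 / R\<^sup>2) * min 1 ((norm z)\<^sup>2)"
proof (cases "(norm z)\<^sup>2 \<le> 1")
  case True
  have "R\<^sup>2 \<le> (norm z)\<^sup>2" using assms by (intro power_mono) auto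
  then have "1 \<le> 1 / R\<^sup>2 * (norm z)\<^sup>2" using assms by (simp add: field_simps)
  also have "\<dots> \<le> max 1 (1 / R\<^sup>2) * (norm z)\<^sup>2" by (intro mult_right_mono) auto
  finally show ?thesis using True by simp
qed simp

lemma integrable_tail:
  assumes s: "0 < s" "s < 1" and "0 < R"
  shows "integrable lborel (\<lambda>z::'a::euclidean_space. indicator {z. R < norm z} z / norm z powr (real DIM('a) + 2 * s))"
proof (rule Bochner_Integration.integrable_bound)
  show "integrable lborel (\<lambda>z::'a. max 1 (1 / R\<^sup>2) * levy_weight s z)"
    by (intro integrable_mult_right integrable_levy_weight s)
  have le: "1 \<le> max 1 (1 / R\<^sup>2) * min 1 ((norm z)\<^sup>2)" if "R < norm z" for z :: 'a
    using that assms by (intro one_le_scaled_truncation) auto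
  have "indicator {z. R < norm z} z / norm z powr (real DIM('a) + 2 * s) \<le> max 1 (1 / R\<^sup>2) * levy_weight s z" for z :: 'a
  proof (cases "R < norm z")
    case True
    then have "1 / norm z powr (real DIM('a) + 2 * s)
        \<le> (max 1 (1 / R\<^sup>2) * min 1 ((norm z)\<^sup>2)) / norm z powr (real DIM('a) + 2 * s)"
      using le by (intro divide_right_mono) auto
    then show ?thesis using True by (simp add: levy_weight_def)
  qed (simp add: levy_weight_nonneg)
  then show "AE z::'a in lborel. norm (indicator {z. R < norm z} z / norm z powr (real DIM('a) + 2 * s))
      \<le> norm (max 1 (1 / R\<^sup>2) * levy_weight s z)"
    by (intro AE_I2) (simp add: levy_weight_nonneg)
qed simp

text \<open>The \<open>itself\<close> argument only carries the dimension. Multiplied by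
  \<open>lam\<close> and the height of a maximum, this mass yields the quantitative gain in the
  discrete as well as in the continuous comparison.\<close>

definition tail_mass :: "'a::euclidean_space itself \<Rightarrow> real \<Rightarrow> real \<Rightarrow> real" where
  "tail_mass _ s R = (LINT z|lborel. indicator {z::'a. R < norm z} z / norm z powr (real DIM('a) + 2 * s))"

lemma tail_mass_pos:
  assumes s: "0 < s" "s < 1" and "0 < R"
  shows "0 < tail_mass TYPE('a::euclidean_space) s R"
proof (rule ccontr)
  let ?h = "\<lambda>z::'a. indicator {z. R < norm z} z / norm z powr (real DIM('a) + 2 * s)"
  assume "\<not> ?thesis"
  moreover have "0 \<le> tail_mass TYPE('a) s R"
    unfolding tail_mass_def by (intro integral_nonneg_AE AE_I2) simp
  ultimately have "integral\<^sup>L lborel ?h = 0" unfolding tail_mass_def by linarith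
  then have "AE z in lborel. ?h z = 0"
    using integrable_tail[OF assms, where 'a='a]
    by (subst (asm) integral_nonneg_eq_0_iff_AE) auto
  then have ae: "AE z::'a in lborel. \<not> R < norm z"
    by eventually_elim (use \<open>0 < R\<close> in \<open>auto simp: indicator_def\<close>)
  \<comment> \<open>The unit ball around a point of norm \<open>R + 1\<close> lies in the tail and
    has positive measure.\<close>
  obtain c :: 'a where c: "norm c = R + 1" using vector_choose_size[of "R + 1"] \<open>0 < R\<close> by auto
  have sub: "ball c 1 \<subseteq> {z. R < norm z}"
  proof
    fix z assume "z \<in> ball c 1"
    then have "norm (c - z) < 1" by (simp add: dist_norm)
    then show "z \<in> {z. R < norm z}" using c norm_triangle_sub[of c z] by simp
  qed
  have "AE z in lborel. z \<notin> ball c 1" using ae by eventually_elim (use sub in auto)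
  then have "ball c 1 = {}" by (rule open_AE_complement_empty[OF open_ball])
  then show False by simp
qed

subsection \<open>Nonlocal operators as integrals of second differences\<close>

text \<open>The definitions integrate over \<open>lebesgue\<close>, whereas Fubini and the changes
  of variables are applied to Borel integrands over \<open>lborel\<close>. Measurability of
  \<open>G\<close> is not assumed: it follows from the completeness of Lebesgue measure.\<close>

lemma lebesgue_eq_AE_lborel:
  fixes G h :: "'a::euclidean_space \<Rightarrow> real"
  assumes h: "h \<in> borel_measurable borel" and ae: "AE y in lborel. G y = h y"
  shows lebesgue_integrable_eq_AE: "integrable lebesgue G \<longleftrightarrow> integrable lborel h"
    and lebesgue_integral_eq_AE: "integral\<^sup>L lebesgue G = integral\<^sup>L lborel h"
proof -
  have hl: "h \<in> borel_measurable lborel" using h by simp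
  have hc: "h \<in> borel_measurable lebesgue" by (rule measurable_completion) (use h in simp)
  have ae': "AE y in lebesgue. h y = G y"
    using AE_completion[OF ae] by eventually_elim simp
  have G: "G \<in> borel_measurable lebesgue"
  proof (rule measurableI)
    fix A :: "real set" assume A: "A \<in> sets borel"
    show "G -` A \<inter> space lebesgue \<in> sets lebesgue"
    proof (rule completion.in_sets_AE)
      show "h -` A \<inter> space lebesgue \<in> sets lebesgue" using hc A by (rule measurable_sets)
      show "AE y in lebesgue. y \<in> h -` A \<inter> space lebesgue \<longleftrightarrow> y \<in> G -` A \<inter> space lebesgue"
        using ae' by eventually_elim simp
    qed simp
  qed simp
  show "integrable lebesgue G \<longleftrightarrow> integrable lborel h"
    using integrable_cong_AE[OF hc G ae'] integrable_completion[OF hl] by simp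
  show "integral\<^sup>L lebesgue G = integral\<^sup>L lborel h"
    using integral_cong_AE[OF hc G ae'] integral_completion[OF hl] by simp
qed

definition second_diff :: "('a::real_normed_vector \<Rightarrow> real) \<Rightarrow> 'a \<Rightarrow> 'a \<Rightarrow> real" where
  "second_diff w x z = 2 * w x - w (x - z) - w (x + z)"

text \<open>Both kernels are kept: \<eta> occurs in the operators as defined, \<open>k\<close> is
  the representative with which all pointwise estimates are made, and \<open>k_AE\<close> exchanges
  one for the other under integrals.\<close>

locale levy_kernel =
  fixes s lam Lam :: real and \<eta> k :: "'a::euclidean_space \<Rightarrow> real"
  assumes s: "0 < s" "s < 1" and lam: "0 < lam" "lam \<le> Lam"
    and k_measurable [measurable]: "k \<in> borel_measurable borel"
    and k_minus: "k (- z) = k z" and k_ge: "lam \<le> k z" and k_le: "k z \<le> Lam"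
    and k_AE: "AE z in lborel. \<eta> (sgn z) = k z"
begin

definition J :: "'a \<Rightarrow> real" where
  "J z = k z / norm z powr (real DIM('a) + 2 * s)"

definition sym_op :: "('a \<Rightarrow> real) \<Rightarrow> 'a \<Rightarrow> real" where
  "sym_op w x = 1 / 2 * (LINT z|lborel. second_diff w x z * J z)"

lemma J_measurable [measurable]: "J \<in> borel_measurable borel"
  unfolding J_def by measurable

lemma J_minus: "J (- z) = J z"
  by (simp add: J_def k_minus)

lemma k_nonneg: "0 \<le> k z"
  using k_ge[of z] lam by linarith

lemma J_nonneg: "0 \<le> J z"
  by (simp add: J_def k_nonneg)

lemma Lam_pos: "0 < Lam" using lam by linarith

lemma integrable_weight_J:
  assumes [measurable]: "h \<in> borel_measurable borel" and le: "\<And>z. \<bar>h z\<bar> \<le> C * min 1 ((norm z)\<^sup>2)"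
  shows "integrable lborel (\<lambda>z. h z * J z)"
    and "\<bar>LINT z|lborel. h z * J z\<bar> \<le> C * Lam * (LINT z|lborel. levy_weight s (z::'a))"
proof -
  have C: "0 \<le> C * min 1 ((norm z)\<^sup>2)" for z :: 'a using le[of z] by linarith
  have bd: "\<bar>h z * J z\<bar> \<le> C * Lam * levy_weight s z" for z
  proof -
    have "\<bar>h z\<bar> * k z \<le> (C * min 1 ((norm z)\<^sup>2)) * Lam"
      using le[of z] k_le[of z] k_nonneg[of z] C[of z] by (intro mult_mono) auto
    then have "\<bar>h z\<bar> * k z / norm z powr (real DIM('a) + 2 * s)
        \<le> (C * min 1 ((norm z)\<^sup>2)) * Lam / norm z powr (real DIM('a) + 2 * s)"
      by (intro divide_right_mono) auto
    then show ?thesis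
      using k_nonneg[of z] by (simp add: J_def levy_weight_def abs_mult mult_ac)
  qed
  have int: "integrable lborel (\<lambda>z::'a. C * Lam * levy_weight s z)"
    by (intro integrable_mult_right integrable_levy_weight s)
  show 1: "integrable lborel (\<lambda>z. h z * J z)"
    by (rule Bochner_Integration.integrable_bound[OF int])
      (use bd in \<open>auto intro!: AE_I2 order_trans[OF bd]\<close>)
  have "\<bar>LINT z|lborel. h z * J z\<bar> \<le> (LINT z|lborel. \<bar>h z * J z\<bar>)"
    by (rule integral_abs_bound)
  also have "\<dots> \<le> (LINT z|lborel. C * Lam * levy_weight s (z::'a))"
    using 1 int bd by (intro integral_mono) auto
  finally show "\<bar>LINT z|lborel. h z * J z\<bar> \<le> C * Lam * (LINT z|lborel. levy_weight s (z::'a))"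
    by simp
qed

lemma integrable_tail_J:
  assumes [measurable]: "h \<in> borel_measurable borel" and "0 < R"
    and le: "\<And>z. \<bar>h z\<bar> \<le> C"
  shows "integrable lborel (\<lambda>z. indicator {z. R < norm z} z * (h z * J z))"
proof -
  have C0: "0 \<le> C" using le[of 0] by linarith
  let ?h = "\<lambda>z. indicator {z. R < norm z} z * h z"
  have "\<bar>?h z\<bar> \<le> (C * max 1 (1 / R\<^sup>2)) * min 1 ((norm z)\<^sup>2)" for z :: 'a
  proof (cases "R < norm z")
    case True
    have "1 \<le> max 1 (1 / R\<^sup>2) * min 1 ((norm z)\<^sup>2)"
      using True assms by (intro one_le_scaled_truncation) auto
    then have "C * 1 \<le> C * (max 1 (1 / R\<^sup>2) * min 1 ((norm z)\<^sup>2))"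
      using C0 by (intro mult_left_mono)
    then show ?thesis using True le[of z] by simp
  qed (use C0 in auto)
  then have "integrable lborel (\<lambda>z. ?h z * J z)"
    by (intro integrable_weight_J(1)) auto
  then show ?thesis by (simp add: mult.assoc)
qed

text \<open>The kernel is even, so averaging the truncated first difference with its reflection in
  \<open>z\<close> produces half of the truncated second difference. The latter is absolutely
  integrable against \<open>J\<close>, and dominated convergence removes the truncation.\<close>

lemma has_frac_op_sym_op:
  assumes w [measurable]: "w \<in> borel_measurable borel" and M: "\<And>y. \<bar>w y\<bar> \<le> M"
    and int: "integrable lborel (\<lambda>z. second_diff w x z * J z)"
  shows "has_frac_op s \<eta> w x (sym_op w x)"
proof -
  define p where "p = real DIM('a) + 2 * s"
  define F where "F \<rho> z = indicator {z. \<rho> < norm z} z * ((w x - w (x - z)) * J z)" for \<rho> and z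
  have Fm [measurable]: "F \<rho> \<in> borel_measurable borel" for \<rho>
    unfolding F_def by measurable
  have Fint: "integrable lborel (F \<rho>)" if "0 < \<rho>" for \<rho>
    unfolding F_def
  proof (rule integrable_tail_J[OF _ that])
    show "\<bar>w x - w (x - z)\<bar> \<le> 2 * M" for z using M[of x] M[of "x - z"] by linarith
  qed simp
  have ae: "AE y in lborel. indicator {y. \<rho> < norm (x - y)} y *\<^sub>R frac_integrand s \<eta> w x y = F \<rho> (x - y)" for \<rho>
    using AE_lborel_reflect[OF k_AE, of x]
    by eventually_elim (auto simp: F_def frac_integrand_def J_def indicator_def)
  have Frm: "(\<lambda>y. F \<rho> (x - y)) \<in> borel_measurable borel" for \<rho> by measurable
  have tr: "frac_trunc s \<eta> w x \<rho> = 1 / 2 * (LINT z|lborel. indicator {z. \<rho> < norm z} z * (second_diff w x z * J z))"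
    if "0 < \<rho>" for \<rho>
  proof -
    have 1: "frac_trunc s \<eta> w x \<rho> = (LINT z|lborel. F \<rho> z)"
      unfolding frac_trunc_def set_lebesgue_integral_def
      using lebesgue_integral_eq_AE[OF Frm ae] integral_lborel_reflect[OF Fm] by simp
    have 2: "(LINT z|lborel. F \<rho> (0 - z)) = (LINT z|lborel. F \<rho> z)"
      by (rule integral_lborel_reflect) simp
    have 3: "integrable lborel (\<lambda>z. F \<rho> (0 - z))"
      using integrable_lborel_reflect[OF Fm, of \<rho> 0] Fint[OF that] by simp
    have "(LINT z|lborel. indicator {z. \<rho> < norm z} z * (second_diff w x z * J z))
        = (LINT z|lborel. F \<rho> z + F \<rho> (0 - z))"
      by (intro Bochner_Integration.integral_cong)
        (auto simp: F_def second_diff_def J_minus indicator_def algebra_simps)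
    also have "\<dots> = 2 * (LINT z|lborel. F \<rho> z)"
      using 2 3 Fint[OF that] by simp
    finally show ?thesis using 1 by simp
  qed
  have lim: "((\<lambda>\<rho>. 1 / 2 * (LINT z|lborel. indicator {z. \<rho> < norm z} z * (second_diff w x z * J z)))
      \<longlongrightarrow> 1 / 2 * (LINT z|lborel. second_diff w x z * J z)) (at_right 0)"
  proof (rule tendsto_at_right_sequentially[of 0 1])
    fix S :: "nat \<Rightarrow> real" assume S: "\<And>n. 0 < S n" "S \<longlonglongrightarrow> 0"
    have "(\<lambda>n. LINT z|lborel. indicator {z. S n < norm z} z * (second_diff w x z * J z))
       \<longlonglongrightarrow> (LINT z|lborel. second_diff w x z * J z)"
    proof (rule integral_dominated_convergence[where w="\<lambda>z. \<bar>second_diff w x z * J z\<bar>"])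
      show "AE z in lborel. (\<lambda>n. indicator {z. S n < norm z} z * (second_diff w x z * J z))
          \<longlonglongrightarrow> second_diff w x z * J z"
        using AE_lborel_singleton[of 0]
      proof eventually_elim
        case (elim z)
        then have "\<forall>\<^sub>F n in sequentially. S n < norm z"
          using order_tendstoD(2)[OF S(2), of "norm z"] by simp
        then have "\<forall>\<^sub>F n in sequentially. indicator {z. S n < norm z} z * (second_diff w x z * J z)
            = second_diff w x z * J z"
          by eventually_elim simp
        then show ?case by (rule tendsto_eventually)
      qed
      show "(\<lambda>z. second_diff w x z * J z) \<in> borel_measurable lborel"
        using int by (rule borel_measurable_integrable)
      then show "(\<lambda>z. indicator {z. S n < norm z} z * (second_diff w x z * J z)) \<in> borel_measurable lborel" for n
        by measurable
      show "integrable lborel (\<lambda>z. \<bar>second_diff w x z * J z\<bar>)" using int by (rule integrable_abs)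
    qed (auto simp: indicator_def)
    then show "(\<lambda>n. 1 / 2 * (LINT z|lborel. indicator {z. S n < norm z} z * (second_diff w x z * J z)))
       \<longlonglongrightarrow> 1 / 2 * (LINT z|lborel. second_diff w x z * J z)"
      by (intro tendsto_mult tendsto_const)
  qed simp
  show ?thesis
    unfolding has_frac_op_def
  proof (intro conjI allI impI)
    fix \<rho> :: real assume "0 < \<rho>"
    then show "set_integrable lebesgue {y. \<rho> < norm (x - y)} (frac_integrand s \<eta> w x)"
      unfolding set_integrable_def
      using lebesgue_integrable_eq_AE[OF Frm ae] integrable_lborel_reflect[OF Fm] Fint by simp
  next
    have "\<forall>\<^sub>F \<rho> in at_right 0. 1 / 2 * (LINT z|lborel. indicator {z. \<rho> < norm z} z * (second_diff w x z * J z))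
        = frac_trunc s \<eta> w x \<rho>"
      using eventually_at_right_less[of "0::real"] by eventually_elim (use tr in simp)
    then show "(frac_trunc s \<eta> w x \<longlongrightarrow> sym_op w x) (at_right 0)"
      using lim unfolding sym_op_def by (rule Lim_transform_eventually[rotated])
  qed
qed

end

lemma frac_op_eq:
  assumes "has_frac_op s \<eta> w x l"
  shows "frac_op s \<eta> w x = l"
  unfolding frac_op_def
proof (rule the_equality, rule assms)
  fix l' assume "has_frac_op s \<eta> w x l'"
  then show "l' = l"
    using assms tendsto_unique[of "at_right (0::real)"] unfolding has_frac_op_def by auto
qed

subsection \<open>Discrete comparison\<close>

lemma reg_kernel_outer: "\<epsilon> \<le> r \<Longrightarrow> reg_kernel d s \<epsilon> r = r powr (- d - 2 * s)"
  by (simp add: reg_kernel_def)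

text \<open>With \<open>t = r / \<epsilon>\<close> the inner branch is
  \<open>\<epsilon> powr (- d - 2 * s)\<close> times
  \<open>1 + G * (1 - t\<^sup>2) - N * (1 - t ^ 3)\<close>. The identity
  \<open>2 * G - 3 * N = d + 2 * s\<close> says that both branches have the same slope at
  \<open>r = \<epsilon>\<close>. It gives \<open>3 * N \<le> 2 * G\<close>, and
  \<open>2 * (1 - t ^ 3) \<le> 3 * (1 - t\<^sup>2)\<close> on the unit interval does the
  rest.\<close>

lemma reg_kernel_nonneg:
  assumes s: "0 < s" "s < 1" and d: "0 < d" and \<epsilon>: "0 < \<epsilon>" and r: "0 \<le> r"
  shows "0 \<le> reg_kernel d s \<epsilon> r"
proof (cases "\<epsilon> \<le> r")
  case False
  define G where "G = (4 + d) * (d + 2 * s) * (3 + d + 2 * s) / (4 * (1 - s))"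
  define N where "N = (5 + d) * (d + 2 * s) * (2 + d + 2 * s) / (6 * (1 - s))"
  define t where "t = r / \<epsilon>"
  have t: "0 \<le> t" "t \<le> 1" and rt: "r = t * \<epsilon>" using False r \<epsilon> by (auto simp: t_def field_simps)
  have N0: "0 \<le> N" using s d by (simp add: N_def)
  have "G * (4 * (1 - s)) = (4 + d) * (d + 2 * s) * (3 + d + 2 * s)"
    "N * (6 * (1 - s)) = (5 + d) * (d + 2 * s) * (2 + d + 2 * s)"
    using s by (simp_all add: G_def N_def)
  moreover have "(2 * G - 3 * N) * (2 * (1 - s)) = G * (4 * (1 - s)) - N * (6 * (1 - s))"
    by (simp add: algebra_simps)
  ultimately have "(2 * G - 3 * N) * (2 * (1 - s))
      = (4 + d) * (d + 2 * s) * (3 + d + 2 * s) - (5 + d) * (d + 2 * s) * (2 + d + 2 * s)"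
    by simp
  also have "\<dots> = (d + 2 * s) * (2 * (1 - s))" by (simp add: algebra_simps)
  finally have GN: "2 * G - 3 * N = d + 2 * s" using s by simp
  have "N * (1 - t ^ 3) \<le> G * (1 - t\<^sup>2)"
  proof -
    \<comment> \<open>The cubic \<open>1 - 3 * t\<^sup>2 + 2 * t ^ 3\<close> has a double zero at
      \<open>t = 1\<close>, which gives this factorization.\<close>
    have "0 \<le> (1 - t) * (1 - t) * (1 + 2 * t)" using t by simp
    also have "\<dots> = 3 * (1 - t\<^sup>2) - 2 * (1 - t ^ 3)"
      by (simp add: power2_eq_square power3_eq_cube algebra_simps)
    finally have "N * (2 * (1 - t ^ 3)) \<le> N * (3 * (1 - t\<^sup>2))"
      using N0 by (intro mult_left_mono) auto
    also have "\<dots> \<le> 2 * G * (1 - t\<^sup>2)"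
    proof -
      have "t\<^sup>2 \<le> 1" using t by (simp add: power_le_one)
      then have "3 * N * (1 - t\<^sup>2) \<le> 2 * G * (1 - t\<^sup>2)"
        using GN s d by (intro mult_right_mono) auto
      then show ?thesis by (simp add: mult_ac)
    qed
    finally show ?thesis by (simp add: algebra_simps)
  qed
  moreover have "reg_kernel d s \<epsilon> r = \<epsilon> powr (- d - 2 * s) * (1 + G * (1 - t\<^sup>2) - N * (1 - t ^ 3))"
  proof -
    have "\<epsilon> powr (- d - 2 * s - 2) * \<epsilon>\<^sup>2 = \<epsilon> powr (- d - 2 * s)"
      "\<epsilon> powr (- d - 2 * s - 3) * \<epsilon> ^ 3 = \<epsilon> powr (- d - 2 * s)"
      using \<epsilon> by (simp_all add: powr_diff powr_numeral)
    moreover have "reg_kernel d s \<epsilon> r = \<epsilon> powr (- d - 2 * s)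
        + G * (\<epsilon> powr (- d - 2 * s - 2) * \<epsilon>\<^sup>2) * (1 - t\<^sup>2)
        - N * (\<epsilon> powr (- d - 2 * s - 3) * \<epsilon> ^ 3) * (1 - t ^ 3)"
      using False unfolding reg_kernel_def Let_def G_def[symmetric] N_def[symmetric] rt
      by (simp add: power_mult_distrib algebra_simps)
    ultimately show ?thesis by (simp add: algebra_simps)
  qed
  ultimately show ?thesis by simp
qed (simp add: reg_kernel_outer)

lemma reg_kernel_bounded:
  assumes "0 < \<epsilon>"
  obtains C where "\<And>r. 0 \<le> r \<Longrightarrow> r < \<epsilon> \<Longrightarrow> \<bar>reg_kernel d s \<epsilon> r\<bar> \<le> C"
proof -
  \<comment> \<open>Only the polynomial shape of the inner branch matters here, so its coefficients
    are abstracted.\<close>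
  have "\<exists>a g n. \<forall>r. r < \<epsilon> \<longrightarrow> reg_kernel d s \<epsilon> r = a + g * (r\<^sup>2 - \<epsilon>\<^sup>2) + n * (r ^ 3 - \<epsilon> ^ 3)"
    unfolding reg_kernel_def Let_def by (intro exI allI impI, subst if_not_P, simp, rule refl)
  then obtain a g n where K: "\<And>r. r < \<epsilon> \<Longrightarrow> reg_kernel d s \<epsilon> r = a + g * (r\<^sup>2 - \<epsilon>\<^sup>2) + n * (r ^ 3 - \<epsilon> ^ 3)"
    by (elim exE) blast
  show ?thesis
  proof (rule that[of "\<bar>a\<bar> + \<bar>g\<bar> * \<epsilon>\<^sup>2 + \<bar>n\<bar> * \<epsilon> ^ 3"])
    fix r assume r: "0 \<le> r" "r < \<epsilon>"
    have "0 \<le> r\<^sup>2" "r\<^sup>2 \<le> \<epsilon>\<^sup>2" "0 \<le> r ^ 3" "r ^ 3 \<le> \<epsilon> ^ 3"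
      using r by (auto intro: power_mono)
    then have "\<bar>r\<^sup>2 - \<epsilon>\<^sup>2\<bar> \<le> \<epsilon>\<^sup>2" "\<bar>r ^ 3 - \<epsilon> ^ 3\<bar> \<le> \<epsilon> ^ 3" by linarith+
    then have "\<bar>g * (r\<^sup>2 - \<epsilon>\<^sup>2)\<bar> \<le> \<bar>g\<bar> * \<epsilon>\<^sup>2" "\<bar>n * (r ^ 3 - \<epsilon> ^ 3)\<bar> \<le> \<bar>n\<bar> * \<epsilon> ^ 3"
      unfolding abs_mult by (auto intro: mult_left_mono)
    then show "\<bar>reg_kernel d s \<epsilon> r\<bar> \<le> \<bar>a\<bar> + \<bar>g\<bar> * \<epsilon>\<^sup>2 + \<bar>n\<bar> * \<epsilon> ^ 3"
      unfolding K[OF r(2)] by linarith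
  qed
qed

lemma reg_kernel_measurable [measurable]: "reg_kernel d s \<epsilon> \<in> borel_measurable borel"
  unfolding reg_kernel_def Let_def by measurable

context levy_kernel
begin

lemma reg_op_eq:
  assumes w [measurable]: "w \<in> borel_measurable borel"
  shows "reg_op s \<eta> \<epsilon> w x
    = 1 / 2 * (LINT y|lborel. second_diff w x y * (k y * reg_kernel (real DIM('a)) s \<epsilon> (norm y)))"
  unfolding reg_op_def
proof (subst lebesgue_integral_eq_AE)
  show "AE y in lborel. (2 * w x - w (x - y) - w (x + y)) * \<eta> (sgn y) * reg_kernel (real DIM('a)) s \<epsilon> (norm y)
      = second_diff w x y * (k y * reg_kernel (real DIM('a)) s \<epsilon> (norm y))"
    using k_AE by eventually_elim (simp add: second_diff_def)
  show "(\<lambda>y. second_diff w x y * (k y * reg_kernel (real DIM('a)) s \<epsilon> (norm y))) \<in> borel_measurable borel"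
    unfolding second_diff_def by measurable
qed simp

lemma integrable_reg_kernel:
  assumes h [measurable]: "h \<in> borel_measurable borel" and le: "\<And>z. \<bar>h z\<bar> \<le> C" and \<epsilon>: "0 < \<epsilon>"
  shows "integrable lborel (\<lambda>z::'a. h z * (k z * reg_kernel (real DIM('a)) s \<epsilon> (norm z)))"
proof -
  obtain B where B: "\<And>r. 0 \<le> r \<Longrightarrow> r < \<epsilon> \<Longrightarrow> \<bar>reg_kernel (real DIM('a)) s \<epsilon> r\<bar> \<le> B"
    using reg_kernel_bounded[OF \<epsilon>] by metis
  have B0: "0 \<le> B" using B[of 0] \<epsilon> by linarith
  have C0: "0 \<le> C" using le[of 0] by linarith
  \<comment> \<open>The tail starts at \<open>\<epsilon> / 2\<close> because its indicator is strict
    while the outer formula is already used at \<open>norm z = \<epsilon>\<close>.\<close>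
  define g where "g z = C * Lam * (B * indicator (cball 0 \<epsilon>) z
      + indicator {z. \<epsilon> / 2 < norm z} z / norm z powr (real DIM('a) + 2 * s))" for z :: 'a
  have "emeasure lborel (cball (0::'a) \<epsilon>) < \<infinity>"
    by (intro emeasure_bounded_finite bounded_cball)
  then have 1: "integrable lborel (indicat_real (cball (0::'a) \<epsilon>))"
    by (intro integrable_real_indicator) simp_all
  have 2: "integrable lborel (\<lambda>z::'a. indicator {z. \<epsilon> / 2 < norm z} z / norm z powr (real DIM('a) + 2 * s))"
    by (rule integrable_tail[OF s]) (use \<epsilon> in simp)
  have g: "integrable lborel g"
    unfolding g_def
    by (rule integrable_mult_right, rule Bochner_Integration.integrable_add,
        rule integrable_mult_right, rule 1, rule 2)
  show ?thesis
  proof (rule Bochner_Integration.integrable_bound[OF g])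
    have "(\<lambda>z::'a. h z * (k z * reg_kernel (real DIM('a)) s \<epsilon> (norm z))) \<in> borel_measurable borel"
      by measurable
    then show "(\<lambda>z::'a. h z * (k z * reg_kernel (real DIM('a)) s \<epsilon> (norm z))) \<in> borel_measurable lborel"
      by simp
  next
    show "AE z in lborel. norm (h z * (k z * reg_kernel (real DIM('a)) s \<epsilon> (norm z))) \<le> norm (g z)"
    proof (rule AE_I2)
      fix z :: 'a
      have "\<bar>reg_kernel (real DIM('a)) s \<epsilon> (norm z)\<bar>
          \<le> B * indicator (cball 0 \<epsilon>) z + indicator {z. \<epsilon> / 2 < norm z} z / norm z powr (real DIM('a) + 2 * s)"
      proof (cases "norm z < \<epsilon>")
        case True
        then have "\<bar>reg_kernel (real DIM('a)) s \<epsilon> (norm z)\<bar> \<le> B * indicator (cball 0 \<epsilon>) z"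
          using B[of "norm z"] by simp
        moreover have "0 \<le> indicator {z. \<epsilon> / 2 < norm z} z / norm z powr (real DIM('a) + 2 * s)"
          by simp
        ultimately show ?thesis by linarith
      next
        case False
        then have "reg_kernel (real DIM('a)) s \<epsilon> (norm z) = norm z powr (- (real DIM('a) + 2 * s))"
          by (simp add: reg_kernel_outer)
        also have "\<dots> = 1 / norm z powr (real DIM('a) + 2 * s)" by (rule powr_minus_divide)
        finally have "\<bar>reg_kernel (real DIM('a)) s \<epsilon> (norm z)\<bar>
            = indicator {z. \<epsilon> / 2 < norm z} z / norm z powr (real DIM('a) + 2 * s)"
          using False \<epsilon> by simp
        moreover have "0 \<le> B * indicator (cball 0 \<epsilon>) z" using B0 by simp
        ultimately show ?thesis by linarith
      qed
      then have "\<bar>h z\<bar> * (k z * \<bar>reg_kernel (real DIM('a)) s \<epsilon> (norm z)\<bar>)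
          \<le> C * (Lam * (B * indicator (cball 0 \<epsilon>) z + indicator {z. \<epsilon> / 2 < norm z} z / norm z powr (real DIM('a) + 2 * s)))"
        using le k_le k_nonneg C0 Lam_pos by (intro mult_mono) auto
      then have "\<bar>h z * (k z * reg_kernel (real DIM('a)) s \<epsilon> (norm z))\<bar> \<le> g z"
        using k_nonneg[of z] by (simp add: g_def abs_mult mult_ac)
      then show "norm (h z * (k z * reg_kernel (real DIM('a)) s \<epsilon> (norm z))) \<le> norm (g z)"
        by simp
    qed
  qed
qed

text \<open>At a maximum of \<open>v - w\<close> every second difference of \<open>v - w\<close> is
  nonnegative, which alone gives a weak inequality. Strictness comes from far away, where both
  functions vanish and the second difference equals twice the maximum.\<close>

lemma reg_op_less_at_max:
  assumes v: "v \<in> borel_measurable borel" "\<And>y. \<bar>v y\<bar> \<le> M"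
    and w: "w \<in> borel_measurable borel" "\<And>y. \<bar>w y\<bar> \<le> M"
    and \<epsilon>: "0 < \<epsilon>"
    and max: "\<And>y. v y - w y \<le> v x - w x" "0 < v x - w x"
    and R: "0 < R" "\<And>y. R < norm (y - x) \<Longrightarrow> v y = 0 \<and> w y = 0"
  shows "reg_op s \<eta> \<epsilon> w x < reg_op s \<eta> \<epsilon> v x"
proof -
  note [measurable] = v(1) w(1)
  let ?K = "\<lambda>z::'a. k z * reg_kernel (real DIM('a)) s \<epsilon> (norm z)"
  define m where "m = v x - w x"
  \<comment> \<open>Beyond \<open>\<epsilon>\<close> the regularized kernel is the pure power,
    beyond \<open>R\<close> the functions vanish; the tail needs both.\<close>
  define R' where "R' = max R \<epsilon>"
  have R': "0 < R'" "R \<le> R'" "\<epsilon> \<le> R'" using R(1) by (auto simp: R'_def)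
  have sd: "(\<lambda>z. second_diff u x z) \<in> borel_measurable borel" if "u \<in> borel_measurable borel" for u :: "'a \<Rightarrow> real"
    using that unfolding second_diff_def by measurable
  have sdb: "\<bar>second_diff u x z\<bar> \<le> 4 * M" if "\<And>y. \<bar>u y\<bar> \<le> M" for u :: "'a \<Rightarrow> real" and z
    using that[of x] that[of "x + z"] that[of "x - z"] unfolding second_diff_def by linarith
  have iv: "integrable lborel (\<lambda>z. second_diff v x z * ?K z)"
    by (rule integrable_reg_kernel[OF sd[OF v(1)] sdb[OF v(2)] \<epsilon>])
  have iw: "integrable lborel (\<lambda>z. second_diff w x z * ?K z)"
    by (rule integrable_reg_kernel[OF sd[OF w(1)] sdb[OF w(2)] \<epsilon>])
  have K0: "0 \<le> ?K z" for z
    using reg_kernel_nonneg[OF s _ \<epsilon>, of "real DIM('a)" "norm z"] k_nonneg[of z] by simp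
  have "0 < 2 * m * lam * tail_mass TYPE('a) s R'"
    using tail_mass_pos[OF s R'(1), where 'a='a] max(2) lam by (simp add: m_def)
  also have "\<dots> = (LINT z|lborel. 2 * m * lam * (indicator {z::'a. R' < norm z} z / norm z powr (real DIM('a) + 2 * s)))"
    unfolding tail_mass_def by (rule integral_mult_right_zero[symmetric])
  also have "\<dots> \<le> (LINT z|lborel. second_diff v x z * ?K z - second_diff w x z * ?K z)"
  proof (rule integral_mono)
    show "integrable lborel (\<lambda>z::'a. 2 * m * lam * (indicator {z. R' < norm z} z / norm z powr (real DIM('a) + 2 * s)))"
      by (intro integrable_mult_right integrable_tail s R')
    show "integrable lborel (\<lambda>z. second_diff v x z * ?K z - second_diff w x z * ?K z)"
      using iv iw by simp
    fix z :: 'a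
    have eq: "second_diff v x z * ?K z - second_diff w x z * ?K z
        = ((m - (v (x - z) - w (x - z))) + (m - (v (x + z) - w (x + z)))) * ?K z"
      by (simp add: second_diff_def m_def algebra_simps)
    show "2 * m * lam * (indicator {z. R' < norm z} z / norm z powr (real DIM('a) + 2 * s))
        \<le> second_diff v x z * ?K z - second_diff w x z * ?K z"
    proof (cases "R' < norm z")
      case True
      then have "reg_kernel (real DIM('a)) s \<epsilon> (norm z) = norm z powr (- (real DIM('a) + 2 * s))"
        using R' by (simp add: reg_kernel_outer)
      also have "\<dots> = 1 / norm z powr (real DIM('a) + 2 * s)" by (rule powr_minus_divide)
      finally have 1: "?K z = k z / norm z powr (real DIM('a) + 2 * s)" by simp
      have "v (x - z) - w (x - z) = 0" "v (x + z) - w (x + z) = 0"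
        using R(2)[of "x - z"] R(2)[of "x + z"] True R' by auto
      then have "second_diff v x z * ?K z - second_diff w x z * ?K z = 2 * m * ?K z"
        unfolding eq by simp
      then have "second_diff v x z * ?K z - second_diff w x z * ?K z = 2 * m * k z / norm z powr (real DIM('a) + 2 * s)"
        using 1 by simp
      moreover have "2 * m * lam / norm z powr (real DIM('a) + 2 * s) \<le> 2 * m * k z / norm z powr (real DIM('a) + 2 * s)"
        using k_ge[of z] max(2) by (intro divide_right_mono mult_left_mono) (auto simp: m_def)
      ultimately show ?thesis using True by simp
    next
      case False
      then show ?thesis
        unfolding eq using max(1)[of "x - z"] max(1)[of "x + z"] K0[of z] by (simp add: m_def)
    qed
  qed
  also have "\<dots> = 2 * (reg_op s \<eta> \<epsilon> v x - reg_op s \<eta> \<epsilon> w x)"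
    using iv iw by (simp add: reg_op_eq)
  finally show ?thesis by simp
qed

lemma bounded_within_radius:
  fixes z :: 'a
  assumes "bounded \<Omega>"
  obtains R where "0 < R" "\<And>y. y \<in> \<Omega> \<Longrightarrow> norm (y - z) \<le> R"
proof -
  obtain e where e: "\<And>y. y \<in> \<Omega> \<Longrightarrow> dist z y \<le> e"
    using assms unfolding bounded_any_center[of _ z] by blast
  show ?thesis
    by (rule that[of "max 1 e"])
      (use e in \<open>auto simp: dist_norm norm_minus_commute le_max_iff_disj\<close>)
qed

text \<open>Where \<open>v - w\<close> is maximal and exceeds \<open>M\<close>, the function
  \<open>v\<close> lies strictly above its obstacle, because \<open>w\<close> is above its own and
  \<open>\<psi>\<close> exceeds \<open>\<phi>\<close> by at most \<open>M\<close>. So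
  \<open>v\<close> solves the equation at that vertex while \<open>w\<close> is a supersolution,
  against the strict inequality of the operators at a maximum.\<close>

lemma discrete_obstacle_comparison:
  assumes mesh: "conforming_mesh \<Omega> \<T>" and \<Omega>: "open \<Omega>" "bounded \<Omega>"
    and eps: "\<And>z. z \<in> interior_vertices \<Omega> \<T> \<Longrightarrow> 0 < eps z"
    and v: "discrete_obstacle_solution s \<eta> \<Omega> f \<T> eps \<psi> v"
    and w: "discrete_obstacle_solution s \<eta> \<Omega> f \<T> eps \<phi> w"
    and M: "0 \<le> M" "\<And>z. z \<in> interior_vertices \<Omega> \<T> \<Longrightarrow> \<psi> z - \<phi> z \<le> M"
  shows "v x - w x \<le> M"
proof (rule ccontr)
  assume neg: "\<not> v x - w x \<le> M"
  let ?I = "interior_vertices \<Omega> \<T>"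
  have vf: "v \<in> fe_space \<Omega> \<T>" and wf: "w \<in> fe_space \<Omega> \<T>"
    using v w by (auto simp: discrete_obstacle_solution_def)
  have df: "(\<lambda>x. v x - w x) \<in> fe_space \<Omega> \<T>" by (rule fe_space_diff[OF vf wf])
  have fin: "finite ?I" using finite_mesh_vertices[OF mesh] by (simp add: interior_vertices_def)
  have "\<exists>z\<in>?I. M < v z - w z"
    using fe_space_le_vertices[OF mesh df M(1), of x] neg by (meson not_le)
  then obtain z0 where z0: "z0 \<in> ?I" "M < v z0 - w z0" by blast
  obtain z where z: "z \<in> ?I" "\<And>y. y \<in> ?I \<Longrightarrow> v y - w y \<le> v z - w z"
  proof -
    have "Max ((\<lambda>y. v y - w y) ` ?I) \<in> (\<lambda>y. v y - w y) ` ?I"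
      using fin z0(1) by (intro Max_in) auto
    then obtain z where "z \<in> ?I" "v z - w z = Max ((\<lambda>y. v y - w y) ` ?I)" by auto
    then show ?thesis using fin by (intro that[of z]) auto
  qed
  have mz: "M < v z - w z" using z(2)[OF z0(1)] z0(2) by linarith
  \<comment> \<open>Piecewise affinity extends the maximum over interior vertices to the whole
    space; outside \<Omega> the difference is \<open>0\<close>, below the positive maximum.\<close>
  have max: "v y - w y \<le> v z - w z" for y
    using fe_space_le_vertices[OF mesh df, of "v z - w z" y] z(2) mz M(1) by simp
  have cont: "continuous_on UNIV u" "\<exists>B. \<forall>y. \<bar>u y\<bar> \<le> B" if "u \<in> fe_space \<Omega> \<T>" for u :: "'a \<Rightarrow> real"
  proof -
    have u: "continuous_on (closure \<Omega>) u" "\<And>x. x \<notin> \<Omega> \<Longrightarrow> u x = 0"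
      using that by (auto simp: fe_space_def)
    then show "continuous_on UNIV u" using \<Omega>(1) by (rule continuous_on_zero_extension)
    have "bounded (u ` closure \<Omega>)"
      using u(1) \<Omega>(2) by (intro compact_imp_bounded compact_continuous_image) auto
    then obtain B where "\<And>y. y \<in> closure \<Omega> \<Longrightarrow> \<bar>u y\<bar> \<le> B" by (auto simp: bounded_iff)
    then have "\<bar>u y\<bar> \<le> max 0 B" for y
      using u(2)[of y] closure_subset[of \<Omega>] by (cases "y \<in> \<Omega>") (auto simp: le_max_iff_disj)
    then show "\<exists>B. \<forall>y. \<bar>u y\<bar> \<le> B" by blast
  qed
  obtain Bv Bw where B: "\<And>y. \<bar>v y\<bar> \<le> Bv" "\<And>y. \<bar>w y\<bar> \<le> Bw"
    using cont(2)[OF vf] cont(2)[OF wf] by blast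
  have meas: "v \<in> borel_measurable borel" "w \<in> borel_measurable borel"
    using cont(1)[OF vf] cont(1)[OF wf] by (auto intro: borel_measurable_continuous_onI)
  obtain R where R: "0 < R" "\<And>y. y \<in> \<Omega> \<Longrightarrow> norm (y - z) \<le> R"
    using bounded_within_radius[OF \<Omega>(2), of z] by blast
  have "reg_op s \<eta> (eps z) w z < reg_op s \<eta> (eps z) v z"
  proof (rule reg_op_less_at_max[where M="max Bv Bw" and R=R])
    show "\<bar>v y\<bar> \<le> max Bv Bw" "\<bar>w y\<bar> \<le> max Bv Bw" for y
      using B[of y] by (auto simp: le_max_iff_disj)
    show "v y = 0 \<and> w y = 0" if "R < norm (y - z)" for y
    proof -
      have "y \<notin> \<Omega>" using R(2)[of y] that by auto
      then show ?thesis using vf wf by (auto simp: fe_space_def)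
    qed
  qed (use meas max mz M(1) eps[OF z(1)] R(1) in auto)
  moreover have "min (reg_op s \<eta> (eps z) v z - f z) (v z - \<psi> z) = 0"
    "min (reg_op s \<eta> (eps z) w z - f z) (w z - \<phi> z) = 0"
    using v w z(1) by (auto simp: discrete_obstacle_solution_def)
  ultimately show False using mz M(2)[OF z(1)] by (auto simp: min_def split: if_splits)
qed

end

subsection \<open>Mollification\<close>

lemma has_real_derivative_positive_part_power:
  "((\<lambda>t::real. max 0 t ^ Suc (Suc n)) has_real_derivative real (Suc (Suc n)) * max 0 t ^ Suc n) (at t)"
proof -
  consider "t < 0" | "t = 0" | "0 < t" by linarith
  then show ?thesis
  proof cases
    case 1
    have "((\<lambda>t::real. 0) has_real_derivative 0) (at t)" by simp
    then have "((\<lambda>t::real. max 0 t ^ Suc (Suc n)) has_real_derivative 0) (at t)"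
      by (rule has_field_derivative_transform_within_open[of _ _ _ "{..<0}"]) (use 1 in auto)
    then show ?thesis using 1 by simp
  next
    case 2
    have "((\<lambda>h::real. \<bar>h\<bar> ^ Suc n) \<longlongrightarrow> \<bar>0\<bar> ^ Suc n) (at 0)"
      by (intro tendsto_intros)
    then have lim: "((\<lambda>h::real. \<bar>h\<bar> ^ Suc n) \<longlongrightarrow> 0) (at 0)" by simp
    have "((\<lambda>h::real. max 0 h ^ Suc (Suc n) / h) \<longlongrightarrow> 0) (at 0)"
    proof (rule Lim_null_comparison[OF _ lim])
      show "\<forall>\<^sub>F h in at 0. norm (max 0 h ^ Suc (Suc n) / h) \<le> \<bar>h::real\<bar> ^ Suc n"
      proof (intro always_eventually allI)
        fix h :: real
        show "norm (max 0 h ^ Suc (Suc n) / h) \<le> \<bar>h\<bar> ^ Suc n"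
        proof (cases "0 < h")
          case False
          then have "norm (max 0 h ^ Suc (Suc n) / h) = 0" by (simp add: max_absorb1)
          also have "0 \<le> \<bar>h\<bar> ^ Suc n" by (intro zero_le_power abs_ge_zero)
          finally show ?thesis .
        qed simp
      qed
    qed
    then show ?thesis using 2 by (simp add: has_field_derivative_iff)
  next
    case 3
    have "((\<lambda>t::real. t ^ Suc (Suc n)) has_real_derivative real (Suc (Suc n)) * t ^ Suc n) (at t)"
      by (rule DERIV_cong[OF DERIV_pow]) simp
    then have "((\<lambda>t::real. max 0 t ^ Suc (Suc n)) has_real_derivative real (Suc (Suc n)) * t ^ Suc n) (at t)"
      by (rule has_field_derivative_transform_within_open[of _ _ _ "{0<..}"]) (use 3 in auto)
    then show ?thesis using 3 by simp
  qed
qed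

lemma C2_function_scale:
  assumes "C2_function \<phi>"
  shows "C2_function (\<lambda>x. c * \<phi> x)"
proof -
  obtain g D2 where g: "\<And>x. (\<phi> has_derivative (\<lambda>v. g x \<bullet> v)) (at x)"
    "\<And>x. (g has_derivative blinfun_apply (D2 x)) (at x)" "continuous_on UNIV D2"
    using assms unfolding C2_function_def by blast
  show ?thesis
    unfolding C2_function_def
  proof (intro exI[of _ "\<lambda>x. c *\<^sub>R g x"] exI[of _ "\<lambda>x. c *\<^sub>R D2 x"] conjI allI)
    fix x
    show "((\<lambda>x. c * \<phi> x) has_derivative (\<lambda>v. c *\<^sub>R g x \<bullet> v)) (at x)"
      using has_derivative_mult_right[OF g(1)[of x], of c] by simp
    show "((\<lambda>x. c *\<^sub>R g x) has_derivative blinfun_apply (c *\<^sub>R D2 x)) (at x)"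
      using has_derivative_scaleR_right[OF g(2)[of x], of c] by (simp add: scaleR_blinfun.rep_eq)
    show "continuous_on UNIV (\<lambda>x. c *\<^sub>R D2 x)" using g(3) by (intro continuous_intros)
  qed
qed

lemma C2_function_add_const:
  assumes "C2_function \<phi>"
  shows "C2_function (\<lambda>x. \<phi> x + c)"
proof -
  obtain g D2 where g: "\<And>x. (\<phi> has_derivative (\<lambda>v. g x \<bullet> v)) (at x)"
    "\<And>x. (g has_derivative blinfun_apply (D2 x)) (at x)" "continuous_on UNIV D2"
    using assms unfolding C2_function_def by blast
  then show ?thesis
    unfolding C2_function_def by (intro exI[of _ g] exI[of _ D2]) (auto intro: has_derivative_add_const)
qed

text \<open>The cube is the least integer power that makes the truncated paraboloid twice
  continuously differentiable, which is all the smoothness asked of test functions.\<close>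

definition bump :: "real \<Rightarrow> 'a::euclidean_space \<Rightarrow> real" where
  "bump \<epsilon> x = max 0 (\<epsilon>\<^sup>2 - x \<bullet> x) ^ 3"

lemma bump_nonneg: "0 \<le> bump \<epsilon> x"
  by (simp add: bump_def)

lemma C2_function_bump: "C2_function (bump \<epsilon> :: 'a::euclidean_space \<Rightarrow> real)"
proof -
  define P where "P x = max 0 (\<epsilon>\<^sup>2 - x \<bullet> x)" for x :: 'a
  \<comment> \<open>The Hessian of \<open>P x ^ 3\<close>, whose gradient is
    \<open>- 6 * (P x)\<^sup>2\<close> times \<open>x\<close>; the second summand is a multiple of
    the rank one map that sends \<open>v\<close> to
    \<open>(x \<bullet> v) *\<^sub>R x\<close>.\<close>
  define D2 :: "'a \<Rightarrow> 'a \<Rightarrow>\<^sub>L 'a" where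
    "D2 x = (- 6 * (P x)\<^sup>2) *\<^sub>R id_blinfun
       + (24 * P x) *\<^sub>R (blinfun_scaleR_left x o\<^sub>L blinfun_inner_right x)" for x
  have q: "((\<lambda>x. \<epsilon>\<^sup>2 - x \<bullet> x) has_derivative (\<lambda>v. - 2 * (x \<bullet> v))) (at x)" for x :: 'a
    by (auto intro!: derivative_eq_intros simp: inner_commute)
  have P2: "((\<lambda>x. (P x)\<^sup>2) has_derivative (\<lambda>v. - 4 * P x * (x \<bullet> v))) (at x)" for x
    using has_derivative_compose[OF q has_real_derivative_positive_part_power[of 0, unfolded has_field_derivative_def]]
    by (simp add: P_def[abs_def] numeral_2_eq_2 mult_ac)
  show ?thesis
    unfolding C2_function_def
  proof (intro exI[of _ "\<lambda>x. (- 6 * (P x)\<^sup>2) *\<^sub>R x"] exI[of _ D2] conjI allI)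
    fix x :: 'a
    show "(bump \<epsilon> has_derivative (\<lambda>v. (- 6 * (P x)\<^sup>2) *\<^sub>R x \<bullet> v)) (at x)"
      using has_derivative_compose[OF q has_real_derivative_positive_part_power[of 1, unfolded has_field_derivative_def]]
      by (simp add: bump_def[abs_def] P_def numeral_2_eq_2 numeral_3_eq_3 mult_ac)
    have "((\<lambda>x. (- 6 * (P x)\<^sup>2) *\<^sub>R x) has_derivative (\<lambda>v. (- 6 * (P x)\<^sup>2) *\<^sub>R v + (- 6 * (- 4 * P x * (x \<bullet> v))) *\<^sub>R x)) (at x)"
      by (intro has_derivative_scaleR has_derivative_mult_right P2 has_derivative_ident)
    moreover have "blinfun_apply (D2 x) = (\<lambda>v. (- 6 * (P x)\<^sup>2) *\<^sub>R v + (- 6 * (- 4 * P x * (x \<bullet> v))) *\<^sub>R x)"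
      by (rule ext) (simp add: D2_def blinfun.bilinear_simps mult_ac)
    ultimately show "((\<lambda>x. (- 6 * (P x)\<^sup>2) *\<^sub>R x) has_derivative blinfun_apply (D2 x)) (at x)"
      by (simp only:)
  next
    have "continuous_on UNIV P" unfolding P_def by (intro continuous_intros)
    then show "continuous_on UNIV D2" unfolding D2_def by (intro continuous_intros)
  qed
qed

lemma C2_function_continuous:
  assumes "C2_function \<phi>"
  shows "continuous_on UNIV \<phi>"
proof -
  obtain g where "\<And>x. (\<phi> has_derivative (\<lambda>v. g x \<bullet> v)) (at x)"
    using assms unfolding C2_function_def by blast
  then show ?thesis by (meson continuous_at_imp_continuous_on has_derivative_continuous)
qed

lemma integrable_continuous_bounded_support:
  fixes h :: "'a::euclidean_space \<Rightarrow> real"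
  assumes "continuous_on UNIV h" "\<And>x. x \<notin> cbox a b \<Longrightarrow> h x = 0"
  shows "integrable lborel h" and "integral\<^sup>L lborel h = integral (cbox a b) h"
proof -
  have c: "continuous_on (cbox a b) h" using assms(1) continuous_on_subset by blast
  have "integrable lborel (\<lambda>x. indicator (cbox a b) x *\<^sub>R h x)"
    by (rule borel_integrable_compact[OF compact_cbox c])
  moreover have eq: "(\<lambda>x. indicator (cbox a b) x *\<^sub>R h x) = h"
    using assms(2) by (auto simp: fun_eq_iff indicator_def)
  ultimately show 1: "integrable lborel h" by simp
  have "set_integrable lborel (cbox a b) h" using 1 eq by (simp add: set_integrable_def)
  from set_borel_integral_eq_integral(2)[OF this]
  show "integral\<^sup>L lborel h = integral (cbox a b) h"
    unfolding set_lebesgue_integral_def eq .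
qed

lemma C2_mollifier_exists:
  assumes "0 < \<epsilon>"
  obtains \<rho> :: "'a::euclidean_space \<Rightarrow> real"
  where "C2_function \<rho>" "\<And>x. 0 \<le> \<rho> x" "\<And>x. \<epsilon> \<le> norm x \<Longrightarrow> \<rho> x = 0"
    "integrable lborel \<rho>" "integral\<^sup>L lborel \<rho> = 1"
proof -
  let ?b = "bump \<epsilon> :: 'a \<Rightarrow> real"
  have b0: "?b x = 0" if "\<epsilon> \<le> norm x" for x
  proof -
    have "\<epsilon>\<^sup>2 \<le> (norm x)\<^sup>2" using that assms by (intro power_mono) auto
    then show ?thesis by (simp add: bump_def power2_norm_eq_inner)
  qed
  have cont: "continuous_on UNIV ?b" by (rule C2_function_continuous[OF C2_function_bump])
  obtain a c where ac: "cball (0::'a) \<epsilon> \<subseteq> cbox a c"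
    using bounded_subset_cbox_symmetric[OF bounded_cball] by metis
  have int: "integrable lborel ?b"
    by (rule integrable_continuous_bounded_support(1)[OF cont, of a c]) (use ac b0 in force)
  have pos: "0 < integral\<^sup>L lborel ?b"
  proof -
    have "0 \<le> integral\<^sup>L lborel ?b" by (intro integral_nonneg_AE AE_I2) (simp add: bump_def)
    moreover have "integral\<^sup>L lborel ?b \<noteq> 0"
    proof
      assume "integral\<^sup>L lborel ?b = 0"
      then have "AE x in lborel. ?b x = 0"
        using int by (subst (asm) integral_nonneg_eq_0_iff_AE) (auto simp: bump_def)
      moreover have pos: "?b x \<noteq> 0" if "x \<in> ball 0 \<epsilon>" for x
      proof -
        have "(norm x)\<^sup>2 < \<epsilon>\<^sup>2" using that assms by (intro power_strict_mono) auto
        then show ?thesis by (simp add: bump_def power2_norm_eq_inner)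
      qed
      ultimately have "AE x in lborel. x \<notin> ball (0::'a) \<epsilon>" by (auto elim!: eventually_mono)
      then have "ball (0::'a) \<epsilon> = {}" by (rule open_AE_complement_empty[OF open_ball])
      then show False using assms by simp
    qed
    ultimately show ?thesis by simp
  qed
  show ?thesis
  proof (rule that[of "\<lambda>x. (1 / integral\<^sup>L lborel ?b) * ?b x"])
    show "C2_function (\<lambda>x. (1 / integral\<^sup>L lborel ?b) * ?b x)"
      by (intro C2_function_scale C2_function_bump)
  qed (use pos b0 int in \<open>auto simp: bump_nonneg\<close>)
qed

text \<open>For short steps the mean value theorem along the segment reduces the second difference
  to a difference of gradients, which is Lipschitz on a ball since the Hessian is bounded there. The
  radius \<open>R + 2\<close> leaves room for a unit step from \<open>norm x \<le> R + 1\<close>;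
  for \<open>x\<close> farther out all three points miss the support. Long steps only need
  boundedness.\<close>

lemma C2_second_diff_bound:
  fixes b :: "'a::euclidean_space \<Rightarrow> real"
  assumes C2: "C2_function b" and supp: "\<And>x. R \<le> norm x \<Longrightarrow> b x = 0"
  obtains C where "0 \<le> C" "\<And>x z. \<bar>second_diff b x z\<bar> \<le> C * min 1 ((norm z)\<^sup>2)"
proof -
  obtain g D2 where g: "\<And>x. (b has_derivative (\<lambda>v. g x \<bullet> v)) (at x)"
    "\<And>x. (g has_derivative blinfun_apply (D2 x)) (at x)" "continuous_on UNIV D2"
    using C2 unfolding C2_function_def by blast
  have "bounded (b ` cball 0 R)"
    by (intro compact_imp_bounded compact_continuous_image compact_cball
        continuous_on_subset[OF C2_function_continuous[OF C2] subset_UNIV])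
  then obtain M where M: "\<And>x. x \<in> cball 0 R \<Longrightarrow> \<bar>b x\<bar> \<le> M"
    by (metis bounded_iff imageI real_norm_def)
  have bM: "\<bar>b x\<bar> \<le> max 0 M" for x
    using M[of x] supp[of x] by (cases "norm x \<le> R") (auto simp: le_max_iff_disj)
  have "bounded (D2 ` cball 0 (R + 2))"
    by (intro compact_imp_bounded compact_continuous_image compact_cball
        continuous_on_subset[OF g(3) subset_UNIV])
  then obtain B where B: "\<And>x. x \<in> cball 0 (R + 2) \<Longrightarrow> norm (D2 x) \<le> B"
    by (metis bounded_iff imageI)
  have lip: "norm (g x - g y) \<le> B * norm (x - y)" if "x \<in> cball 0 (R + 2)" "y \<in> cball 0 (R + 2)" for x y
  proof (rule differentiable_bound[OF convex_cball _ _ that])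
    show "(g has_derivative blinfun_apply (D2 x)) (at x within cball 0 (R + 2))" for x
      using g(2) by (rule has_derivative_at_withinI)
    show "onorm (blinfun_apply (D2 x)) \<le> B" if "x \<in> cball 0 (R + 2)" for x
      using B[OF that] by (simp add: norm_blinfun.rep_eq)
  qed
  have near: "\<bar>second_diff b x z\<bar> \<le> 2 * max 0 B * (norm z)\<^sup>2" if z: "norm z \<le> 1" for x z
  proof (cases "norm x \<le> R + 1")
    case True
    define h where "h t = b (x + t *\<^sub>R z) + b (x - t *\<^sub>R z)" for t
    have "(h has_real_derivative (g (x + t *\<^sub>R z) - g (x - t *\<^sub>R z)) \<bullet> z) (at t)" for t
    proof -
      have 1: "((\<lambda>t. x + t *\<^sub>R z) has_derivative (\<lambda>r. r *\<^sub>R z)) (at t)"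
        "((\<lambda>t. x - t *\<^sub>R z) has_derivative (\<lambda>r. - (r *\<^sub>R z))) (at t)"
        by (auto intro!: derivative_eq_intros)
      have "(h has_derivative (\<lambda>r. g (x + t *\<^sub>R z) \<bullet> (r *\<^sub>R z) + g (x - t *\<^sub>R z) \<bullet> (- (r *\<^sub>R z)))) (at t)"
        unfolding h_def
        by (intro has_derivative_add has_derivative_compose[OF 1(1) g(1)] has_derivative_compose[OF 1(2) g(1)])
      moreover have "(\<lambda>r. g (x + t *\<^sub>R z) \<bullet> (r *\<^sub>R z) + g (x - t *\<^sub>R z) \<bullet> (- (r *\<^sub>R z)))
          = (*) ((g (x + t *\<^sub>R z) - g (x - t *\<^sub>R z)) \<bullet> z)"
        by (simp add: fun_eq_iff algebra_simps inner_diff_left)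
      ultimately show ?thesis by (simp add: has_field_derivative_def)
    qed
    then obtain t where t: "0 < t" "t < 1"
      "h 1 - h 0 = (1 - 0) * ((g (x + t *\<^sub>R z) - g (x - t *\<^sub>R z)) \<bullet> z)"
      using MVT2[of 0 1 h "\<lambda>t. (g (x + t *\<^sub>R z) - g (x - t *\<^sub>R z)) \<bullet> z"] by auto
    have "norm (t *\<^sub>R z) \<le> 1" using t z by (simp add: mult_le_one)
    then have in_ball: "x + t *\<^sub>R z \<in> cball 0 (R + 2)" "x - t *\<^sub>R z \<in> cball 0 (R + 2)"
      using True norm_triangle_ineq[of x "t *\<^sub>R z"] norm_triangle_ineq4[of x "t *\<^sub>R z"] by auto
    have "\<bar>second_diff b x z\<bar> = \<bar>h 1 - h 0\<bar>" by (simp add: h_def second_diff_def)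
    also have "\<dots> \<le> norm (g (x + t *\<^sub>R z) - g (x - t *\<^sub>R z)) * norm z"
      using t(3) Cauchy_Schwarz_ineq2 by simp
    also have "\<dots> \<le> (B * norm ((x + t *\<^sub>R z) - (x - t *\<^sub>R z))) * norm z"
      by (intro mult_right_mono lip in_ball) simp
    also have "(x + t *\<^sub>R z) - (x - t *\<^sub>R z) = (2 * t) *\<^sub>R z"
      by (simp add: scaleR_2 flip: scaleR_scaleR)
    also have "(B * norm ((2 * t) *\<^sub>R z)) * norm z = 2 * (B * (t * (norm z)\<^sup>2))"
      using t by (simp add: power2_eq_square)
    also have "\<dots> \<le> 2 * (max 0 B * (1 * (norm z)\<^sup>2))"
      using t by (intro mult_left_mono mult_mono mult_right_mono) auto
    finally show ?thesis by simp
  next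
    case False
    have "R \<le> norm (x - z)" "R \<le> norm (x + z)" "R \<le> norm x"
      using False z norm_triangle_ineq2[of x z] norm_triangle_ineq2[of x "- z"] by auto
    then show ?thesis by (simp add: second_diff_def supp)
  qed
  have far: "\<bar>second_diff b x z\<bar> \<le> 4 * max 0 M" for x z
    using bM[of x] bM[of "x - z"] bM[of "x + z"] unfolding second_diff_def by linarith
  show ?thesis
  proof (rule that[of "2 * max 0 B + 4 * max 0 M"])
    fix x z
    have *: "0 \<le> 2 * max 0 B" "0 \<le> 4 * max 0 M" by auto
    show "\<bar>second_diff b x z\<bar> \<le> (2 * max 0 B + 4 * max 0 M) * min 1 ((norm z)\<^sup>2)"
    proof (cases "norm z \<le> 1")
      case True
      then have min: "min 1 ((norm z)\<^sup>2) = (norm z)\<^sup>2" by (simp add: power_le_one)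
      have "0 \<le> 4 * max 0 M * (norm z)\<^sup>2" using *(2) by (intro mult_nonneg_nonneg) auto
      then show ?thesis
        using near[OF True, of x] unfolding min distrib_right by linarith
    next
      case False
      then have "min 1 ((norm z)\<^sup>2) = 1" by (simp add: one_le_power)
      then show ?thesis using far[of x z] * by simp
    qed
  qed simp
qed

section \<open>Convolution with C2 functions\<close>

definition conv :: "('a::euclidean_space \<Rightarrow> real) \<Rightarrow> ('a \<Rightarrow> real) \<Rightarrow> 'a \<Rightarrow> real" where
  "conv g b x = (LINT y|lborel. g y * b (x - y))"

context
  fixes g :: "'a::euclidean_space \<Rightarrow> real" and a c :: 'a
  assumes g_cont: "continuous_on UNIV g" and g_supp: "\<And>x. x \<notin> cbox a c \<Longrightarrow> g x = 0"
begin

lemma integrable_mult_conv: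
  assumes "continuous_on UNIV b"
  shows "integrable lborel (\<lambda>y. g y * b (x - y))"
    and "(LINT y|lborel. g y * b (x - y)) = integral (cbox a c) (\<lambda>y. g y * b (x - y))"
proof -
  have "continuous_on UNIV (\<lambda>y. g y * b (x - y))"
    using g_cont by (intro continuous_intros continuous_on_compose2[OF assms]) auto
  then show "integrable lborel (\<lambda>y. g y * b (x - y))"
    "(LINT y|lborel. g y * b (x - y)) = integral (cbox a c) (\<lambda>y. g y * b (x - y))"
    by (intro integrable_continuous_bounded_support[of _ a c]; use g_supp in simp)+
qed

text \<open>All differentiation falls on \<open>b\<close>, so continuity of \<open>g\<close> is
  enough. As \<open>g\<close> is supported in a fixed box, the convolution is an integral over that
  box with \<open>x\<close> as a parameter, and the Leibniz rule applies twice.\<close>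

lemma C2_function_conv:
  assumes "C2_function b"
  shows "C2_function (conv g b)"
proof -
  obtain G D2 where G: "\<And>x. (b has_derivative (\<lambda>v. G x \<bullet> v)) (at x)"
    "\<And>x. (G has_derivative blinfun_apply (D2 x)) (at x)" "continuous_on UNIV D2"
    using assms unfolding C2_function_def by blast
  have Gc: "continuous_on UNIV G"
    using G(2) by (meson continuous_at_imp_continuous_on has_derivative_continuous)
  have bc: "continuous_on UNIV b" by (rule C2_function_continuous[OF assms])
  have sub: "((\<lambda>x. x - t) has_derivative (\<lambda>v. v)) (at x)" for x t :: 'a
    by (auto intro!: derivative_eq_intros)
  have cg: "continuous_on (cbox a c) g" using g_cont continuous_on_subset by blast
  have cont2: "continuous_on (UNIV \<times> cbox a c) (\<lambda>(x, t). g t *\<^sub>R F (x - t))"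
    if "continuous_on UNIV F" for F :: "'a \<Rightarrow> 'b::real_normed_vector"
    unfolding case_prod_beta
    by (intro continuous_intros continuous_on_compose2[OF that] continuous_on_compose2[OF g_cont]) auto
  have cont1: "continuous_on (cbox a c) (\<lambda>t. g t *\<^sub>R F (x - t))"
    if "continuous_on UNIV F" for F :: "'a \<Rightarrow> 'b::real_normed_vector" and x
    by (intro continuous_intros continuous_on_compose2[OF that] cg) auto
  let ?G = "\<lambda>x. integral (cbox a c) (\<lambda>t. g t *\<^sub>R G (x - t))"
  let ?D = "\<lambda>x. integral (cbox a c) (\<lambda>t. g t *\<^sub>R D2 (x - t))"
  have inner: "continuous_on UNIV (\<lambda>x. blinfun_inner_right (G x))"
    using Gc by (intro continuous_intros)
  have "(conv g b has_derivative (\<lambda>v. ?G x \<bullet> v)) (at x)" for x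
  proof -
    have "((\<lambda>x. integral (cbox a c) (\<lambda>t. g t * b (x - t))) has_derivative
        integral (cbox a c) (\<lambda>t. g t *\<^sub>R blinfun_inner_right (G (x - t)))) (at x within UNIV)"
    proof (rule leibniz_rule)
      fix x t
      have "((\<lambda>x. b (x - t)) has_derivative (\<lambda>v. G (x - t) \<bullet> v)) (at x)"
        by (rule has_derivative_compose[OF sub G(1)])
      then have "((\<lambda>x. g t * b (x - t)) has_derivative (\<lambda>v. g t * (G (x - t) \<bullet> v))) (at x)"
        by (rule has_derivative_mult_right)
      moreover have "blinfun_apply (g t *\<^sub>R blinfun_inner_right (G (x - t))) = (\<lambda>v. g t * (G (x - t) \<bullet> v))"
        by (rule ext) (simp add: blinfun.bilinear_simps)
      ultimately show "((\<lambda>x. g t * b (x - t)) has_derivative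
          blinfun_apply (g t *\<^sub>R blinfun_inner_right (G (x - t)))) (at x within UNIV)"
        by (simp only:)
      show "(\<lambda>t. g t * b (x - t)) integrable_on cbox a c"
        using cont1[OF bc, of x] by (intro integrable_continuous) simp
    qed (use cont2[OF inner] in auto)
    \<comment> \<open>The Leibniz rule delivers an integral of functionals;
      \<open>C2_function\<close> asks for the inner product with a gradient vector.\<close>
    moreover have "blinfun_apply (integral (cbox a c) (\<lambda>t. g t *\<^sub>R blinfun_inner_right (G (x - t)))) = (\<lambda>v. ?G x \<bullet> v)"
    proof (rule ext)
      fix v
      have "blinfun_apply (integral (cbox a c) (\<lambda>t. g t *\<^sub>R blinfun_inner_right (G (x - t)))) v
          = integral (cbox a c) (\<lambda>t. blinfun_apply (g t *\<^sub>R blinfun_inner_right (G (x - t))) v)"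
        by (intro blinfun_apply_integral integrable_continuous cont1[OF inner])
      also have "\<dots> = integral (cbox a c) ((\<lambda>y. y \<bullet> v) \<circ> (\<lambda>t. g t *\<^sub>R G (x - t)))"
        by (simp add: blinfun.bilinear_simps o_def)
      also have "\<dots> = ?G x \<bullet> v"
        by (intro integral_linear bounded_linear_inner_left integrable_continuous cont1[OF Gc])
      finally show "blinfun_apply (integral (cbox a c) (\<lambda>t. g t *\<^sub>R blinfun_inner_right (G (x - t)))) v = ?G x \<bullet> v" .
    qed
    moreover have "conv g b = (\<lambda>x. integral (cbox a c) (\<lambda>t. g t * b (x - t)))"
      unfolding conv_def using integrable_mult_conv(2)[OF bc] by (rule ext)
    ultimately show ?thesis by simp
  qed
  moreover have "(?G has_derivative blinfun_apply (?D x)) (at x)" for x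
  proof (rule leibniz_rule)
    fix x t
    have "((\<lambda>x. G (x - t)) has_derivative blinfun_apply (D2 (x - t))) (at x)"
      by (rule has_derivative_compose[OF sub G(2)])
    then have "((\<lambda>x. g t *\<^sub>R G (x - t)) has_derivative (\<lambda>v. g t *\<^sub>R blinfun_apply (D2 (x - t)) v)) (at x)"
      by (rule has_derivative_scaleR_right)
    moreover have "blinfun_apply (g t *\<^sub>R D2 (x - t)) = (\<lambda>v. g t *\<^sub>R blinfun_apply (D2 (x - t)) v)"
      by (rule ext) (simp add: blinfun.bilinear_simps)
    ultimately show "((\<lambda>x. g t *\<^sub>R G (x - t)) has_derivative blinfun_apply (g t *\<^sub>R D2 (x - t))) (at x within UNIV)"
      by (simp only:)
    show "(\<lambda>t. g t *\<^sub>R G (x - t)) integrable_on cbox a c"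
      by (intro integrable_continuous cont1[OF Gc])
  qed (use cont2[OF G(3)] in auto)
  moreover have "continuous_on UNIV ?D"
    by (rule integral_continuous_on_param[OF cont2[OF G(3)]])
  ultimately show ?thesis
    unfolding C2_function_def by (intro exI[of _ ?G] exI[of _ ?D] conjI allI)
qed

lemma second_diff_conv:
  assumes "continuous_on UNIV b"
  shows "second_diff (conv g b) x z = (LINT y|lborel. g y * second_diff b (x - y) z)"
proof -
  have "second_diff (conv g b) x z
      = (LINT y|lborel. 2 * (g y * b (x - y)) - g y * b (x - z - y) - g y * b (x + z - y))"
    using integrable_mult_conv(1)[OF assms] by (simp add: second_diff_def conv_def)
  also have "\<dots> = (LINT y|lborel. g y * second_diff b (x - y) z)"
    by (intro Bochner_Integration.integral_cong) (simp_all add: second_diff_def algebra_simps)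
  finally show ?thesis .
qed

text \<open>The estimate sees \<open>g\<close> only through its maximum and the size of its support;
  this is what lets operators of mollifications pass to uniform limits.\<close>

lemma second_diff_conv_bound:
  assumes b: "continuous_on UNIV b" "\<And>x. \<bar>second_diff b x z\<bar> \<le> C" and M: "\<And>y. \<bar>g y\<bar> \<le> M"
  shows "\<bar>second_diff (conv g b) x z\<bar> \<le> M * measure lborel (cbox a c) * C"
proof -
  have "\<bar>second_diff (conv g b) x z\<bar> \<le> (LINT y|lborel. \<bar>g y * second_diff b (x - y) z\<bar>)"
    unfolding second_diff_conv[OF b(1)] by (rule integral_abs_bound)
  also have "\<dots> \<le> (LINT y|lborel. (M * C) * indicator (cbox a c) y)"
  proof (rule integral_mono)
    have "integrable lborel (\<lambda>y. 2 * (g y * b (x - y)) - g y * b (x - z - y) - g y * b (x + z - y))"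
      using integrable_mult_conv(1)[OF b(1)] by simp
    moreover have "(\<lambda>y. 2 * (g y * b (x - y)) - g y * b (x - z - y) - g y * b (x + z - y))
        = (\<lambda>y. g y * second_diff b (x - y) z)"
      by (simp add: fun_eq_iff second_diff_def algebra_simps)
    ultimately show "integrable lborel (\<lambda>y. \<bar>g y * second_diff b (x - y) z\<bar>)" by simp
    show "integrable lborel (\<lambda>y. (M * C) * indicat_real (cbox a c) y)"
      by (rule integrable_mult_right, rule integrable_real_indicator, simp,
          rule emeasure_bounded_finite, rule bounded_cbox)
    fix y
    have "0 \<le> M" using M[of y] by linarith
    then show "\<bar>g y * second_diff b (x - y) z\<bar> \<le> (M * C) * indicat_real (cbox a c) y"
      using g_supp[of y] M[of y] b(2)[of "x - y"]
      by (cases "y \<in> cbox a c") (auto simp: abs_mult intro!: mult_mono)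
  qed
  also have "\<dots> = M * measure lborel (cbox a c) * C" by simp
  finally show ?thesis .
qed

text \<open>The oscillation of \<open>g\<close> enters only within distance
  \<open>\<epsilon>\<close> of \<open>x\<close>, so \<open>\<tau> = 0\<close> is a legitimate choice
  where \<open>g\<close> is locally constant.\<close>

lemma conv_close:
  assumes \<rho>: "continuous_on UNIV \<rho>" "\<And>x. 0 \<le> \<rho> x" "\<And>x. \<epsilon> \<le> norm x \<Longrightarrow> \<rho> x = 0"
    "integrable lborel \<rho>" "integral\<^sup>L lborel \<rho> = 1"
    and close: "\<And>y. norm (x - y) < \<epsilon> \<Longrightarrow> \<bar>g y - g x\<bar> \<le> \<tau>"
  shows "\<bar>conv g \<rho> x - g x\<bar> \<le> \<tau>"
proof -
  have m: "\<rho> \<in> borel_measurable borel" using \<rho>(1) by (rule borel_measurable_continuous_onI)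
  have i: "integrable lborel (\<lambda>y. \<rho> (x - y))" "(LINT y|lborel. \<rho> (x - y)) = 1"
    using integrable_lborel_reflect[OF m] integral_lborel_reflect[OF m] \<rho>(4,5) by auto
  note ig = integrable_mult_conv(1)[OF \<rho>(1), of x]
  have "conv g \<rho> x - g x = (LINT y|lborel. g y * \<rho> (x - y) - g x * \<rho> (x - y))"
    using i ig by (simp add: conv_def)
  also have "\<bar>\<dots>\<bar> \<le> (LINT y|lborel. \<bar>g y * \<rho> (x - y) - g x * \<rho> (x - y)\<bar>)"
    by (rule integral_abs_bound)
  also have "\<dots> \<le> (LINT y|lborel. \<tau> * \<rho> (x - y))"
  proof (rule integral_mono)
    fix y
    show "\<bar>g y * \<rho> (x - y) - g x * \<rho> (x - y)\<bar> \<le> \<tau> * \<rho> (x - y)"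
    proof (cases "norm (x - y) < \<epsilon>")
      case True
      then show ?thesis
        using close[OF True] \<rho>(2)[of "x - y"] by (simp add: abs_mult mult_right_mono flip: left_diff_distrib)
    qed (simp add: \<rho>(3))
  qed (use i ig in auto)
  also have "\<dots> = \<tau>" using i by simp
  finally show ?thesis .
qed

end

subsection \<open>The energy form tested with a mollifier\<close>

text \<open>For fixed \<open>x\<close> the map sending \<open>z\<close> to \<open>x - z\<close> is a
  reflection, so the slices keep their measure. This change of variables makes the kernel of the
  energy form depend on one variable alone.\<close>

lemma lborel_shear:
  "distr lborel borel (\<lambda>(z, x). (x, x - z)) = (lborel :: ('a::euclidean_space \<times> 'a) measure)"
proof (rule measure_eqI)
  let ?T = "\<lambda>(z, x). (x, x - z) :: 'a \<times> 'a"
  have T [measurable]: "?T \<in> borel \<rightarrow>\<^sub>M borel"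
    by (intro borel_measurable_continuous_onI) (auto intro!: continuous_intros simp: case_prod_beta)
  show "sets (distr lborel borel ?T) = sets lborel" by simp
  fix A assume "A \<in> sets (distr lborel borel ?T)"
  then have A [measurable]: "A \<in> sets borel" by simp
  have sets: "sets ((lborel :: 'a measure) \<Otimes>\<^sub>M (lborel :: 'a measure)) = sets borel"
    by (simp only: lborel_prod sets_lborel)
  have TA: "?T -` A \<in> sets borel" using measurable_sets[OF T A] by simp
  have "emeasure (distr lborel borel ?T) A = emeasure lborel (?T -` A)"
    using A by (subst emeasure_distr) auto
  also have "\<dots> = emeasure (lborel \<Otimes>\<^sub>M lborel) (?T -` A)" by (simp only: lborel_prod)
  also have "\<dots> = (\<integral>\<^sup>+x. emeasure lborel ((\<lambda>z. (z, x)) -` (?T -` A)) \<partial>lborel)"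
    by (rule lborel_pair.emeasure_pair_measure_alt2) (simp only: sets TA)
  also have "\<dots> = (\<integral>\<^sup>+x. emeasure lborel (Pair x -` A) \<partial>lborel)"
  proof (rule nn_integral_cong)
    fix x :: 'a
    have P: "Pair x \<in> borel \<rightarrow>\<^sub>M (borel :: ('a \<times> 'a) measure)"
      by (intro borel_measurable_continuous_onI continuous_intros)
    have PA: "Pair x -` A \<in> sets borel" using measurable_sets[OF P A] by simp
    have "emeasure lborel (Pair x -` A) = emeasure (distr lborel borel (\<lambda>z. x - z)) (Pair x -` A)"
      by (simp only: lborel_reflect)
    also have "\<dots> = emeasure lborel ((\<lambda>z. x - z) -` (Pair x -` A))"
      using PA by (subst emeasure_distr) auto
    finally have "emeasure lborel (Pair x -` A) = emeasure lborel ((\<lambda>z. x - z) -` (Pair x -` A))" .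
    then show "emeasure lborel ((\<lambda>z. (z, x)) -` (?T -` A)) = emeasure lborel (Pair x -` A)"
      by (simp add: vimage_def)
  qed
  also have "\<dots> = emeasure (lborel \<Otimes>\<^sub>M lborel) A"
    by (rule lborel.emeasure_pair_measure_alt[symmetric]) (simp only: sets A)
  also have "\<dots> = emeasure lborel A" by (simp only: lborel_prod)
  finally show "emeasure (distr lborel borel ?T) A = emeasure lborel A" .
qed

lemma shear_measurable: "(\<lambda>(z, x). (x, x - z)) \<in> borel \<rightarrow>\<^sub>M (borel :: ('a::euclidean_space \<times> 'a) measure)"
  by (intro borel_measurable_continuous_onI) (auto intro!: continuous_intros simp: case_prod_beta)

lemma integrable_shear:
  fixes h :: "'a::euclidean_space \<times> 'a \<Rightarrow> real"
  assumes "h \<in> borel_measurable borel"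
  shows "integrable lborel h \<longleftrightarrow> integrable (lborel \<Otimes>\<^sub>M lborel) (\<lambda>(z, x). h (x, x - z))"
proof -
  have "integrable (distr lborel borel (\<lambda>(z, x). (x, x - z))) h \<longleftrightarrow> integrable lborel (\<lambda>p. h ((\<lambda>(z, x). (x, x - z)) p))"
    using assms shear_measurable by (intro integrable_distr_eq) auto
  then show ?thesis unfolding lborel_shear lborel_prod by (simp add: case_prod_unfold)
qed

lemma integral_shear:
  fixes h :: "'a::euclidean_space \<times> 'a \<Rightarrow> real"
  assumes "h \<in> borel_measurable borel"
  shows "(LINT p|lborel. h p) = (LINT p|(lborel \<Otimes>\<^sub>M lborel). (\<lambda>(z, x). h (x, x - z)) p)"
proof -
  have "(LINT p|distr lborel borel (\<lambda>(z, x). (x, x - z)). h p) = (LINT p|lborel. h ((\<lambda>(z, x). (x, x - z)) p))"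
    using assms shear_measurable by (intro integral_distr) auto
  then show ?thesis unfolding lborel_shear lborel_prod by (simp add: case_prod_unfold)
qed

text \<open>Under the shear the preimage of a null set \<open>N\<close> of differences is
  \<open>N \<times> UNIV\<close>. The transfer is needed because \<eta> agrees with \<open>k\<close>
  only almost everywhere and enters the double integral as a function of
  \<open>x - y\<close>.\<close>

lemma AE_lborel_diff:
  fixes P :: "'a::euclidean_space \<Rightarrow> bool"
  assumes "AE z in lborel. P z"
  shows "AE p in (lborel :: ('a \<times> 'a) measure). P (fst p - snd p)"
proof -
  obtain N where N: "N \<in> null_sets lborel" "{z. \<not> P z} \<subseteq> N"
    using assms by (auto elim!: AE_E simp: null_sets_def)
  have Nb: "N \<in> sets borel" using N by auto
  let ?D = "\<lambda>p::'a \<times> 'a. fst p - snd p"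
  have D: "?D \<in> borel \<rightarrow>\<^sub>M borel"
    by (intro borel_measurable_continuous_onI continuous_intros)
  have DN: "?D -` N \<in> sets borel" using measurable_sets[OF D Nb] by simp
  have "emeasure lborel (?D -` N) = emeasure (distr lborel borel (\<lambda>(z, x). (x, x - z))) (?D -` N)"
    by (simp only: lborel_shear)
  also have "\<dots> = emeasure lborel ((\<lambda>(z, x). (x, x - z)) -` (?D -` N))"
    using DN shear_measurable by (subst emeasure_distr) auto
  also have "(\<lambda>(z, x). (x, x - z)) -` (?D -` N) = N \<times> (UNIV :: 'a set)" by auto
  also have "emeasure lborel (N \<times> (UNIV :: 'a set)) = emeasure (lborel \<Otimes>\<^sub>M lborel) (N \<times> (UNIV :: 'a set))"
    by (simp only: lborel_prod)
  also have "\<dots> = 0"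
    using N by (subst lborel.emeasure_pair_measure_Times) auto
  finally have "?D -` N \<in> null_sets lborel" using DN by (auto simp: null_sets_def)
  then show ?thesis using N(2) by (intro AE_I') auto
qed

section \<open>Gagliardo seminorm and fractional Sobolev space\<close>

definition gagliardo :: "real \<Rightarrow> ('a::euclidean_space \<Rightarrow> real) \<Rightarrow> 'a \<times> 'a \<Rightarrow> real" where
  "gagliardo s w = (\<lambda>(x, y). (w x - w y)\<^sup>2 / norm (x - y) powr (real DIM('a) + 2 * s))"

lemma gagliardo_measurable:
  assumes [measurable]: "w \<in> borel_measurable borel"
  shows "gagliardo s w \<in> borel_measurable borel"
  unfolding gagliardo_def by (simp only: borel_prod[symmetric]) measurable

lemma Hs_space_iff:
  assumes w: "w \<in> borel_measurable borel"
  shows "w \<in> Hs_space s \<longleftrightarrow> integrable lborel (\<lambda>x. (w x)\<^sup>2) \<and> integrable lborel (gagliardo s w)"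
proof -
  have m: "w \<in> borel_measurable lebesgue" by (rule measurable_completion) (use w in simp)
  have "integrable lebesgue (\<lambda>x. (w x)\<^sup>2) \<longleftrightarrow> integrable lborel (\<lambda>x. (w x)\<^sup>2)"
    by (rule integrable_completion) (use w in simp)
  moreover have "integrable lebesgue (gagliardo s w) \<longleftrightarrow> integrable lborel (gagliardo s w)"
    by (rule integrable_completion) (use gagliardo_measurable[OF w] in simp)
  ultimately show ?thesis using m unfolding Hs_space_def gagliardo_def by blast
qed

lemma Hs_space_add_scaled:
  assumes w: "w \<in> borel_measurable borel" "w \<in> Hs_space s"
    and v: "v \<in> borel_measurable borel" "v \<in> Hs_space s"
  shows "(\<lambda>x. w x + c * v x) \<in> Hs_space s"
proof -
  note [measurable] = w(1) v(1)
  have m: "(\<lambda>x. w x + c * v x) \<in> borel_measurable borel" by measurable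
  have sq: "(a + c * b)\<^sup>2 \<le> 2 * a\<^sup>2 + 2 * c\<^sup>2 * b\<^sup>2" for a b :: real
    using sum_squares_bound[of a "c * b"] by (simp add: power2_sum power_mult_distrib algebra_simps)
  have 1: "integrable lborel (\<lambda>x. 2 * (w x)\<^sup>2 + 2 * c\<^sup>2 * (v x)\<^sup>2)"
    using w v by (simp add: Hs_space_iff)
  have 2: "integrable lborel (\<lambda>p. 2 * gagliardo s w p + 2 * c\<^sup>2 * gagliardo s v p)"
    using w v by (simp add: Hs_space_iff)
  have "integrable lborel (\<lambda>x. (w x + c * v x)\<^sup>2)"
    by (rule Bochner_Integration.integrable_bound[OF 1])
      (auto intro!: AE_I2 order_trans[OF sq])
  moreover have "integrable lborel (gagliardo s (\<lambda>x. w x + c * v x))"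
  proof (rule Bochner_Integration.integrable_bound[OF 2])
    show "gagliardo s (\<lambda>x. w x + c * v x) \<in> borel_measurable lborel"
      using gagliardo_measurable[OF m] by simp
    have le: "gagliardo s (\<lambda>x. w x + c * v x) p \<le> 2 * gagliardo s w p + 2 * c\<^sup>2 * gagliardo s v p" for p
    proof -
      obtain x y where p: "p = (x, y)" by (cases p)
      have "(w x + c * v x) - (w y + c * v y) = (w x - w y) + c * (v x - v y)"
        by (simp add: algebra_simps)
      then have "((w x + c * v x) - (w y + c * v y))\<^sup>2 \<le> 2 * (w x - w y)\<^sup>2 + 2 * c\<^sup>2 * (v x - v y)\<^sup>2"
        using sq by metis
      then have "((w x + c * v x) - (w y + c * v y))\<^sup>2 / norm (x - y) powr (real DIM('a) + 2 * s)
          \<le> (2 * (w x - w y)\<^sup>2 + 2 * c\<^sup>2 * (v x - v y)\<^sup>2) / norm (x - y) powr (real DIM('a) + 2 * s)"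
        by (intro divide_right_mono) auto
      then show ?thesis by (simp add: gagliardo_def p add_divide_distrib)
    qed
    have nn: "0 \<le> gagliardo s (\<lambda>x. w x + c * v x) p" for p
      by (simp add: gagliardo_def case_prod_beta)
    show "AE p in lborel. norm (gagliardo s (\<lambda>x. w x + c * v x) p)
        \<le> norm (2 * gagliardo s w p + 2 * c\<^sup>2 * gagliardo s v p)"
      using le nn by (intro AE_I2) (simp add: order_trans[OF le abs_ge_self])
  qed
  ultimately show ?thesis using Hs_space_iff[OF m] by blast
qed

text \<open>Expanding the product gives four correlations, each of which is, after a translation, a
  value of the convolution: twice at \<open>x0\<close>, once at \<open>x0 + z\<close> and once at
  \<open>x0 - z\<close>.\<close>

lemma integral_cross_difference:
  fixes g \<rho> \<psi> :: "'a::euclidean_space \<Rightarrow> real"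
  assumes g: "continuous_on UNIV g" "\<And>x. x \<notin> cbox a c \<Longrightarrow> g x = 0" and \<rho>: "continuous_on UNIV \<rho>"
    and \<psi>_def: "\<And>x. \<psi> x = \<rho> (x0 - x)"
  shows "integrable lborel (\<lambda>x. (g x - g (x - z)) * (\<psi> x - \<psi> (x - z)))"
    and "(LINT x|lborel. (g x - g (x - z)) * (\<psi> x - \<psi> (x - z))) = second_diff (conv g \<rho>) x0 z"
proof -
  have gm [measurable]: "g \<in> borel_measurable borel" using g(1) by (rule borel_measurable_continuous_onI)
  have \<rho>m [measurable]: "\<rho> \<in> borel_measurable borel" using \<rho> by (rule borel_measurable_continuous_onI)
  have i: "integrable lborel (\<lambda>y. g y * \<rho> (x - y))" for x
    by (rule integrable_mult_conv(1)[OF g(1) _ \<rho>, of a c]) (rule g(2))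
  have tr: "integrable lborel (\<lambda>x. h (x - z)) \<longleftrightarrow> integrable lborel h"
    if "h \<in> borel_measurable borel" for h :: "'a \<Rightarrow> real"
    using integrable_lborel_translate[OF that, of "- z"] by simp
  have trI: "(LINT x|lborel. h (x - z)) = (LINT x|lborel. h x)"
    if "h \<in> borel_measurable borel" for h :: "'a \<Rightarrow> real"
    using integral_lborel_translate[OF that, of "- z"] by simp
  have 1: "integrable lborel (\<lambda>x. g x * \<psi> x)" "(LINT x|lborel. g x * \<psi> x) = conv g \<rho> x0"
    using i[of x0] by (simp_all add: \<psi>_def conv_def)
  have 2: "integrable lborel (\<lambda>x. g x * \<psi> (x - z))" "(LINT x|lborel. g x * \<psi> (x - z)) = conv g \<rho> (x0 + z)"
    using i[of "x0 + z"] by (simp_all add: \<psi>_def conv_def algebra_simps)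
  have 3: "integrable lborel (\<lambda>x. g (x - z) * \<psi> x)" "(LINT x|lborel. g (x - z) * \<psi> x) = conv g \<rho> (x0 - z)"
    using tr[of "\<lambda>x. g x * \<rho> (x0 - z - x)"] trI[of "\<lambda>x. g x * \<rho> (x0 - z - x)"] i[of "x0 - z"]
    by (simp_all add: \<psi>_def conv_def algebra_simps)
  have 4: "integrable lborel (\<lambda>x. g (x - z) * \<psi> (x - z))" "(LINT x|lborel. g (x - z) * \<psi> (x - z)) = conv g \<rho> x0"
    using tr[of "\<lambda>x. g x * \<psi> x"] trI[of "\<lambda>x. g x * \<psi> x"] 1 by (simp_all add: \<psi>_def)
  have eq: "(\<lambda>x. (g x - g (x - z)) * (\<psi> x - \<psi> (x - z)))
      = (\<lambda>x. (g x * \<psi> x - g x * \<psi> (x - z)) - (g (x - z) * \<psi> x - g (x - z) * \<psi> (x - z)))"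
    by (simp add: fun_eq_iff algebra_simps)
  show "integrable lborel (\<lambda>x. (g x - g (x - z)) * (\<psi> x - \<psi> (x - z)))"
    unfolding eq by (intro Bochner_Integration.integrable_diff 1 2 3 4)
  show "(LINT x|lborel. (g x - g (x - z)) * (\<psi> x - \<psi> (x - z))) = second_diff (conv g \<rho>) x0 z"
    unfolding eq using 1 2 3 4 by (simp add: second_diff_def)
qed

text \<open>\<open>integral_cross_difference\<close> with both functions equal to the mollifier
  evaluates the inner integral of the Gagliardo double integral as a second difference of a
  convolution, which the Levy weight dominates as a function of \<open>z\<close>.\<close>

lemma Hs_space_C2_compact_support:
  fixes \<rho> :: "'a::euclidean_space \<Rightarrow> real"
  assumes s: "0 < s" "s < 1" and C2: "C2_function \<rho>" and supp: "\<And>x. R \<le> norm x \<Longrightarrow> \<rho> x = 0"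
  shows "(\<lambda>x. \<rho> (x0 - x)) \<in> Hs_space s"
proof -
  define \<psi> where "\<psi> x = \<rho> (x0 - x)" for x
  have \<rho>c: "continuous_on UNIV \<rho>" by (rule C2_function_continuous[OF C2])
  have \<psi>c: "continuous_on UNIV \<psi>"
    unfolding \<psi>_def by (intro continuous_on_compose2[OF \<rho>c] continuous_intros) auto
  have m [measurable]: "\<psi> \<in> borel_measurable borel" using \<psi>c by (rule borel_measurable_continuous_onI)
  obtain c where c: "cball x0 R \<subseteq> cbox (- c) c"
    using bounded_subset_cbox_symmetric[OF bounded_cball] by metis
  have \<psi>0: "\<psi> x = 0" if "x \<notin> cbox (- c) c" for x
  proof -
    have "x \<notin> cball x0 R" using that c by blast
    then show ?thesis using supp by (simp add: \<psi>_def dist_norm)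
  qed
  have "continuous_on UNIV (\<lambda>x. (\<psi> x)\<^sup>2)" using \<psi>c by (intro continuous_intros)
  then have sq: "integrable lborel (\<lambda>x. (\<psi> x)\<^sup>2)"
    by (rule integrable_continuous_bounded_support(1)[of _ "- c" c]) (simp add: \<psi>0)
  obtain C where C: "0 \<le> C" "\<And>x z. \<bar>second_diff \<rho> x z\<bar> \<le> C * min 1 ((norm z)\<^sup>2)"
    using C2_second_diff_bound[OF C2 supp] by metis
  have "bounded (\<psi> ` cbox (- c) c)"
    by (intro compact_imp_bounded compact_continuous_image compact_cbox continuous_on_subset[OF \<psi>c subset_UNIV])
  then obtain M where M: "\<And>x. x \<in> cbox (- c) c \<Longrightarrow> \<bar>\<psi> x\<bar> \<le> M"
    by (metis bounded_iff imageI real_norm_def)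
  have M': "\<bar>\<psi> x\<bar> \<le> max 0 M" for x
    using M[of x] \<psi>0[of x] by (cases "x \<in> cbox (- c) c") (auto simp: le_max_iff_disj)
  define K where "K = max 0 M * measure lborel (cbox (- c) c) * C"
  have cross: "integrable lborel (\<lambda>x. (\<psi> x - \<psi> (x - z))\<^sup>2)"
    "(LINT x|lborel. (\<psi> x - \<psi> (x - z))\<^sup>2) = second_diff (conv \<psi> \<rho>) x0 z" for z
    unfolding power2_eq_square
    by (rule integral_cross_difference[OF \<psi>c _ \<rho>c \<psi>_def, of "- c" c]; rule \<psi>0; assumption)+
  let ?p = "real DIM('a) + 2 * s"
  let ?F = "\<lambda>(z, x). (\<psi> x - \<psi> (x - z))\<^sup>2 / norm z powr ?p"
  have Fm: "?F \<in> borel_measurable (lborel \<Otimes>\<^sub>M lborel)" by measurable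
  have "integrable (lborel \<Otimes>\<^sub>M lborel) ?F"
  proof (rule lborel_pair.Fubini_integrable[OF Fm])
    have eq: "(LINT x|lborel. norm (?F (z, x))) = second_diff (conv \<psi> \<rho>) x0 z / norm z powr ?p" for z
      using cross(2)[of z] by simp
    have "integrable lborel (\<lambda>z. second_diff (conv \<psi> \<rho>) x0 z / norm z powr ?p)"
    proof (rule Bochner_Integration.integrable_bound)
      show "integrable lborel (\<lambda>z::'a. K * levy_weight s z)"
        by (intro integrable_mult_right integrable_levy_weight s)
      have "conv \<psi> \<rho> \<in> borel_measurable borel"
        by (intro borel_measurable_continuous_onI C2_function_continuous C2_function_conv[OF \<psi>c \<psi>0 C2])
      then show "(\<lambda>z. second_diff (conv \<psi> \<rho>) x0 z / norm z powr ?p) \<in> borel_measurable lborel"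
        unfolding second_diff_def by measurable
      show "AE z in lborel. norm (second_diff (conv \<psi> \<rho>) x0 z / norm z powr ?p) \<le> norm (K * levy_weight s z)"
      proof (rule AE_I2)
        fix z :: 'a
        have "\<bar>second_diff (conv \<psi> \<rho>) x0 z\<bar> \<le> max 0 M * measure lborel (cbox (- c) c) * (C * min 1 ((norm z)\<^sup>2))"
          by (rule second_diff_conv_bound[OF \<psi>c \<psi>0 \<rho>c C(2) M'])
        also have "\<dots> = K * min 1 ((norm z)\<^sup>2)" by (simp add: K_def mult_ac)
        finally have "\<bar>second_diff (conv \<psi> \<rho>) x0 z\<bar> / norm z powr ?p \<le> K * min 1 ((norm z)\<^sup>2) / norm z powr ?p"
          by (intro divide_right_mono) auto
        then have "norm (second_diff (conv \<psi> \<rho>) x0 z / norm z powr ?p) \<le> K * levy_weight s z"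
          by (simp add: levy_weight_def)
        also have "\<dots> \<le> norm (K * levy_weight s z)" by simp
        finally show "norm (second_diff (conv \<psi> \<rho>) x0 z / norm z powr ?p) \<le> norm (K * levy_weight s z)" .
      qed
    qed
    then show "integrable lborel (\<lambda>z. LINT x|lborel. norm (?F (z, x)))" unfolding eq .
    show "AE z in lborel. integrable lborel (\<lambda>x. ?F (z, x))"
      using cross(1) by (intro AE_I2) simp
  qed
  then have "integrable lborel (gagliardo s \<psi>)"
    by (subst integrable_shear[OF gagliardo_measurable[OF m]]) (simp add: gagliardo_def)
  then show ?thesis using sq Hs_space_iff[OF m] unfolding \<psi>_def by blast
qed

context levy_kernel
begin

text \<open>
  In the variables \<open>x\<close> and \<open>z = x - y\<close> the kernel depends on \<open>z\<close> only, and integrating the product of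
  differences in \<open>x\<close> first moves the second difference onto the convolution. No smoothness of \<open>g\<close>
  is needed.
\<close>

lemma energy_form_eq_sym_op:
  assumes g: "continuous_on UNIV g" "\<And>x. x \<notin> cbox a c \<Longrightarrow> g x = 0" "g \<in> Hs_space s"
    and C2: "C2_function \<rho>" and supp: "\<And>x. R \<le> norm x \<Longrightarrow> \<rho> x = 0"
  shows "energy_form s \<eta> g (\<lambda>x. \<rho> (x0 - x)) = sym_op (conv g \<rho>) x0"
proof -
  define \<psi> where "\<psi> x = \<rho> (x0 - x)" for x
  have \<rho>c: "continuous_on UNIV \<rho>" by (rule C2_function_continuous[OF C2])
  have \<psi>c: "continuous_on UNIV \<psi>"
    unfolding \<psi>_def by (intro continuous_on_compose2[OF \<rho>c] continuous_intros) auto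
  have m [measurable]: "\<psi> \<in> borel_measurable borel" using \<psi>c by (rule borel_measurable_continuous_onI)
  have gm [measurable]: "g \<in> borel_measurable borel" using g(1) by (rule borel_measurable_continuous_onI)
  have \<psi>H: "\<psi> \<in> Hs_space s"
    using Hs_space_C2_compact_support[OF s C2 supp] unfolding \<psi>_def .
  define H where "H = (\<lambda>(x, y). (g x - g y) * (\<psi> x - \<psi> y) * J (x - y))"
  have Hm: "H \<in> borel_measurable borel"
    unfolding H_def by (simp only: borel_prod[symmetric]) measurable
  \<comment> \<open>Absolute convergence for Fubini: the product of two differences is at most the
    sum of their squares, hence bounded by the two Gagliardo integrands.\<close>
  have Hi: "integrable lborel H"
  proof (rule Bochner_Integration.integrable_bound)
    show "integrable lborel (\<lambda>p. Lam * (gagliardo s g p + gagliardo s \<psi> p))"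
      using g(3) \<psi>H Hs_space_iff[OF gm] Hs_space_iff[OF m] by simp
    show "H \<in> borel_measurable lborel" using Hm by simp
    show "AE p in lborel. norm (H p) \<le> norm (Lam * (gagliardo s g p + gagliardo s \<psi> p))"
    proof (rule AE_I2)
      fix p :: "'a \<times> 'a"
      obtain x y where p: "p = (x, y)" by (cases p)
      have "2 * (\<bar>g x - g y\<bar> * \<bar>\<psi> x - \<psi> y\<bar>) \<le> (g x - g y)\<^sup>2 + (\<psi> x - \<psi> y)\<^sup>2"
        using sum_squares_bound[of "\<bar>g x - g y\<bar>" "\<bar>\<psi> x - \<psi> y\<bar>"] by (simp add: mult.assoc)
      moreover have "0 \<le> \<bar>g x - g y\<bar> * \<bar>\<psi> x - \<psi> y\<bar>" by simp
      ultimately have "\<bar>g x - g y\<bar> * \<bar>\<psi> x - \<psi> y\<bar> \<le> (g x - g y)\<^sup>2 + (\<psi> x - \<psi> y)\<^sup>2" by linarith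
      then have "\<bar>g x - g y\<bar> * \<bar>\<psi> x - \<psi> y\<bar> * k (x - y) \<le> ((g x - g y)\<^sup>2 + (\<psi> x - \<psi> y)\<^sup>2) * Lam"
        using k_nonneg k_le by (intro mult_mono) auto
      then have "\<bar>g x - g y\<bar> * \<bar>\<psi> x - \<psi> y\<bar> * k (x - y) / norm (x - y) powr (real DIM('a) + 2 * s)
          \<le> ((g x - g y)\<^sup>2 + (\<psi> x - \<psi> y)\<^sup>2) * Lam / norm (x - y) powr (real DIM('a) + 2 * s)"
        by (intro divide_right_mono) auto
      also have "\<dots> = Lam * (gagliardo s g p + gagliardo s \<psi> p)"
        by (simp add: gagliardo_def p add_divide_distrib algebra_simps)
      finally have "\<bar>H p\<bar> \<le> Lam * (gagliardo s g p + gagliardo s \<psi> p)"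
        using k_nonneg[of "x - y"] by (simp add: H_def p J_def abs_mult)
      then show "norm (H p) \<le> norm (Lam * (gagliardo s g p + gagliardo s \<psi> p))" by simp
    qed
  qed
  have "AE p in lborel. (\<lambda>(x, y). (g x - g y) * (\<psi> x - \<psi> y) / norm (x - y) powr (real DIM('a) + 2 * s) * \<eta> (sgn (x - y))) p = H p"
    using AE_lborel_diff[OF k_AE] by eventually_elim (auto simp: H_def J_def case_prod_beta)
  then have "energy_form s \<eta> g \<psi> = 1 / 2 * (LINT p|lborel. H p)"
    unfolding energy_form_def using lebesgue_integral_eq_AE[OF Hm] by simp
  also have "(LINT p|lborel. H p) = (LINT p|(lborel \<Otimes>\<^sub>M lborel). (\<lambda>(z, x). H (x, x - z)) p)"
    by (rule integral_shear[OF Hm])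
  also have "\<dots> = (LINT z|lborel. (LINT x|lborel. (\<lambda>(z, x). H (x, x - z)) (z, x)))"
    using Hi integrable_shear[OF Hm] by (intro lborel_pair.integral_fst'[symmetric]) simp
  also have "\<dots> = (LINT z|lborel. (LINT x|lborel. (g x - g (x - z)) * (\<psi> x - \<psi> (x - z))) * J z)"
    by (simp add: H_def)
  also have "\<dots> = (LINT z|lborel. second_diff (conv g \<rho>) x0 z * J z)"
    by (subst integral_cross_difference(2)[OF g(1) _ \<rho>c \<psi>_def, of a c]) (auto simp: g(2))
  finally show ?thesis by (simp add: sym_op_def \<psi>_def)
qed

end

subsection \<open>Comparison of weak and viscosity solutions\<close>

lemma uniformly_continuous_bounded_support:
  fixes g :: "'a::euclidean_space \<Rightarrow> real"
  assumes g: "continuous_on UNIV g" "\<And>x. B < norm x \<Longrightarrow> g x = 0" and "0 < \<tau>"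
  obtains d where "0 < d" "\<And>x y. norm (x - y) < d \<Longrightarrow> \<bar>g x - g y\<bar> \<le> \<tau>"
proof -
  have "uniformly_continuous_on (cball 0 (B + 1)) g"
    by (intro compact_uniformly_continuous compact_cball continuous_on_subset[OF g(1) subset_UNIV])
  then obtain d where d: "0 < d"
    "\<And>x y. x \<in> cball 0 (B + 1) \<Longrightarrow> y \<in> cball 0 (B + 1) \<Longrightarrow> dist y x < d \<Longrightarrow> dist (g y) (g x) < \<tau>"
    using \<open>0 < \<tau>\<close> unfolding uniformly_continuous_on_def by metis
  show ?thesis
  proof (rule that[of "min d 1"])
    fix x y :: 'a assume xy: "norm (x - y) < min d 1"
    show "\<bar>g x - g y\<bar> \<le> \<tau>"
    proof (cases "x \<in> cball 0 (B + 1) \<and> y \<in> cball 0 (B + 1)")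
      case True
      then show ?thesis using d(2)[of y x] xy by (simp add: dist_norm)
    next
      case False
      \<comment> \<open>The points are less than one apart, so if one lies outside radius
        \<open>B + 1\<close>, both lie outside radius \<open>B\<close>, where \<open>g\<close>
        vanishes.\<close>
      then have "B < norm x" "B < norm y"
        using xy norm_triangle_ineq2[of x y] norm_triangle_ineq3[of x y] by auto
      then show ?thesis using g(2) \<open>0 < \<tau>\<close> by simp
    qed
  qed (use d in simp)
qed

lemma mollified_source_le:
  fixes f \<rho> :: "'a::euclidean_space \<Rightarrow> real"
  assumes \<Omega>: "open \<Omega>" "bounded \<Omega>" and f: "continuous_on (closure \<Omega>) f"
    and \<rho>: "\<And>x. 0 \<le> \<rho> x" "\<And>x. \<epsilon> \<le> norm x \<Longrightarrow> \<rho> x = 0" "integrable lborel \<rho>" "integral\<^sup>L lborel \<rho> = 1"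
      "continuous_on UNIV \<rho>"
    and sub: "cball x0 \<epsilon> \<subseteq> \<Omega>" and le: "\<And>y. y \<in> cball x0 \<epsilon> \<Longrightarrow> f y \<le> t"
  shows "(LINT x:\<Omega>|lebesgue. f x * \<rho> (x0 - x)) \<le> t"
proof -
  have \<rho>m [measurable]: "\<rho> \<in> borel_measurable borel" using \<rho>(5) by (rule borel_measurable_continuous_onI)
  \<comment> \<open>The extension by zero is Borel on the whole space, while \<open>f\<close> is
    constrained only on \<open>closure \<Omega>\<close>.\<close>
  define h where "h x = indicator (closure \<Omega>) x * f x" for x
  have hm [measurable]: "h \<in> borel_measurable borel"
    unfolding h_def using borel_measurable_continuous_on_indicator[OF _ f] by simp
  have "compact (closure \<Omega>)" using \<Omega>(2) by simp
  then have "bounded (f ` closure \<Omega>)" using f by (intro compact_imp_bounded compact_continuous_image)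
  then obtain M where M: "\<And>x. x \<in> closure \<Omega> \<Longrightarrow> \<bar>f x\<bar> \<le> M"
    by (metis bounded_iff imageI real_norm_def)
  have hM: "\<bar>h x\<bar> \<le> max 0 M" for x
    using M[of x] by (cases "x \<in> closure \<Omega>") (auto simp: h_def le_max_iff_disj)
  have i: "integrable lborel (\<lambda>x. \<rho> (x0 - x))" "(LINT x|lborel. \<rho> (x0 - x)) = 1"
    using integrable_lborel_reflect[OF \<rho>m] integral_lborel_reflect[OF \<rho>m] \<rho>(3,4) by auto
  have ih: "integrable lborel (\<lambda>x. h x * \<rho> (x0 - x))"
  proof (rule Bochner_Integration.integrable_bound)
    show "integrable lborel (\<lambda>x. max 0 M * \<rho> (x0 - x))" using i(1) by (rule integrable_mult_right)
    show "AE x in lborel. norm (h x * \<rho> (x0 - x)) \<le> norm (max 0 M * \<rho> (x0 - x))"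
      using hM \<rho>(1) by (intro AE_I2) (simp add: abs_mult mult_right_mono)
  qed simp
  have off: "\<rho> (x0 - x) = 0" if "x \<notin> cball x0 \<epsilon>" for x
    using that by (intro \<rho>(2)) (simp add: dist_norm)
  have eq: "indicator \<Omega> x *\<^sub>R (f x * \<rho> (x0 - x)) = h x * \<rho> (x0 - x)" for x
    using off[of x] sub closure_subset[of \<Omega>] by (cases "x \<in> cball x0 \<epsilon>") (auto simp: h_def indicator_def)
  have "(LINT x:\<Omega>|lebesgue. f x * \<rho> (x0 - x)) = (LINT x|lborel. h x * \<rho> (x0 - x))"
    unfolding set_lebesgue_integral_def eq by (rule integral_completion) simp
  also have "\<dots> \<le> (LINT x|lborel. t * \<rho> (x0 - x))"
  proof (rule integral_mono[OF ih])
    show "integrable lborel (\<lambda>x. t * \<rho> (x0 - x))" using i(1) by (rule integrable_mult_right)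
    fix x
    show "h x * \<rho> (x0 - x) \<le> t * \<rho> (x0 - x)"
    proof (cases "x \<in> cball x0 \<epsilon>")
      case True
      then have "x \<in> closure \<Omega>" using sub closure_subset by blast
      then have "h x \<le> t" using le[OF True] by (simp add: h_def)
      then show ?thesis using \<rho>(1) by (intro mult_right_mono)
    qed (simp add: off)
  qed
  also have "\<dots> = t" using i(2) by simp
  finally show ?thesis .
qed

lemma has_frac_op_uminus:
  assumes "has_frac_op s \<eta> w x l"
  shows "has_frac_op s \<eta> (\<lambda>y. - w y) x (- l)"
proof -
  have eq: "frac_integrand s \<eta> (\<lambda>y. - w y) x = (\<lambda>y. - frac_integrand s \<eta> w x y)"
  proof (rule ext)
    fix y
    have "- w x - - w y = - (w x - w y)" by simp
    then show "frac_integrand s \<eta> (\<lambda>y. - w y) x y = - frac_integrand s \<eta> w x y"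
      unfolding frac_integrand_def by (simp only: minus_divide_left[symmetric] mult_minus_left)
  qed
  have "frac_trunc s \<eta> (\<lambda>y. - w y) x = (\<lambda>\<rho>. - frac_trunc s \<eta> w x \<rho>)"
    by (simp add: fun_eq_iff frac_trunc_def eq set_lebesgue_integral_def)
  then show ?thesis
    using assms unfolding has_frac_op_def eq
    by (auto simp: set_integrable_def intro: tendsto_minus)
qed

context levy_kernel
begin

text \<open>\<open>v\<close> is \<open>w - c\<close> on the ball and stays above
  \<open>w - c\<close> elsewhere, so its second differences at \<open>x\<close> are at most those of
  \<open>w\<close>. Beyond \<open>R\<close> the function \<open>v\<close> vanishes while
  \<open>w - c\<close> equals \<open>- c\<close>; this height, integrated against the kernel, is the
  gain.\<close>

lemma has_frac_op_replace_on:
  assumes u: "u \<in> borel_measurable borel" "\<And>y. \<bar>u y\<bar> \<le> M"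
    and w: "w \<in> borel_measurable borel" "\<And>y. \<bar>w y\<bar> \<le> M"
    and sd: "\<And>z. \<bar>second_diff w x z\<bar> \<le> C * min 1 ((norm z)\<^sup>2)"
    and r: "0 < r" "r \<le> R" and c: "0 \<le> c"
    and below: "\<And>y. w y - c \<le> u y"
    and far: "\<And>z. R < norm z \<Longrightarrow> w (x + z) = 0 \<and> u (x + z) = 0"
  defines "v \<equiv> replace_on (ball x r) (\<lambda>y. w y - c) u"
  shows "has_frac_op s \<eta> v x (sym_op v x)"
    and "sym_op v x \<le> sym_op w x - c * lam * tail_mass TYPE('a) s R"
proof -
  note [measurable] = u(1) w(1)
  have vm [measurable]: "v \<in> borel_measurable borel"
    unfolding v_def replace_on_def by (rule measurable_If_set) simp_all
  define B where "B = M + c"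
  have vB: "\<bar>v y\<bar> \<le> B" for y
    using u(2)[of y] w(2)[of y] c by (auto simp: v_def replace_on_def B_def)
  have B0: "0 \<le> B" using vB[of 0] by linarith
  \<comment> \<open>The first summand covers steps shorter than \<open>r\<close>, where
    \<open>v\<close> and \<open>w\<close> have the same second difference; the second covers the
    longer steps, where \<open>v\<close> is merely bounded.\<close>
  define C' where "C' = \<bar>C\<bar> + 4 * B * max 1 (1 / r\<^sup>2)"
  have vx: "v x = w x - c" using r by (simp add: v_def replace_on_def)
  have sdv: "\<bar>second_diff v x z\<bar> \<le> C' * min 1 ((norm z)\<^sup>2)" for z
  proof (cases "norm z < r")
    case True
    then have "second_diff v x z = second_diff w x z"
      using r by (simp add: second_diff_def v_def replace_on_def dist_norm)
    also have "\<bar>\<dots>\<bar> \<le> C * min 1 ((norm z)\<^sup>2)" by (rule sd)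
    also have "\<dots> \<le> C' * min 1 ((norm z)\<^sup>2)"
    proof (rule mult_right_mono)
      have "0 \<le> 4 * B * max 1 (1 / r\<^sup>2)" using B0 by (intro mult_nonneg_nonneg) auto
      then show "C \<le> C'" unfolding C'_def by linarith
    qed simp
    finally show ?thesis .
  next
    case False
    have "1 \<le> max 1 (1 / r\<^sup>2) * min 1 ((norm z)\<^sup>2)"
      using False r by (intro one_le_scaled_truncation) auto
    then have "4 * B * 1 \<le> 4 * B * (max 1 (1 / r\<^sup>2) * min 1 ((norm z)\<^sup>2))"
      using B0 by (intro mult_left_mono) auto
    moreover have "0 \<le> \<bar>C\<bar> * min 1 ((norm z)\<^sup>2)" by simp
    moreover have "\<bar>second_diff v x z\<bar> \<le> 4 * B"
      using vB[of x] vB[of "x - z"] vB[of "x + z"] unfolding second_diff_def by linarith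
    moreover have "C' * min 1 ((norm z)\<^sup>2)
        = \<bar>C\<bar> * min 1 ((norm z)\<^sup>2) + 4 * B * (max 1 (1 / r\<^sup>2) * min 1 ((norm z)\<^sup>2))"
      unfolding C'_def distrib_right by (simp only: mult.assoc)
    ultimately show ?thesis by linarith
  qed
  have sdm: "(\<lambda>z. second_diff v x z) \<in> borel_measurable borel" "(\<lambda>z. second_diff w x z) \<in> borel_measurable borel"
    unfolding second_diff_def by measurable
  have iv: "integrable lborel (\<lambda>z. second_diff v x z * J z)" by (rule integrable_weight_J(1)[OF sdm(1) sdv])
  have iw: "integrable lborel (\<lambda>z. second_diff w x z * J z)" by (rule integrable_weight_J(1)[OF sdm(2) sd])
  show "has_frac_op s \<eta> v x (sym_op v x)" by (rule has_frac_op_sym_op[OF vm vB iv])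
  have "2 * (c * lam * tail_mass TYPE('a) s R)
      = (LINT z|lborel. 2 * c * lam * (indicator {z::'a. R < norm z} z / norm z powr (real DIM('a) + 2 * s)))"
    unfolding tail_mass_def by (subst integral_mult_right_zero) simp
  also have "\<dots> \<le> (LINT z|lborel. second_diff w x z * J z - second_diff v x z * J z)"
  proof (rule integral_mono)
    show "integrable lborel (\<lambda>z::'a. 2 * c * lam * (indicator {z. R < norm z} z / norm z powr (real DIM('a) + 2 * s)))"
      by (rule integrable_mult_right, rule integrable_tail[OF s]) (use r in simp)
    show "integrable lborel (\<lambda>z. second_diff w x z * J z - second_diff v x z * J z)"
      using iv iw by simp
    fix z :: 'a
    have eq: "second_diff w x z * J z - second_diff v x z * J z
        = ((v (x - z) - w (x - z) + c) + (v (x + z) - w (x + z) + c)) * J z"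
      by (simp add: second_diff_def vx algebra_simps)
    show "2 * c * lam * (indicator {z. R < norm z} z / norm z powr (real DIM('a) + 2 * s))
        \<le> second_diff w x z * J z - second_diff v x z * J z"
    proof (cases "R < norm z")
      case True
      then have "v (x + z) = 0" "v (x - z) = 0" "w (x + z) = 0" "w (x - z) = 0"
        using far[of z] far[of "- z"] r by (auto simp: v_def replace_on_def dist_norm)
      then have "second_diff w x z * J z - second_diff v x z * J z = 2 * c * J z"
        unfolding eq by simp
      moreover have "2 * c * lam / norm z powr (real DIM('a) + 2 * s) \<le> 2 * c * k z / norm z powr (real DIM('a) + 2 * s)"
        using k_ge[of z] c by (intro divide_right_mono mult_left_mono) auto
      ultimately show ?thesis using True by (simp add: J_def)
    next
      case False
      have "w y - c \<le> v y" for y using below[of y] by (simp add: v_def replace_on_def)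
      then have "0 \<le> (v (x - z) - w (x - z) + c) + (v (x + z) - w (x + z) + c)"
        using add_mono[of "w (x - z) - c" "v (x - z)" "w (x + z) - c" "v (x + z)"] by simp
      then show ?thesis unfolding eq using False J_nonneg by simp
    qed
  qed
  also have "\<dots> = 2 * (sym_op w x - sym_op v x)" using iv iw by (simp add: sym_op_def)
  finally show "sym_op v x \<le> sym_op w x - c * lam * tail_mass TYPE('a) s R" by simp
qed

end

text \<open>A mollification of \<open>g\<close>, lowered until it touches \<open>u\<close> from
  below, is admissible in \<open>visc\<close> at the touching point. \<open>weak\<close> is demanded
  only on balls inside \<open>{x \<in> \<Omega>. u x < g x}\<close>, since an iterate is known to be
  off its obstacle only there. \<open>visc\<close> selects some index while \<open>weak\<close>
  holds for every index, so \<open>I\<close> may be a singleton or comprise both operators.\<close>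

lemma viscosity_comparison:
  fixes g u f :: "'a::euclidean_space \<Rightarrow> real" and \<eta> k :: "'i \<Rightarrow> 'a \<Rightarrow> real"
  assumes \<Omega>: "open \<Omega>" "bounded \<Omega>" and f: "continuous_on (closure \<Omega>) f"
    and ker: "\<And>i. i \<in> I \<Longrightarrow> levy_kernel s lam Lam (\<eta> i) (k i)"
    and g: "continuous_on UNIV g" "\<And>x. x \<notin> \<Omega> \<Longrightarrow> g x = 0"
    and u: "continuous_on UNIV u" "\<And>x. x \<notin> \<Omega> \<Longrightarrow> u x = 0"
    and weak: "\<And>x0 \<epsilon> \<rho> i. i \<in> I \<Longrightarrow> 0 < \<epsilon> \<Longrightarrow> cball x0 \<epsilon> \<subseteq> {x \<in> \<Omega>. u x < g x} \<Longrightarrow> C2_function \<rho>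
      \<Longrightarrow> (\<forall>x. 0 \<le> \<rho> x) \<Longrightarrow> (\<forall>x. \<epsilon> \<le> norm x \<longrightarrow> \<rho> x = 0)
      \<Longrightarrow> levy_kernel.sym_op s (k i) (conv g \<rho>) x0 \<le> (LINT x:\<Omega>|lebesgue. f x * \<rho> (x0 - x))"
    and visc: "\<And>x N \<phi>. open N \<Longrightarrow> x \<in> N \<Longrightarrow> N \<subseteq> \<Omega> \<Longrightarrow> C2_function \<phi> \<Longrightarrow> \<phi> x = u x
      \<Longrightarrow> (\<forall>y\<in>N. \<phi> y \<le> u y) \<Longrightarrow> (\<And>i. i \<in> I \<Longrightarrow> \<exists>l. has_frac_op s (\<eta> i) (replace_on N \<phi> u) x l)
      \<Longrightarrow> \<exists>i\<in>I. f x \<le> frac_op s (\<eta> i) (replace_on N \<phi> u) x"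
    and s: "0 < s" "s < 1" and lam: "0 < lam"
  shows "g x \<le> u x"
proof (rule ccontr)
  assume "\<not> g x \<le> u x"
  define m where "m = g x - u x"
  have m: "0 < m" using \<open>\<not> g x \<le> u x\<close> by (simp add: m_def)
  obtain B where B: "0 < B" "\<And>y. y \<in> \<Omega> \<Longrightarrow> norm y \<le> B"
    using \<Omega>(2) unfolding bounded_pos by blast
  have g0: "g y = 0" and u0: "u y = 0" if "B < norm y" for y
    using B(2)[of y] g(2)[of y] u(2)[of y] that by force+
  \<comment> \<open>For \<open>x0\<close> in \<Omega> and \<open>norm z > R\<close> the point
    \<open>x0 + z\<close> has norm above \<open>B + 2\<close>; \<open>u\<close> vanishes beyond
    \<open>B\<close>, the mollification beyond \<open>B + 1\<close>.\<close>
  define R where "R = 2 * B + 2"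
  define \<kappa> where "\<kappa> = lam * tail_mass TYPE('a) s R"
  have \<kappa>: "0 < \<kappa>" unfolding \<kappa>_def using lam B(1)
    by (intro mult_pos_pos tail_mass_pos s) (simp_all add: R_def)
  \<comment> \<open>\<open>m / 8\<close> keeps the mollification ball inside the set where
    \<open>u < g\<close>; \<open>m * \<kappa> / 4\<close> keeps the error below the gain, which is
    at least \<open>m * \<kappa> / 2\<close>. Neither involves the mollification scale.\<close>
  define \<tau> where "\<tau> = min (m / 8) (m * \<kappa> / 4)"
  have \<tau>: "0 < \<tau>" "\<tau> \<le> m / 8" "\<tau> \<le> m * \<kappa> / 4" using m \<kappa> by (auto simp: \<tau>_def)
  obtain d1 where d1: "0 < d1" "\<And>x y. norm (x - y) < d1 \<Longrightarrow> \<bar>g x - g y\<bar> \<le> \<tau>"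
    using uniformly_continuous_bounded_support[OF g(1) g0 \<tau>(1)] by metis
  obtain d2 where d2: "0 < d2" "\<And>x y. norm (x - y) < d2 \<Longrightarrow> \<bar>u x - u y\<bar> \<le> \<tau>"
    using uniformly_continuous_bounded_support[OF u(1) u0 \<tau>(1)] by metis
  have "uniformly_continuous_on (closure \<Omega>) f"
    using \<Omega>(2) f by (intro compact_uniformly_continuous) simp_all
  then obtain d3 where d3: "0 < d3"
    "\<And>x y. x \<in> closure \<Omega> \<Longrightarrow> y \<in> closure \<Omega> \<Longrightarrow> dist y x < d3 \<Longrightarrow> dist (f y) (f x) < \<tau>"
    using \<tau>(1) unfolding uniformly_continuous_on_def by metis
  define \<epsilon> where "\<epsilon> = min 1 (min d1 (min d2 d3)) / 2"
  have \<epsilon>: "0 < \<epsilon>" "\<epsilon> < 1" "\<epsilon> < d1" "\<epsilon> < d2" "\<epsilon> < d3"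
    using d1(1) d2(1) d3(1) by (auto simp: \<epsilon>_def)
  obtain \<rho> :: "'a \<Rightarrow> real" where \<rho>: "C2_function \<rho>" "\<And>x. 0 \<le> \<rho> x" "\<And>x. \<epsilon> \<le> norm x \<Longrightarrow> \<rho> x = 0"
    "integrable lborel \<rho>" "integral\<^sup>L lborel \<rho> = 1"
    using C2_mollifier_exists[OF \<epsilon>(1)] by metis
  have \<rho>c: "continuous_on UNIV \<rho>" by (rule C2_function_continuous[OF \<rho>(1)])
  obtain c where c: "cball (0::'a) B \<subseteq> cbox (- c) c"
    using bounded_subset_cbox_symmetric[OF bounded_cball] by metis
  have gbox: "g y = 0" if "y \<notin> cbox (- c) c" for y
  proof -
    have "y \<notin> cball 0 B" using that c by blast
    then show ?thesis by (intro g0) simp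
  qed
  define w where "w = conv g \<rho>"
  have wC2: "C2_function w" unfolding w_def by (rule C2_function_conv[OF g(1) gbox \<rho>(1)])
  have wc: "continuous_on UNIV w" by (rule C2_function_continuous[OF wC2])
  have wg: "\<bar>w y - g y\<bar> \<le> \<tau>" for y
    unfolding w_def
  proof (rule conv_close[OF g(1) gbox \<rho>c \<rho>(2) \<rho>(3) \<rho>(4,5)])
    show "\<bar>g y' - g y\<bar> \<le> \<tau>" if "norm (y - y') < \<epsilon>" for y'
      using d1(2)[of y' y] that \<epsilon>(3) by (simp add: norm_minus_commute)
  qed
  have w0: "w y = 0" if y: "B + 1 < norm y" for y
  proof -
    have gy: "g y = 0" using y by (intro g0) simp
    \<comment> \<open>Tolerance \<open>0\<close>: \<open>g\<close> vanishes on the whole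
      mollification ball around \<open>y\<close>.\<close>
    have "\<bar>w y - g y\<bar> \<le> 0"
      unfolding w_def
    proof (rule conv_close[OF g(1) gbox \<rho>c \<rho>(2) \<rho>(3) \<rho>(4,5)])
      show "\<bar>g y' - g y\<bar> \<le> 0" if "norm (y - y') < \<epsilon>" for y'
      proof -
        have "B < norm y'" using that y \<epsilon>(2) norm_triangle_ineq2[of y y'] by linarith
        then show ?thesis using g0 gy by simp
      qed
    qed
    then show ?thesis using gy by simp
  qed
  obtain x0 where x0: "x0 \<in> cball 0 (B + 1)" "\<And>y. y \<in> cball 0 (B + 1) \<Longrightarrow> w y - u y \<le> w x0 - u x0"
  proof -
    have "continuous_on (cball 0 (B + 1)) (\<lambda>y. w y - u y)"
      by (intro continuous_intros continuous_on_subset[OF wc subset_UNIV] continuous_on_subset[OF u(1) subset_UNIV])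
    then show ?thesis
      using continuous_attains_sup[of "cball (0::'a) (B + 1)" "\<lambda>y. w y - u y"] B(1) that by auto
  qed
  define C where "C = w x0 - u x0"
  have "x \<in> \<Omega>" using m g(2)[of x] u(2)[of x] unfolding m_def by (cases "x \<in> \<Omega>") simp_all
  then have "x \<in> cball 0 (B + 1)" using B(2) by fastforce
  then have Cm: "m - \<tau> \<le> C" using x0(2)[of x] wg[of x] unfolding C_def m_def by linarith
  then have C0: "0 < C" using \<tau> m by linarith
  have below: "w y - C \<le> u y" for y
  proof (cases "norm y \<le> B + 1")
    case True
    then show ?thesis using x0(2)[of y] by (simp add: C_def)
  next
    case False
    then show ?thesis using w0[of y] u0[of y] C0 by simp
  qed
  \<comment> \<open>Three times \<open>\<tau>\<close> is lost: two for moving \<open>g\<close> and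
    \<open>u\<close> from \<open>x0\<close> to \<open>y\<close>, one for replacing \<open>w\<close>
    by \<open>g\<close>. Since \<open>C \<ge> m - \<tau>\<close>, at least half of \<open>m\<close>
    remains.\<close>
  have ball: "cball x0 \<epsilon> \<subseteq> {x \<in> \<Omega>. u x < g x}"
  proof
    fix y assume "y \<in> cball x0 \<epsilon>"
    then have "norm (x0 - y) \<le> \<epsilon>" by (simp add: dist_norm)
    then have "\<bar>g x0 - g y\<bar> \<le> \<tau>" "\<bar>u x0 - u y\<bar> \<le> \<tau>" using d1(2)[of x0 y] d2(2)[of x0 y] \<epsilon> by auto
    then have "u y < g y" using wg[of x0] Cm \<tau>(2) m unfolding C_def by linarith
    moreover from this have "y \<in> \<Omega>" using g(2)[of y] u(2)[of y] by force
    ultimately show "y \<in> {x \<in> \<Omega>. u x < g x}" by simp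
  qed
  then have sub: "cball x0 \<epsilon> \<subseteq> \<Omega>" by blast
  have x0\<Omega>: "x0 \<in> \<Omega>" using sub \<epsilon>(1) by auto
  have far: "w (x0 + z) = 0 \<and> u (x0 + z) = 0" if "R < norm z" for z
  proof -
    have "B + 2 < norm (x0 + z)"
      using that B(2)[OF x0\<Omega>] norm_triangle_ineq2[of z "- x0"] by (simp add: R_def add.commute)
    then show ?thesis using w0 u0 by simp
  qed
  obtain M1 where M1: "\<And>y. \<bar>w y\<bar> \<le> M1"
  proof -
    have "bounded (w ` cball 0 (B + 1))"
      by (intro compact_imp_bounded compact_continuous_image compact_cball continuous_on_subset[OF wc subset_UNIV])
    then obtain M where M: "\<And>y. y \<in> cball 0 (B + 1) \<Longrightarrow> \<bar>w y\<bar> \<le> M"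
      by (metis bounded_iff imageI real_norm_def)
    have "\<bar>w y\<bar> \<le> max 0 M" for y
      using M[of y] w0[of y] by (cases "norm y \<le> B + 1") (auto simp: le_max_iff_disj)
    then show ?thesis by (rule that)
  qed
  obtain M2 where M2: "\<And>y. \<bar>u y\<bar> \<le> M2"
  proof -
    have "bounded (u ` cball 0 B)"
      by (intro compact_imp_bounded compact_continuous_image compact_cball continuous_on_subset[OF u(1) subset_UNIV])
    then obtain M where M: "\<And>y. y \<in> cball 0 B \<Longrightarrow> \<bar>u y\<bar> \<le> M"
      by (metis bounded_iff imageI real_norm_def)
    have "\<bar>u y\<bar> \<le> max 0 M" for y
      using M[of y] u0[of y] by (cases "norm y \<le> B") (auto simp: le_max_iff_disj)
    then show ?thesis by (rule that)
  qed
  have wM: "\<bar>w y\<bar> \<le> max M1 M2" and uM: "\<bar>u y\<bar> \<le> max M1 M2" for y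
    using M1[of y] M2[of y] by (auto simp: le_max_iff_disj)
  obtain D where D: "0 \<le> D" "\<And>y z. \<bar>second_diff w y z\<bar> \<le> D * min 1 ((norm z)\<^sup>2)"
  proof (rule C2_second_diff_bound[OF wC2])
    show "w y = 0" if "B + 2 \<le> norm y" for y using w0[of y] that by simp
  qed blast
  have wm: "w \<in> borel_measurable borel" and um: "u \<in> borel_measurable borel"
    using wc u(1) by (auto intro: borel_measurable_continuous_onI)
  have \<epsilon>R: "\<epsilon> \<le> R" using \<epsilon> B(1) by (simp add: R_def)
  let ?v = "replace_on (ball x0 \<epsilon>) (\<lambda>y. w y - C) u"
  have op: "has_frac_op s (\<eta> i) ?v x0 (levy_kernel.sym_op s (k i) ?v x0)"
    "levy_kernel.sym_op s (k i) ?v x0 \<le> levy_kernel.sym_op s (k i) w x0 - C * \<kappa>" if "i \<in> I" for i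
  proof -
    interpret levy_kernel s lam Lam "\<eta> i" "k i" by (rule ker[OF that])
    show "has_frac_op s (\<eta> i) ?v x0 (sym_op ?v x0)" "sym_op ?v x0 \<le> sym_op w x0 - C * \<kappa>"
      using has_frac_op_replace_on[OF um uM wm wM D(2) \<epsilon>(1) \<epsilon>R less_imp_le[OF C0] below far]
      by (simp_all add: \<kappa>_def mult.assoc)
  qed
  have "\<exists>i\<in>I. f x0 \<le> frac_op s (\<eta> i) ?v x0"
  proof (rule visc)
    show "C2_function (\<lambda>y. w y - C)" using C2_function_add_const[OF wC2, of "- C"] by simp
    show "ball x0 \<epsilon> \<subseteq> \<Omega>" using sub ball_subset_cball by blast
    show "\<exists>l. has_frac_op s (\<eta> i) ?v x0 l" if "i \<in> I" for i using op(1)[OF that] by blast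
  qed (use \<epsilon>(1) below in \<open>auto simp: C_def\<close>)
  then obtain i where i: "i \<in> I" "f x0 \<le> frac_op s (\<eta> i) ?v x0" by blast
  then have "f x0 \<le> levy_kernel.sym_op s (k i) w x0 - C * \<kappa>"
    using op(2)[OF i(1)] frac_op_eq[OF op(1)[OF i(1)]] by simp
  also have "levy_kernel.sym_op s (k i) w x0 \<le> (LINT x:\<Omega>|lebesgue. f x * \<rho> (x0 - x))"
    unfolding w_def by (rule weak[OF i(1) \<epsilon>(1) ball \<rho>(1)]) (use \<rho>(2,3) in auto)
  also have "\<dots> \<le> f x0 + \<tau>"
  proof (rule mollified_source_le[OF \<Omega> f \<rho>(2,3,4,5) \<rho>c sub])
    fix y assume y: "y \<in> cball x0 \<epsilon>"
    then have "y \<in> closure \<Omega>" "x0 \<in> closure \<Omega>" using sub x0\<Omega> closure_subset by blast+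
    then have "dist (f y) (f x0) < \<tau>" using d3(2)[of x0 y] y \<epsilon>(5) by (simp add: dist_commute)
    then show "f y \<le> f x0 + \<tau>" by (simp add: dist_real_def)
  qed
  \<comment> \<open>The value \<open>f x0\<close> cancels; the gain is left against the oscillation
    of \<open>f\<close> on the mollification ball.\<close>
  finally have "C * \<kappa> \<le> \<tau>" by simp
  moreover have "m / 2 * \<kappa> \<le> C * \<kappa>" using Cm \<tau>(2) \<kappa> m by (intro mult_right_mono) auto
  moreover have "0 < m * \<kappa>" using m \<kappa> by simp
  ultimately show False using \<tau>(3) by simp
qed

section \<open>From almost everywhere to pointwise statements; boundary values\<close>

lemma AE_le_imp_le_on_open:
  fixes v w :: "'a::euclidean_space \<Rightarrow> real"
  assumes \<Omega>: "open \<Omega>" and v: "continuous_on \<Omega> v" and w: "continuous_on \<Omega> w"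
    and ae: "AE x in lebesgue. x \<in> \<Omega> \<longrightarrow> v x \<le> w x" and x: "x \<in> \<Omega>"
  shows "v x \<le> w x"
proof -
  have "open ({x. w x - v x < 0} \<inter> \<Omega>)"
    using continuous_open_preimage[OF continuous_on_diff[OF w v] \<Omega> open_lessThan[of 0]]
    by (simp add: vimage_def Int_def conj_commute)
  moreover have "AE x in lborel. x \<notin> {x. w x - v x < 0} \<inter> \<Omega>"
    using ae unfolding AE_completion_iff by eventually_elim auto
  ultimately have "{x. w x - v x < 0} \<inter> \<Omega> = {}" by (rule open_AE_complement_empty)
  then show ?thesis using x by force
qed

lemma Linf_norm_le_imp_le:
  assumes \<Omega>: "open \<Omega>" and w: "continuous_on \<Omega> w" and le: "Linf_norm \<Omega> w \<le> ereal c" and x: "x \<in> \<Omega>"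
  shows "\<bar>w x\<bar> \<le> c"
proof (rule AE_le_imp_le_on_open[OF \<Omega> _ _ _ x])
  have "AE x in lebesgue_on \<Omega>. ereal \<bar>w x\<bar> \<le> Linf_norm \<Omega> w"
    unfolding Linf_norm_def by (rule esssup_AE)
  then have "AE x in lebesgue. x \<in> \<Omega> \<longrightarrow> ereal \<bar>w x\<bar> \<le> Linf_norm \<Omega> w"
    using \<Omega> by (subst (asm) AE_restrict_space_iff) auto
  then show "AE x in lebesgue. x \<in> \<Omega> \<longrightarrow> \<bar>w x\<bar> \<le> c"
    by eventually_elim (use le order_trans in fastforce)
qed (use w in \<open>auto intro: continuous_intros\<close>)

text \<open>The viscosity solution is prescribed only off \<open>closure \<Omega>\<close>. Convexity
  makes \<Omega> the interior of its closure, so every point outside \<Omega> is a limit of exterior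
  points.\<close>

lemma zero_on_frontier:
  fixes \<Omega> :: "'a::euclidean_space set" and u :: "'a \<Rightarrow> real"
  assumes "open \<Omega>" "convex \<Omega>" "continuous_on UNIV u" "\<forall>x\<in>- closure \<Omega>. u x = 0" "x \<notin> \<Omega>"
  shows "u x = 0"
proof -
  have "interior (closure \<Omega>) = \<Omega>" using assms(1,2) by (simp add: convex_interior_closure interior_open)
  then have "x \<in> closure (- closure \<Omega>)" using assms(5) by (simp add: closure_complement)
  moreover have "closed {x. u x = 0}"
    by (rule closed_Collect_eq[OF assms(3) continuous_on_const])
  then have "closure (- closure \<Omega>) \<subseteq> {x. u x = 0}"
    by (rule closure_minimal[rotated]) (use assms(4) in auto)
  ultimately show ?thesis by blast
qed

section \<open>Weak solutions and obstacle problems tested with mollifiers\<close>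

lemma energy_form_cmult: "energy_form s \<eta> w (\<lambda>x. c * v x) = c * energy_form s \<eta> w v"
proof -
  have "(\<lambda>(x, y). (w x - w y) * (c * v x - c * v y) / norm (x - y) powr (real DIM('a) + 2 * s) * \<eta> (sgn (x - y)))
     = (\<lambda>p. c * (case p of (x, y) \<Rightarrow> (w x - w y) * (v x - v y) / norm (x - y) powr (real DIM('a) + 2 * s) * \<eta> (sgn (x - y))))"
    for w v :: "'a::euclidean_space \<Rightarrow> real" and \<eta>
    by (auto simp: fun_eq_iff right_diff_distrib[symmetric])
  then show ?thesis unfolding energy_form_def by (simp only: integral_mult_right_zero mult.left_commute)
qed

lemma sym_op_uminus:
  assumes "levy_kernel s lam Lam \<eta> k"
  shows "levy_kernel.sym_op s k (\<lambda>x. - w x) x = - levy_kernel.sym_op s k w x"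
proof -
  interpret levy_kernel s lam Lam \<eta> k by fact
  have "(\<lambda>z. second_diff (\<lambda>x. - w x) x z * J z) = (\<lambda>z. - (second_diff w x z * J z))"
    by (simp add: fun_eq_iff second_diff_def algebra_simps)
  then show ?thesis by (simp add: sym_op_def)
qed

text \<open>The inclusion of the ball makes the reflected mollifier vanish outside \<Omega>, so that
  adding multiples of it to \<open>w\<close> stays in \<open>Hs_tilde s \<Omega>\<close>.\<close>

locale weak_obstacle_setting = levy_kernel s lam Lam \<eta> k
  for s lam Lam :: real and \<eta> k :: "'a::euclidean_space \<Rightarrow> real" +
  fixes \<Omega> :: "'a set" and w :: "'a \<Rightarrow> real" and \<rho> :: "'a \<Rightarrow> real" and x0 :: 'a and \<epsilon> :: real
  assumes \<Omega>: "open \<Omega>" "bounded \<Omega>"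
    and w_cont: "continuous_on UNIV w" and w_zero: "\<And>x. x \<notin> \<Omega> \<Longrightarrow> w x = 0"
    and C2: "C2_function \<rho>" and \<rho>_nonneg: "\<And>x. 0 \<le> \<rho> x" and \<rho>_supp: "\<And>x. \<epsilon> \<le> norm x \<Longrightarrow> \<rho> x = 0"
    and \<epsilon>: "0 < \<epsilon>" and sub: "cball x0 \<epsilon> \<subseteq> \<Omega>"
begin

lemma energy_form_mollifier:
  assumes "w \<in> Hs_space s"
  shows "energy_form s \<eta> w (\<lambda>x. \<rho> (x0 - x)) = sym_op (conv w \<rho>) x0"
proof -
  obtain c where c: "\<Omega> \<subseteq> cbox (- c) c"
    using bounded_subset_cbox_symmetric[OF \<Omega>(2)] by metis
  have "w y = 0" if "y \<notin> cbox (- c) c" for y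
    using that c by (intro w_zero) blast
  then show ?thesis using assms by (intro energy_form_eq_sym_op[OF w_cont _ _ C2 \<rho>_supp])
qed

lemma mollifier_off: "x \<notin> cball x0 \<epsilon> \<Longrightarrow> \<rho> (x0 - x) = 0"
  by (intro \<rho>_supp) (simp add: dist_norm)

lemma mollifier_zero: "x \<notin> \<Omega> \<Longrightarrow> \<rho> (x0 - x) = 0"
  using sub by (intro mollifier_off) blast

lemma mollifier_in_Hs_space: "(\<lambda>x. \<rho> (x0 - x)) \<in> Hs_space s"
  by (rule Hs_space_C2_compact_support[OF s C2 \<rho>_supp])

lemma perturbed_in_Hs_tilde:
  assumes "w \<in> Hs_tilde s \<Omega>"
  shows "(\<lambda>x. w x + t * \<rho> (x0 - x)) \<in> Hs_tilde s \<Omega>"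
proof -
  have \<rho>c: "continuous_on UNIV \<rho>" by (rule C2_function_continuous[OF C2])
  have "continuous_on UNIV (\<lambda>x. \<rho> (x0 - x))"
    by (intro continuous_on_compose2[OF \<rho>c] continuous_intros) auto
  then have m: "(\<lambda>x. \<rho> (x0 - x)) \<in> borel_measurable borel" "w \<in> borel_measurable borel"
    using w_cont by (auto intro: borel_measurable_continuous_onI)
  have "(\<lambda>x. w x + t * \<rho> (x0 - x)) \<in> Hs_space s"
    using assms mollifier_in_Hs_space m
    by (intro Hs_space_add_scaled) (auto simp: Hs_tilde_def)
  moreover have "w x + t * \<rho> (x0 - x) = 0" if "x \<notin> \<Omega>" for x
    using that w_zero mollifier_zero by simp
  ultimately show ?thesis by (simp add: Hs_tilde_def)
qed

lemma weak_solution_mollified: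
  assumes "weak_solution s \<eta> \<Omega> f w"
  shows "sym_op (conv w \<rho>) x0 = (LINT x:\<Omega>|lebesgue. f x * \<rho> (x0 - x))"
proof -
  have "(\<lambda>x. \<rho> (x0 - x)) \<in> Hs_tilde s \<Omega>"
    using mollifier_in_Hs_space mollifier_zero by (simp add: Hs_tilde_def)
  then show ?thesis
    using assms energy_form_mollifier by (auto simp: weak_solution_def Hs_tilde_def)
qed

text \<open>Raising \<open>w\<close> never violates the obstacle constraint, so the mollifier itself
  is an admissible variation.\<close>

lemma weak_obstacle_supersolution:
  assumes w: "weak_obstacle_solution s \<eta> \<Omega> f \<psi> w"
  shows "(LINT x:\<Omega>|lebesgue. f x * \<rho> (x0 - x)) \<le> sym_op (conv w \<rho>) x0"
proof -
  have wo: "w \<in> Hs_tilde s \<Omega>" "AE x in lebesgue. x \<in> \<Omega> \<longrightarrow> \<psi> x \<le> w x"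
    using w by (auto simp: weak_obstacle_solution_def obstacle_set_def)
  have "AE x in lebesgue. x \<in> \<Omega> \<longrightarrow> \<psi> x \<le> w x + 1 * \<rho> (x0 - x)"
    using wo(2) by eventually_elim (use \<rho>_nonneg in \<open>auto intro: add_increasing2\<close>)
  then have "(\<lambda>x. w x + 1 * \<rho> (x0 - x)) \<in> obstacle_set s \<Omega> \<psi>"
    using perturbed_in_Hs_tilde[OF wo(1), of 1] by (simp add: obstacle_set_def)
  then have "(LINT x:\<Omega>|lebesgue. f x * ((w x + 1 * \<rho> (x0 - x)) - w x))
      \<le> energy_form s \<eta> w (\<lambda>x. (w x + 1 * \<rho> (x0 - x)) - w x)"
    using bspec[OF conjunct2[OF w[unfolded weak_obstacle_solution_def]]] by blast
  then show ?thesis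
    using energy_form_mollifier wo(1) by (simp add: Hs_tilde_def)
qed

text \<open>Lowering \<open>w\<close> by a small multiple of the mollifier is admissible where the
  obstacle is inactive: compactness of the ball supplies a uniform gap. Dividing by the negative
  factor reverses the variational inequality.\<close>

lemma weak_obstacle_subsolution:
  assumes w: "weak_obstacle_solution s \<eta> \<Omega> f \<psi> w" and \<psi>: "continuous_on \<Omega> \<psi>"
    and free: "\<And>x. x \<in> cball x0 \<epsilon> \<Longrightarrow> \<psi> x < w x"
  shows "sym_op (conv w \<rho>) x0 \<le> (LINT x:\<Omega>|lebesgue. f x * \<rho> (x0 - x))"
proof -
  have wo: "w \<in> Hs_tilde s \<Omega>" "AE x in lebesgue. x \<in> \<Omega> \<longrightarrow> \<psi> x \<le> w x"
    using w by (auto simp: weak_obstacle_solution_def obstacle_set_def)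
  have ne: "cball x0 \<epsilon> \<noteq> {}" using \<epsilon> by simp
  have cont: "continuous_on (cball x0 \<epsilon>) (\<lambda>x. w x - \<psi> x)" "continuous_on (cball x0 \<epsilon>) (\<lambda>x. \<rho> (x0 - x))"
    by (intro continuous_on_diff continuous_on_subset[OF \<psi> sub] continuous_on_subset[OF w_cont subset_UNIV])
      (intro continuous_on_compose2[OF C2_function_continuous[OF C2]] continuous_intros subset_UNIV)
  obtain p where p: "p \<in> cball x0 \<epsilon>" "\<And>y. y \<in> cball x0 \<epsilon> \<Longrightarrow> w p - \<psi> p \<le> w y - \<psi> y"
    using continuous_attains_inf[OF compact_cball ne cont(1)] by blast
  obtain q where q: "\<And>y. y \<in> cball x0 \<epsilon> \<Longrightarrow> \<rho> (x0 - y) \<le> \<rho> (x0 - q)"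
    using continuous_attains_sup[OF compact_cball ne cont(2)] by blast
  \<comment> \<open>Smallest gap over largest height; the added \<open>1\<close> excludes division
    by zero.\<close>
  define t where "t = (w p - \<psi> p) / (\<rho> (x0 - q) + 1)"
  have Q: "0 < \<rho> (x0 - q) + 1" using \<rho>_nonneg[of "x0 - q"] by linarith
  have t: "0 < t" using free[OF p(1)] Q by (simp add: t_def)
  have below: "\<psi> x \<le> w x + (- t) * \<rho> (x0 - x)" if x: "x \<in> cball x0 \<epsilon>" for x
  proof -
    have "t * \<rho> (x0 - x) \<le> t * (\<rho> (x0 - q) + 1)"
      using q[OF x] t by (intro mult_left_mono) auto
    also have "\<dots> = w p - \<psi> p" using Q by (simp add: t_def)
    also have "\<dots> \<le> w x - \<psi> x" by (rule p(2)[OF x])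
    finally show ?thesis by simp
  qed
  have "AE x in lebesgue. x \<in> \<Omega> \<longrightarrow> \<psi> x \<le> w x + (- t) * \<rho> (x0 - x)"
    using wo(2)
  proof eventually_elim
    case (elim x)
    then show ?case using below[of x] mollifier_off[of x] by (cases "x \<in> cball x0 \<epsilon>") auto
  qed
  then have "(\<lambda>x. w x + (- t) * \<rho> (x0 - x)) \<in> obstacle_set s \<Omega> \<psi>"
    using perturbed_in_Hs_tilde[OF wo(1), of "- t"] by (simp add: obstacle_set_def)
  then have "(LINT x:\<Omega>|lebesgue. f x * ((w x + (- t) * \<rho> (x0 - x)) - w x))
      \<le> energy_form s \<eta> w (\<lambda>x. (w x + (- t) * \<rho> (x0 - x)) - w x)"
    using bspec[OF conjunct2[OF w[unfolded weak_obstacle_solution_def]]] by blast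
  moreover have "(\<lambda>x. (w x + (- t) * \<rho> (x0 - x)) - w x) = (\<lambda>x. (- t) * \<rho> (x0 - x))" by simp
  moreover have "energy_form s \<eta> w (\<lambda>x. (- t) * \<rho> (x0 - x)) = (- t) * sym_op (conv w \<rho>) x0"
    unfolding energy_form_cmult using energy_form_mollifier wo(1) by (simp add: Hs_tilde_def)
  moreover have "(LINT x:\<Omega>|lebesgue. f x * ((w x + (- t) * \<rho> (x0 - x)) - w x))
      = (- t) * (LINT x:\<Omega>|lebesgue. f x * \<rho> (x0 - x))"
    unfolding set_lebesgue_integral_def by (subst integral_mult_right_zero[symmetric]) (simp add: mult_ac)
  ultimately have "(- t) * (LINT x:\<Omega>|lebesgue. f x * \<rho> (x0 - x)) \<le> (- t) * sym_op (conv w \<rho>) x0"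
    by (simp only:)
  then show ?thesis using t by simp
qed

end

context levy_kernel
begin

text \<open>The constant depends neither on the functions nor on \<open>M\<close>. With
  \<open>\<rho>\<close> fixed, the operator of the mollification is thus continuous under uniform
  convergence with supports in a common box, because the second difference can be put on
  \<open>\<rho>\<close>.\<close>

lemma sym_op_conv_diff_bound:
  assumes C2: "C2_function \<rho>" and supp: "\<And>x. R \<le> norm x \<Longrightarrow> \<rho> x = 0"
  obtains C where "\<And>g h M. continuous_on UNIV g \<Longrightarrow> (\<forall>x. x \<notin> cbox a c \<longrightarrow> g x = 0)
    \<Longrightarrow> continuous_on UNIV h \<Longrightarrow> (\<forall>x. x \<notin> cbox a c \<longrightarrow> h x = 0) \<Longrightarrow> (\<forall>x. \<bar>g x - h x\<bar> \<le> M)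
    \<Longrightarrow> \<bar>sym_op (conv g \<rho>) x0 - sym_op (conv h \<rho>) x0\<bar> \<le> C * M"
proof -
  have \<rho>c: "continuous_on UNIV \<rho>" by (rule C2_function_continuous[OF C2])
  obtain D where D: "0 \<le> D" "\<And>y z. \<bar>second_diff \<rho> y z\<bar> \<le> D * min 1 ((norm z)\<^sup>2)"
    using C2_second_diff_bound[OF C2 supp] by metis
  define V where "V = measure lborel (cbox a c)"
  have bd: "\<bar>second_diff (conv g \<rho>) x0 z\<bar> \<le> (M * V * D) * min 1 ((norm z)\<^sup>2)"
    if "continuous_on UNIV g" "\<forall>x. x \<notin> cbox a c \<longrightarrow> g x = 0" "\<And>x. \<bar>g x\<bar> \<le> M" for g M z
  proof -
    have "\<bar>second_diff (conv g \<rho>) x0 z\<bar> \<le> M * V * (D * min 1 ((norm z)\<^sup>2))"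
      unfolding V_def by (rule second_diff_conv_bound[OF that(1) _ \<rho>c D(2) that(3)]) (use that(2) in blast)
    then show ?thesis by (simp only: mult.assoc)
  qed
  have meas: "(\<lambda>z. second_diff (conv g \<rho>) x0 z) \<in> borel_measurable borel"
    if "continuous_on UNIV g" "\<forall>x. x \<notin> cbox a c \<longrightarrow> g x = 0" for g
  proof -
    have "C2_function (conv g \<rho>)"
      by (rule C2_function_conv[OF that(1) _ C2]) (use that(2) in blast)
    then have [measurable]: "conv g \<rho> \<in> borel_measurable borel"
      by (intro borel_measurable_continuous_onI C2_function_continuous)
    show ?thesis unfolding second_diff_def by measurable
  qed
  have int: "integrable lborel (\<lambda>z. second_diff (conv g \<rho>) x0 z * J z)"
    if g: "continuous_on UNIV g" "\<forall>x. x \<notin> cbox a c \<longrightarrow> g x = 0" for g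
  proof -
    have "bounded (g ` cbox a c)"
      by (intro compact_imp_bounded compact_continuous_image compact_cbox continuous_on_subset[OF g(1) subset_UNIV])
    then obtain M where M: "\<And>y. y \<in> cbox a c \<Longrightarrow> \<bar>g y\<bar> \<le> M"
      by (metis bounded_iff imageI real_norm_def)
    have "\<bar>g y\<bar> \<le> max 0 M" for y
      using M[of y] g(2) by (cases "y \<in> cbox a c") (auto simp: le_max_iff_disj)
    then show ?thesis using integrable_weight_J(1)[OF meas[OF g] bd[OF g]] by blast
  qed
  show ?thesis
  proof (rule that[of "V * D * Lam * (LINT z|lborel. levy_weight s (z::'a)) / 2"])
    fix g h :: "'a \<Rightarrow> real" and M :: real
    assume g: "continuous_on UNIV g" "\<forall>x. x \<notin> cbox a c \<longrightarrow> g x = 0"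
      and h: "continuous_on UNIV h" "\<forall>x. x \<notin> cbox a c \<longrightarrow> h x = 0" and M: "\<forall>x. \<bar>g x - h x\<bar> \<le> M"
    let ?d = "\<lambda>x. g x - h x"
    have d: "continuous_on UNIV ?d" "\<forall>x. x \<notin> cbox a c \<longrightarrow> ?d x = 0"
      using g h by (auto intro: continuous_on_diff)
    have conv_d: "conv ?d \<rho> x = conv g \<rho> x - conv h \<rho> x" for x
    proof -
      have "integrable lborel (\<lambda>y. g y * \<rho> (x - y))" "integrable lborel (\<lambda>y. h y * \<rho> (x - y))"
        by (rule integrable_mult_conv(1)[OF _ _ \<rho>c, of _ a c]; use g h in blast)+
      then show ?thesis by (simp add: conv_def left_diff_distrib)
    qed
    have sd: "second_diff (conv ?d \<rho>) x0 z * J z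
        = second_diff (conv g \<rho>) x0 z * J z - second_diff (conv h \<rho>) x0 z * J z" for z
      unfolding second_diff_def conv_d by (simp add: algebra_simps)
    have "sym_op (conv g \<rho>) x0 - sym_op (conv h \<rho>) x0 = 1 / 2 * (LINT z|lborel. second_diff (conv ?d \<rho>) x0 z * J z)"
      unfolding sd sym_op_def using int[OF g] int[OF h] by simp
    moreover have "\<bar>LINT z|lborel. second_diff (conv ?d \<rho>) x0 z * J z\<bar>
        \<le> (M * V * D) * Lam * (LINT z|lborel. levy_weight s (z::'a))"
      by (rule integrable_weight_J(2)[OF meas[OF d] bd[OF d]]) (use M in blast)
    moreover have "(M * V * D) * Lam * (LINT z|lborel. levy_weight s (z::'a))
        = 2 * (V * D * Lam * (LINT z|lborel. levy_weight s (z::'a)) / 2 * M)"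
      by (simp add: mult_ac)
    ultimately show "\<bar>sym_op (conv g \<rho>) x0 - sym_op (conv h \<rho>) x0\<bar>
        \<le> V * D * Lam * (LINT z|lborel. levy_weight s (z::'a)) / 2 * M"
      by linarith
  qed
qed

end

section \<open>Convergence of the obstacle iterates and identification of the limit\<close>

lemma uniformly_Cauchy_on_if_close_to_fe_space:
  fixes uc :: "nat \<Rightarrow> 'a::euclidean_space \<Rightarrow> real"
  assumes mesh: "\<And>e. 0 < e \<Longrightarrow> \<exists>\<T> v. conforming_mesh \<Omega> \<T> \<and> (\<forall>k. v k \<in> fe_space \<Omega> \<T>) \<and>
      (\<forall>k x. \<bar>uc k x - v k x\<bar> \<le> e)"
    and conv: "\<And>x. convergent (\<lambda>k. uc k x)"
  shows "uniformly_Cauchy_on UNIV uc"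
proof (rule uniformly_Cauchy_onI)
  fix e :: real assume e: "0 < e"
  \<comment> \<open>Comparing \<open>v m\<close> with \<open>v n\<close> at a vertex costs four
    eighths, which piecewise affinity carries to every point; returning to \<open>uc\<close> costs
    two more.\<close>
  obtain \<T> v where T: "conforming_mesh \<Omega> \<T>" "\<And>k. v k \<in> fe_space \<Omega> \<T>" "\<And>k x. \<bar>uc k x - v k x\<bar> \<le> e / 8"
    using mesh[of "e / 8"] e by auto
  let ?V = "interior_vertices \<Omega> \<T>"
  have fin: "finite ?V" using finite_mesh_vertices[OF T(1)] by (simp add: interior_vertices_def)
  have "\<forall>\<^sub>F k in sequentially. \<forall>z\<in>?V. dist (uc k z) (lim (\<lambda>k. uc k z)) < e / 8"
    using conv e by (intro eventually_ball_finite[OF fin] ballI tendstoD) (simp_all add: convergent_LIMSEQ_iff)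
  then obtain N where N: "\<And>k z. N \<le> k \<Longrightarrow> z \<in> ?V \<Longrightarrow> dist (uc k z) (lim (\<lambda>k. uc k z)) < e / 8"
    unfolding eventually_sequentially by blast
  show "\<exists>M. \<forall>x\<in>UNIV. \<forall>m\<ge>M. \<forall>n\<ge>M. dist (uc m x) (uc n x) < e"
  proof (intro exI[of _ N] ballI allI impI)
    fix x m n assume mn: "N \<le> m" "N \<le> n"
    have "\<bar>v m x - v n x\<bar> \<le> e / 2"
    proof (rule fe_space_abs_le_vertices[OF T(1) T(2) T(2)])
      fix z assume "z \<in> ?V"
      then show "\<bar>v m z - v n z\<bar> \<le> e / 2"
        using N[OF mn(1) \<open>z \<in> ?V\<close>] N[OF mn(2) \<open>z \<in> ?V\<close>] T(3)[of m z] T(3)[of n z]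
        unfolding dist_real_def by linarith
    qed (use e in simp)
    then show "dist (uc m x) (uc n x) < e"
      using T(3)[of m x] T(3)[of n x] e unfolding dist_real_def by linarith
  qed
qed

lemma iter_index_mem: "iter_index k \<in> {1, 2}"
  by (auto simp: iter_index_def)

text \<open>Where \<open>uc (Suc k)\<close> exceeds \<open>u\<close>, the induction hypothesis puts
  it strictly above its obstacle \<open>uc k\<close>, so there it is a subsolution for the operator
  of the current step. A supersolution of the minimum is one for that operator, whence the singleton
  index set.\<close>

lemma obstacle_iteration_le_supersolution:
  fixes \<Omega> :: "'a::euclidean_space set"
  assumes \<Omega>: "open \<Omega>" "bounded \<Omega>" and f: "continuous_on (closure \<Omega>) f"
    and ker: "\<And>i. i \<in> {1, 2} \<Longrightarrow> levy_kernel s lam Lam (\<eta> i) (\<kappa> i)"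
    and sl: "0 < s" "s < 1" "0 < lam"
    and u: "continuous_on UNIV u" "\<And>x. x \<notin> \<Omega> \<Longrightarrow> u x = 0" "viscosity_supersolution s \<eta> \<Omega> f u"
    and uc: "obstacle_iteration s \<eta> \<Omega> f uc" "\<And>k. continuous_on UNIV (uc k)" "\<And>k x. x \<notin> \<Omega> \<Longrightarrow> uc k x = 0"
  shows "uc k x \<le> u x"
proof -
  have visc: "\<exists>i\<in>{j}. f x \<le> frac_op s (\<eta> i) (replace_on N \<phi> u) x"
    if "j \<in> {1, 2}" "open N" "x \<in> N" "N \<subseteq> \<Omega>" "C2_function \<phi>" "\<phi> x = u x" "\<forall>y\<in>N. \<phi> y \<le> u y" for j x N \<phi>
  proof -
    have "f x \<le> min (frac_op s (\<eta> 1) (replace_on N \<phi> u) x) (frac_op s (\<eta> 2) (replace_on N \<phi> u) x)"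
      using u(3) that(2-7) unfolding viscosity_supersolution_def by blast
    then show ?thesis using that(1) by auto
  qed
  have setting: "weak_obstacle_setting s lam Lam (\<eta> i) (\<kappa> i) \<Omega> (uc k) \<rho> x0 \<epsilon>"
    if "i \<in> {1, 2}" "0 < \<epsilon>" "cball x0 \<epsilon> \<subseteq> \<Omega>" "C2_function \<rho>" "\<forall>x. 0 \<le> \<rho> x" "\<forall>x. \<epsilon> \<le> norm x \<longrightarrow> \<rho> x = 0"
    for i k \<rho> x0 \<epsilon>
    using ker[OF that(1)] that \<Omega> uc(2,3)
    by (intro weak_obstacle_setting.intro weak_obstacle_setting_axioms.intro) blast+
  show ?thesis
  proof (induction k arbitrary: x)
    case 0
    show ?case
    proof (rule viscosity_comparison[OF \<Omega> f _ uc(2,3) u(1,2) _ _ sl, where I="{1}" and \<eta>=\<eta> and k=\<kappa> and Lam=Lam])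
      fix x0 :: 'a and \<epsilon> :: real and \<rho> :: "'a \<Rightarrow> real" and i :: nat
      assume a: "i \<in> {1::nat}" "0 < \<epsilon>" "cball x0 \<epsilon> \<subseteq> {x \<in> \<Omega>. u x < uc 0 x}" "C2_function \<rho>" "\<forall>x. 0 \<le> \<rho> x"
        "\<forall>x. \<epsilon> \<le> norm x \<longrightarrow> \<rho> x = 0"
      have i: "i \<in> {1, 2}" and sub: "cball x0 \<epsilon> \<subseteq> \<Omega>" using a(1,3) by auto
      have "weak_solution s (\<eta> i) \<Omega> f (uc 0)"
        using a(1) uc(1) by (simp add: obstacle_iteration_def)
      from weak_obstacle_setting.weak_solution_mollified[OF setting[OF i a(2) sub a(4-6)] this]
      show "levy_kernel.sym_op s (\<kappa> i) (conv (uc 0) \<rho>) x0 \<le> (LINT x:\<Omega>|lebesgue. f x * \<rho> (x0 - x))"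
        by simp
    qed (use visc[of 1] ker in auto)
  next
    case (Suc k)
    let ?i = "iter_index (Suc k)"
    have obst: "weak_obstacle_solution s (\<eta> ?i) \<Omega> f (uc k) (uc (Suc k))"
      using uc(1) unfolding obstacle_iteration_def by (metis diff_Suc_1 le_add1 plus_1_eq_Suc)
    show ?case
    proof (rule viscosity_comparison[OF \<Omega> f _ uc(2,3) u(1,2) _ _ sl, where I="{?i}" and \<eta>=\<eta> and k=\<kappa> and Lam=Lam])
      fix x0 :: 'a and \<epsilon> :: real and \<rho> :: "'a \<Rightarrow> real" and i :: nat
      assume a: "i \<in> {?i}" "0 < \<epsilon>" "cball x0 \<epsilon> \<subseteq> {x \<in> \<Omega>. u x < uc (Suc k) x}" "C2_function \<rho>" "\<forall>x. 0 \<le> \<rho> x"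
        "\<forall>x. \<epsilon> \<le> norm x \<longrightarrow> \<rho> x = 0"
      have i: "i \<in> {1, 2}" using a(1) iter_index_mem by simp
      have sub: "cball x0 \<epsilon> \<subseteq> \<Omega>" using a(3) by blast
      show "levy_kernel.sym_op s (\<kappa> i) (conv (uc (Suc k)) \<rho>) x0 \<le> (LINT x:\<Omega>|lebesgue. f x * \<rho> (x0 - x))"
      proof (rule weak_obstacle_setting.weak_obstacle_subsolution[OF setting[OF i a(2) sub a(4-6)]])
        show "weak_obstacle_solution s (\<eta> i) \<Omega> f (uc k) (uc (Suc k))" using obst a(1) by simp
        show "continuous_on \<Omega> (uc k)" by (rule continuous_on_subset[OF uc(2) subset_UNIV])
        show "uc k x < uc (Suc k) x" if "x \<in> cball x0 \<epsilon>" for x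
          using Suc.IH[of x] a(3) that by fastforce
      qed
    qed (use visc[OF iter_index_mem] ker iter_index_mem in auto)
  qed
qed

text \<open>Each operator governs every second step, so the limit inherits the supersolution
  inequality of both. Negating the functions leads to \<open>viscosity_comparison\<close>; as the
  subsolution property of \<open>u\<close> controls only the smaller of the two operators, the index
  set contains both.\<close>

lemma subsolution_le_obstacle_limit:
  fixes \<Omega> :: "'a::euclidean_space set"
  assumes \<Omega>: "open \<Omega>" "bounded \<Omega>" and f: "continuous_on (closure \<Omega>) f"
    and ker: "\<And>i. i \<in> {1, 2} \<Longrightarrow> levy_kernel s lam Lam (\<eta> i) (\<kappa> i)"
    and sl: "0 < s" "s < 1" "0 < lam"
    and u: "continuous_on UNIV u" "\<And>x. x \<notin> \<Omega> \<Longrightarrow> u x = 0" "viscosity_subsolution s \<eta> \<Omega> f u"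
    and uc: "obstacle_iteration s \<eta> \<Omega> f uc" "\<And>k. continuous_on UNIV (uc k)" "\<And>k x. x \<notin> \<Omega> \<Longrightarrow> uc k x = 0"
    and lim: "uniform_limit UNIV uc ul sequentially"
  shows "u x \<le> ul x"
proof -
  have ul: "continuous_on UNIV ul"
    using uniform_limit_theorem[OF _ lim] uc(2) by simp
  have ul0: "ul x = 0" if "x \<notin> \<Omega>" for x
    using tendsto_uniform_limitI[OF lim, of x] uc(3)[OF that] by (simp add: LIMSEQ_const_iff)
  obtain c where c: "\<Omega> \<subseteq> cbox (- c) c"
    using bounded_subset_cbox_symmetric[OF \<Omega>(2)] by metis
  have super: "(LINT x:\<Omega>|lebesgue. f x * \<rho> (x0 - x)) \<le> levy_kernel.sym_op s (\<kappa> i) (conv ul \<rho>) x0"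
    if i: "i \<in> {1, 2}" and h: "0 < \<epsilon>" "cball x0 \<epsilon> \<subseteq> \<Omega>" "C2_function \<rho>" "\<forall>x. 0 \<le> \<rho> x" "\<forall>x. \<epsilon> \<le> norm x \<longrightarrow> \<rho> x = 0"
    for i x0 \<epsilon> \<rho>
  proof (rule field_le_epsilon)
    fix e :: real assume e: "0 < e"
    interpret levy_kernel s lam Lam "\<eta> i" "\<kappa> i" by (rule ker[OF i])
    have supp: "\<epsilon> \<le> norm x \<Longrightarrow> \<rho> x = 0" for x using h(5) by blast
    obtain C where C: "\<And>g h M. continuous_on UNIV g \<Longrightarrow> (\<forall>x. x \<notin> cbox (- c) c \<longrightarrow> g x = 0)
      \<Longrightarrow> continuous_on UNIV h \<Longrightarrow> (\<forall>x. x \<notin> cbox (- c) c \<longrightarrow> h x = 0) \<Longrightarrow> (\<forall>x. \<bar>g x - h x\<bar> \<le> M)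
      \<Longrightarrow> \<bar>sym_op (conv g \<rho>) x0 - sym_op (conv h \<rho>) x0\<bar> \<le> C * M"
      using sym_op_conv_diff_bound[OF h(3) supp, where a="- c" and c=c] by metis
    \<comment> \<open>The sign of \<open>C\<close> is unknown, hence the absolute value; the
      \<open>1\<close> avoids a zero denominator.\<close>
    define d where "d = e / (\<bar>C\<bar> + 1)"
    have d: "0 < d" using e by (simp add: d_def)
    have Cd: "C * d \<le> e"
    proof -
      have "C * d \<le> (\<bar>C\<bar> + 1) * d" using d by (intro mult_right_mono) auto
      then show ?thesis by (simp add: d_def)
    qed
    obtain K where K: "\<And>k x. K \<le> k \<Longrightarrow> dist (uc k x) (ul x) < d"
      using uniform_limitD[OF lim d] unfolding eventually_sequentially by blast
    \<comment> \<open>\<open>iter_index (Suc j)\<close> is 1 for odd \<open>j\<close> and 2 for even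
      \<open>j\<close>; either choice gives a step beyond \<open>K\<close> governed by operator
      \<open>i\<close>.\<close>
    define j where "j = (if i = 1 then 2 * K + 1 else 2 * K)"
    have j: "iter_index (Suc j) = i" "K \<le> Suc j" using i by (auto simp: j_def iter_index_def)
    have "weak_obstacle_solution s (\<eta> (iter_index (Suc j))) \<Omega> f (uc j) (uc (Suc j))"
      using uc(1) unfolding obstacle_iteration_def by (metis diff_Suc_1 le_add1 plus_1_eq_Suc)
    then have obst: "weak_obstacle_solution s (\<eta> i) \<Omega> f (uc j) (uc (Suc j))" unfolding j .
    have "weak_obstacle_setting s lam Lam (\<eta> i) (\<kappa> i) \<Omega> (uc (Suc j)) \<rho> x0 \<epsilon>"
      using ker[OF i] h \<Omega> uc(2,3)
      by (intro weak_obstacle_setting.intro weak_obstacle_setting_axioms.intro) blast+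
    then have "(LINT x:\<Omega>|lebesgue. f x * \<rho> (x0 - x)) \<le> sym_op (conv (uc (Suc j)) \<rho>) x0"
      using obst by (rule weak_obstacle_setting.weak_obstacle_supersolution)
    moreover have "\<bar>sym_op (conv (uc (Suc j)) \<rho>) x0 - sym_op (conv ul \<rho>) x0\<bar> \<le> C * d"
    proof (rule C)
      show "\<forall>x. x \<notin> cbox (- c) c \<longrightarrow> uc (Suc j) x = 0" "\<forall>x. x \<notin> cbox (- c) c \<longrightarrow> ul x = 0"
        using c uc(3) ul0 by blast+
      show "\<forall>x. \<bar>uc (Suc j) x - ul x\<bar> \<le> d" using K[OF j(2)] by (simp add: dist_real_def less_imp_le)
    qed (rule uc(2) ul)+
    ultimately show "(LINT x:\<Omega>|lebesgue. f x * \<rho> (x0 - x)) \<le> sym_op (conv ul \<rho>) x0 + e"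
      using Cd by linarith
  qed
  have "- ul x \<le> - u x"
  proof (rule viscosity_comparison[OF \<Omega> _ _ _ _ _ _ _ _ sl, where I="{1, 2}" and \<eta>=\<eta> and k=\<kappa> and Lam=Lam and f="\<lambda>x. - f x"])
    fix x0 :: 'a and \<epsilon> :: real and \<rho> :: "'a \<Rightarrow> real" and i :: nat
    assume a: "i \<in> {1::nat, 2}" "0 < \<epsilon>" "cball x0 \<epsilon> \<subseteq> {x \<in> \<Omega>. - u x < - ul x}" "C2_function \<rho>" "\<forall>x. 0 \<le> \<rho> x"
      "\<forall>x. \<epsilon> \<le> norm x \<longrightarrow> \<rho> x = 0"
    have sub: "cball x0 \<epsilon> \<subseteq> \<Omega>" using a(3) by blast
    have "conv (\<lambda>x. - ul x) \<rho> = (\<lambda>x. - conv ul \<rho> x)" by (simp add: conv_def fun_eq_iff)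
    then show "levy_kernel.sym_op s (\<kappa> i) (conv (\<lambda>x. - ul x) \<rho>) x0 \<le> (LINT x:\<Omega>|lebesgue. - f x * \<rho> (x0 - x))"
      using super[OF a(1,2) sub a(4-6)] sym_op_uminus[OF ker[OF a(1)]]
      by (simp add: set_lebesgue_integral_def)
  next
    fix x :: 'a and N and \<phi> :: "'a \<Rightarrow> real"
    assume a: "open N" "x \<in> N" "N \<subseteq> \<Omega>" "C2_function \<phi>" "\<phi> x = - u x" "\<forall>y\<in>N. \<phi> y \<le> - u y"
      and op: "\<And>i. i \<in> {1, 2} \<Longrightarrow> \<exists>l. has_frac_op s (\<eta> i) (replace_on N \<phi> (\<lambda>x. - u x)) x l"
    let ?v = "replace_on N (\<lambda>y. - \<phi> y) u"
    have vv: "(\<lambda>y. - replace_on N \<phi> (\<lambda>x. - u x) y) = ?v" by (auto simp: replace_on_def)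
    \<comment> \<open>\<open>frac_op\<close> is a definite description, so the sign can be moved out
      only once the principal value is known to exist; this is the purpose of the existence premise
      in \<open>viscosity_comparison\<close>.\<close>
    have neg: "frac_op s (\<eta> i) (replace_on N \<phi> (\<lambda>x. - u x)) x = - frac_op s (\<eta> i) ?v x" if i: "i \<in> {1, 2}" for i
    proof -
      obtain l where l: "has_frac_op s (\<eta> i) (replace_on N \<phi> (\<lambda>x. - u x)) x l" using op[OF i] by blast
      show ?thesis
        using frac_op_eq[OF l] frac_op_eq[OF has_frac_op_uminus[OF l]] unfolding vv by simp
    qed
    have "C2_function (\<lambda>y. - \<phi> y)" using C2_function_scale[OF a(4), of "- 1"] by simp
    moreover have "- \<phi> x = u x" "\<forall>y\<in>N. u y \<le> - \<phi> y" using a(5,6) by force+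
    ultimately have "min (frac_op s (\<eta> 1) ?v x) (frac_op s (\<eta> 2) ?v x) \<le> f x"
      using u(3) a(1-3) unfolding viscosity_subsolution_def by blast
    then show "\<exists>i\<in>{1, 2}. - f x \<le> frac_op s (\<eta> i) (replace_on N \<phi> (\<lambda>x. - u x)) x"
      using neg by (auto simp: min_def split: if_splits)
  next
    show "continuous_on (closure \<Omega>) (\<lambda>x. - f x)" "continuous_on UNIV (\<lambda>x. - ul x)" "continuous_on UNIV (\<lambda>x. - u x)"
      using f ul u(1) by (auto intro: continuous_on_minus)
  qed (use ul0 u(2) ker in auto)
  then show ?thesis by simp
qed

subsection \<open>Convergence of the discrete iteration\<close>

lemma kernel_class_levy_kernel:
  assumes "0 < s" "s < 1" "0 < lam" "lam \<le> Lam" and \<eta>: "kernel_class lam Lam \<eta>"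
  shows "\<exists>k. levy_kernel s lam Lam \<eta> k"
proof (rule kernel_class_borel_representative[OF \<eta> \<open>lam \<le> Lam\<close>])
  fix k
  assume "k \<in> borel_measurable borel" "\<And>z. k (- z) = k z" "\<And>z. lam \<le> k z" "\<And>z. k z \<le> Lam"
    "AE z in lborel. \<eta> (sgn z) = k z"
  then have "levy_kernel s lam Lam \<eta> k" using assms(1-4) by (intro levy_kernel.intro)
  then show ?thesis by blast
qed

theorem theorem6p7:
  fixes \<Omega> :: "'a::euclidean_space set"
    and s lam Lam \<mu> :: real
    and \<eta> :: "nat \<Rightarrow> 'a \<Rightarrow> real"
    and f u :: "'a \<Rightarrow> real"
    and uc :: "nat \<Rightarrow> 'a \<Rightarrow> real"
    and H :: "real set"
    and \<T> :: "real \<Rightarrow> 'a set set"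
    and eps :: "real \<Rightarrow> 'a \<Rightarrow> real"
    and uh ut :: "real \<Rightarrow> nat \<Rightarrow> 'a \<Rightarrow> real"
    and \<sigma> :: "real \<Rightarrow> real"
    and ks :: "nat \<Rightarrow> nat"
    and hs :: "nat \<Rightarrow> real"
  assumes s: "0 < s" "s < 1"
    and \<Omega>: "open \<Omega>" "\<Omega> \<noteq> {}" "convex \<Omega>" "polytope (closure \<Omega>)"
    and ellipticity: "0 < lam" "lam \<le> Lam"
    and \<eta>: "\<forall>i\<in>{1, 2}. kernel_class lam Lam (\<eta> i)"
    and f: "continuous_on (closure \<Omega>) f"
    and barrier: "\<exists>U. C2_function U \<and>
          (\<forall>i\<in>{1, 2}. \<forall>x\<in>\<Omega>. \<exists>l. has_frac_op s (\<eta> i) U x l \<and> f x \<le> l) \<and>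
          (\<forall>x\<in>- closure \<Omega>. 0 \<le> U x)"
    and u: "viscosity_solution s \<eta> \<Omega> f u"
    and uc: "obstacle_iteration s \<eta> \<Omega> f uc"
    and mesh: "1 \<le> \<mu>" "graded_mesh_family \<Omega> \<mu> H \<T>"
    and eps: "\<forall>h\<in>H. admissible_scale \<Omega> (\<T> h) (eps h)"
    and uh: "\<forall>h\<in>H. discrete_iteration s \<eta> \<Omega> f (\<T> h) (eps h) (uh h)"
    and ut: "\<forall>h\<in>H. auxiliary_functions s \<eta> \<Omega> f (\<T> h) (eps h) uc (uh h) (ut h)"
    and \<sigma>: "continuous_on {0<..} \<sigma>" "\<forall>h>0. 0 \<le> \<sigma> h" "(\<sigma> \<longlongrightarrow> 0) (at_right 0)"
    and rate: "\<forall>h\<in>H. (SUP k. Linf_norm \<Omega> (\<lambda>x. uc k x - ut h k x)) \<le> ereal (\<sigma> h)"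
    and limits: "filterlim ks at_top sequentially"
          "\<forall>n. hs n \<in> H" "hs \<longlonglongrightarrow> 0"
          "(\<lambda>n. real (ks n) * \<sigma> (hs n)) \<longlonglongrightarrow> 0"
  shows "uniform_limit UNIV (\<lambda>n. uh (hs n) (ks n)) u sequentially"
proof -
  have bdd: "bounded \<Omega>"
    using polytope_imp_bounded[OF \<Omega>(4)] closure_subset bounded_subset by blast
  have Hpos: "0 < h" and mesh_h: "conforming_mesh \<Omega> (\<T> h)" if "h \<in> H" for h
    using mesh(2) that by (auto simp: graded_mesh_family_def)
  have hs: "hs n \<in> H" for n using limits(2) by simp
  have \<sigma>0: "0 \<le> \<sigma> h" if "h \<in> H" for h using \<sigma>(2) Hpos[OF that] by simp
  have "\<exists>\<kappa>. levy_kernel s lam Lam (\<eta> i) \<kappa>" if "i \<in> {1, 2}" for i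
  proof -
    have "kernel_class lam Lam (\<eta> i)" using \<eta> that by blast
    then have "\<exists>\<kappa>. levy_kernel s lam Lam (\<eta> i) \<kappa>" by (rule kernel_class_levy_kernel[OF s ellipticity])
    then show ?thesis .
  qed
  then obtain \<kappa> where ker: "\<And>i. i \<in> {1, 2} \<Longrightarrow> levy_kernel s lam Lam (\<eta> i) (\<kappa> i)"
    by metis
  have uc_Hs: "uc k \<in> Hs_tilde s \<Omega>" for k
  proof (cases k)
    case 0
    then show ?thesis using uc by (simp add: obstacle_iteration_def weak_solution_def)
  next
    case (Suc j)
    then show ?thesis
      using uc by (auto simp: obstacle_iteration_def weak_obstacle_solution_def obstacle_set_def)
  qed
  have uc0: "uc k x = 0" if "x \<notin> \<Omega>" for k x
    using uc_Hs[of k] that by (simp add: Hs_tilde_def)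
  have uc_cont\<Omega>: "continuous_on \<Omega> (uc k)" for k using uc by (simp add: obstacle_iteration_def)
  have ut_fe: "ut h k \<in> fe_space \<Omega> (\<T> h)" if h: "h \<in> H" for h k
  proof (cases k)
    case 0
    then show ?thesis
      using ut uh h by (simp add: auxiliary_functions_def discrete_iteration_def discrete_solution_def)
  next
    case (Suc j)
    then show ?thesis
      using ut h by (auto simp: auxiliary_functions_def discrete_obstacle_solution_def)
  qed
  have uh_fe: "uh h k \<in> fe_space \<Omega> (\<T> h)" if h: "h \<in> H" for h k
    using uh h by (cases k) (auto simp: discrete_iteration_def discrete_solution_def discrete_obstacle_solution_def)
  have ut_cont: "continuous_on UNIV (ut h k)" if h: "h \<in> H" for h k
    using ut_fe[OF h, of k] \<Omega>(1) by (intro continuous_on_zero_extension) (auto simp: fe_space_def)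
  \<comment> \<open>Inside \<Omega> both functions are continuous, so the essential supremum bounds
    every value; outside they vanish.\<close>
  have close: "\<bar>uc k x - ut h k x\<bar> \<le> \<sigma> h" if h: "h \<in> H" for h k x
  proof (cases "x \<in> \<Omega>")
    case True
    have "Linf_norm \<Omega> (\<lambda>x. uc k x - ut h k x) \<le> (SUP k. Linf_norm \<Omega> (\<lambda>x. uc k x - ut h k x))"
      by (rule SUP_upper) simp
    also have "\<dots> \<le> ereal (\<sigma> h)" using rate h by blast
    finally have le: "Linf_norm \<Omega> (\<lambda>x. uc k x - ut h k x) \<le> ereal (\<sigma> h)" .
    have "continuous_on \<Omega> (\<lambda>x. uc k x - ut h k x)"
      by (intro continuous_on_diff uc_cont\<Omega> continuous_on_subset[OF ut_cont[OF h] subset_UNIV])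
    from Linf_norm_le_imp_le[OF \<Omega>(1) this le True] show ?thesis .
  next
    case False
    then show ?thesis using uc0 ut_fe[OF h, of k] \<sigma>0[OF h] by (simp add: fe_space_def)
  qed
  \<comment> \<open>The \<open>hs n\<close> are positive, so they tend to \<open>0\<close> from the
    right, as the hypothesis on \<open>\<sigma>\<close> requires.\<close>
  have \<sigma>lim: "(\<lambda>n. \<sigma> (hs n)) \<longlonglongrightarrow> 0"
  proof (rule filterlim_compose[OF \<sigma>(3)])
    show "filterlim hs (at_right 0) sequentially"
      unfolding filterlim_at using limits(3) Hpos[OF hs]
      by (auto intro!: always_eventually simp: less_imp_neq[symmetric])
  qed
  \<comment> \<open>By definition the iterates are continuous only inside \<Omega>; continuity
    across the boundary comes from uniform approximation by the globally continuous
    \<open>ut (hs n) k\<close>.\<close>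
  have uc_cont: "continuous_on UNIV (uc k)" for k
  proof (rule uniform_limit_theorem[where F=sequentially and f="\<lambda>n. ut (hs n) k"])
    show "\<forall>\<^sub>F n in sequentially. continuous_on UNIV (ut (hs n) k)"
      using ut_cont[OF hs] by simp
    show "uniform_limit UNIV (\<lambda>n. ut (hs n) k) (uc k) sequentially"
    proof (rule uniform_limitI)
      fix e :: real assume "0 < e"
      then have "\<forall>\<^sub>F n in sequentially. \<sigma> (hs n) < e" using order_tendstoD(2)[OF \<sigma>lim] by simp
      then show "\<forall>\<^sub>F n in sequentially. \<forall>x\<in>UNIV. dist (ut (hs n) k x) (uc k x) < e"
      proof eventually_elim
        case (elim n)
        then show ?case using close[OF hs[of n]] by (auto simp: dist_real_def abs_minus_commute intro: le_less_trans)
      qed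
    qed
  qed simp
  have u_cont: "continuous_on UNIV u" and visc: "viscosity_subsolution s \<eta> \<Omega> f u" "viscosity_supersolution s \<eta> \<Omega> f u"
    using u by (auto simp: viscosity_solution_def)
  have u0: "u x = 0" if "x \<notin> \<Omega>" for x
    using zero_on_frontier[OF \<Omega>(1,3) u_cont _ that] u by (simp add: viscosity_solution_def)
  have uc_le: "uc k x \<le> u x" for k x
    by (rule obstacle_iteration_le_supersolution[OF \<Omega>(1) bdd f ker s ellipticity(1) u_cont u0 visc(2) uc uc_cont uc0])
  have uc_mono: "uc k x \<le> uc (Suc k) x" for k x
  proof (cases "x \<in> \<Omega>")
    case True
    have "weak_obstacle_solution s (\<eta> (iter_index (Suc k))) \<Omega> f (uc k) (uc (Suc k))"
      using uc unfolding obstacle_iteration_def by (metis diff_Suc_1 le_add1 plus_1_eq_Suc)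
    then have "AE x in lebesgue. x \<in> \<Omega> \<longrightarrow> uc k x \<le> uc (Suc k) x"
      by (simp add: weak_obstacle_solution_def obstacle_set_def)
    then show ?thesis by (rule AE_le_imp_le_on_open[OF \<Omega>(1) uc_cont\<Omega> uc_cont\<Omega> _ True])
  qed (simp add: uc0)
  have "uniformly_Cauchy_on UNIV uc"
  proof (rule uniformly_Cauchy_on_if_close_to_fe_space)
    fix e :: real assume "0 < e"
    then have "\<forall>\<^sub>F n in sequentially. \<sigma> (hs n) < e" using order_tendstoD(2)[OF \<sigma>lim] by simp
    then obtain n where "\<sigma> (hs n) < e" by (auto simp: eventually_sequentially)
    then have "\<bar>uc k x - ut (hs n) k x\<bar> \<le> e" for k x
      using close[OF hs[of n], of k x] by linarith
    then show "\<exists>\<T> v. conforming_mesh \<Omega> \<T> \<and> (\<forall>k. v k \<in> fe_space \<Omega> \<T>) \<and> (\<forall>k x. \<bar>uc k x - v k x\<bar> \<le> e)"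
      using mesh_h[OF hs[of n]] ut_fe[OF hs[of n]] by blast
  next
    fix x
    have inc: "incseq (\<lambda>k. uc k x)" by (intro incseq_SucI uc_mono)
    obtain l where "(\<lambda>k. uc k x) \<longlonglongrightarrow> l"
      using incseq_convergent[OF inc, of "u x"] uc_le by blast
    then show "convergent (\<lambda>k. uc k x)" by (rule convergentI)
  qed
  then obtain ul where lim: "uniform_limit UNIV uc ul sequentially"
    using Cauchy_uniformly_convergent unfolding uniformly_convergent_on_def by blast
  have "ul x = u x" for x
  proof (rule antisym)
    show "ul x \<le> u x"
      using tendsto_uniform_limitI[OF lim, of x] uc_le by (intro LIMSEQ_le_const2) auto
    show "u x \<le> ul x"
      by (rule subsolution_le_obstacle_limit[OF \<Omega>(1) bdd f ker s ellipticity(1) u_cont u0 visc(1) uc uc_cont uc0 lim])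
  qed
  then have "ul = u" by (rule ext)
  then have lim_u: "uniform_limit UNIV uc u sequentially" using lim by simp
  have eps_pos: "0 < eps h z" if h: "h \<in> H" and z: "z \<in> interior_vertices \<Omega> (\<T> h)" for h z
    using patch_radius_pos[OF mesh_h[OF h] \<Omega>(1) bdd z] eps h z unfolding admissible_scale_def by force
  have disc: "\<bar>uh h k x - ut h k x\<bar> \<le> real k * \<sigma> h" if h: "h \<in> H" for h k x
  proof (induction k arbitrary: x)
    case 0
    then show ?case using ut h by (simp add: auxiliary_functions_def)
  next
    case (Suc k)
    interpret levy_kernel s lam Lam "\<eta> (iter_index (Suc k))" "\<kappa> (iter_index (Suc k))"
      by (rule ker[OF iter_index_mem])
    let ?sol = "discrete_obstacle_solution s (\<eta> (iter_index (Suc k))) \<Omega> f (\<T> h) (eps h)"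
    let ?I = "lagrange_interp (\<T> h) (uc k)"
    have 1: "?sol (uh h k) (uh h (Suc k))"
      using uh h unfolding discrete_iteration_def by (metis diff_Suc_1 le_add1 plus_1_eq_Suc)
    have 2: "?sol ?I (ut h (Suc k))"
      using ut h unfolding auxiliary_functions_def by (metis diff_Suc_1 le_add1 plus_1_eq_Suc)
    \<comment> \<open>Interpolation is exact at vertices, so the obstacles are \<open>uh h k\<close>
      and \<open>uc k\<close>; passing through \<open>ut h k\<close> adds one
      \<open>\<sigma> h\<close> to the induction bound.\<close>
    have obst: "\<bar>uh h k z - ?I z\<bar> \<le> real (Suc k) * \<sigma> h" if "z \<in> interior_vertices \<Omega> (\<T> h)" for z
    proof -
      have "?I z = uc k z"
        using lagrange_interp_vertex[OF mesh_h[OF h]] that by (simp add: interior_vertices_def)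
      then show ?thesis using Suc.IH[of z] close[OF h, of k z] by (simp add: algebra_simps)
    qed
    have nn: "0 \<le> real (Suc k) * \<sigma> h" using \<sigma>0[OF h] by simp
    note comp = discrete_obstacle_comparison[OF mesh_h[OF h] \<Omega>(1) bdd eps_pos[OF h]]
    have "uh h (Suc k) x - ut h (Suc k) x \<le> real (Suc k) * \<sigma> h"
      by (rule comp[OF _ 1 2 nn]) (use obst abs_le_D1 in blast)+
    moreover have "ut h (Suc k) x - uh h (Suc k) x \<le> real (Suc k) * \<sigma> h"
    proof (rule comp[OF _ 2 1 nn])
      show "?I z - uh h k z \<le> real (Suc k) * \<sigma> h" if "z \<in> interior_vertices \<Omega> (\<T> h)" for z
        using obst[OF that] by linarith
    qed
    ultimately show ?case by linarith
  qed
  show ?thesis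
  proof (rule uniform_limitI)
    fix e :: real assume e: "0 < e"
    \<comment> \<open>Three errors share \<open>e\<close>: stopping the iteration at
      \<open>ks n\<close>, the auxiliary discretization, and the accumulated perturbation of the
      discrete obstacles.\<close>
    have "\<forall>\<^sub>F k in sequentially. \<forall>x\<in>UNIV. dist (uc k x) (u x) < e / 3"
      by (rule uniform_limitD[OF lim_u]) (use e in simp)
    then have "\<forall>\<^sub>F n in sequentially. \<forall>x\<in>UNIV. dist (uc (ks n) x) (u x) < e / 3"
      by (rule eventually_compose_filterlim[OF _ limits(1)])
    moreover have "\<forall>\<^sub>F n in sequentially. \<sigma> (hs n) < e / 3"
      by (rule order_tendstoD(2)[OF \<sigma>lim]) (use e in simp)
    moreover have "\<forall>\<^sub>F n in sequentially. real (ks n) * \<sigma> (hs n) < e / 3"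
      by (rule order_tendstoD(2)[OF limits(4)]) (use e in simp)
    ultimately show "\<forall>\<^sub>F n in sequentially. \<forall>x\<in>UNIV. dist (uh (hs n) (ks n) x) (u x) < e"
    proof eventually_elim
      case (elim n)
      show ?case
      proof
        fix x
        have "dist (uc (ks n) x) (u x) < e / 3" using elim(1) by simp
        then show "dist (uh (hs n) (ks n) x) (u x) < e"
          using elim(2,3) disc[OF hs[of n], of "ks n" x] close[OF hs[of n], of "ks n" x]
          unfolding dist_real_def by linarith
      qed
    qed
  qed
qed

end
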